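(* Let $p$ be an odd prime. Then the minimal number of $p$-periodic billiard trajectories in the circle $S^1$ is $$BT_p(S^1)=p-1.$$
   Context: Let $M$ be a smooth closed manifold smoothly embedded in a Euclidean space $\mathbb{R}^n$, and let $p$ be an odd prime. Indices $i$ are taken in $\mathbb{Z}_p$ (cyclically). A $p$-periodic billiard trajectory is a tuple $(x_1,\dots,x_p)\in M^p$ with $x_i\neq x_{i+1}$ for all $i\in\mathbb{Z}_p$ such that for every $i\in\mathbb{Z}_p$ the vector $\frac{x_i-x_{i+1}}{\|x_i-x_{i+1}\|}+\frac{x_i-x_{i-1}}{\|x_i-x_{i-1}\|}$ is orthogonal to the tangent space $T_{x_i}M$. Tuples are considered (and trajectories counted) up to the action on $M^p$ of the dihedral group $D_p$ generated by $(x_1,x_2,\dots,x_p)\mapsto(x_2,\dots,x_p,x_1)$ and $(x_1,x_2,\dots,x_p)\mapsto(x_p,x_{p-1},\dots,x_1)$. $\Delta\subset M^p/D_p$ is the set of classes of tuples with $x_i=x_{i+1}$ for some $i\in\mathbb{Z}_p$. The length function is $f(x_1,\dots,x_p)=\sum_{i\in\mathbb{Z}_p}\|x_i-x_{i+1}\|$ on $M^p/D_p$; it is smooth on $(M^p/D_p)\setminus\Delta$ (a manifold, since $D_p$ acts freely there), and its critical points there are exactly the $p$-periodic billiard trajectories. Standing genericity assumption: only embeddings for which $f$ is a Morse function on $(M^p/D_p)\setminus\Delta$ are considered. $BT_p(M)$ denotes the minimal number of $p$-periodic billiard trajectories (up to $D_p$), the minimum being over all smooth embeddings of $M$ into Euclidean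 spaces satisfying this assumption. *)

theory Defs
  imports
    "HOL-Analysis.Analysis"
    "HOL-Library.Extended_Nat"
    "HOL-Computational_Algebra.Primes"
begin

text \<open>
  The circle is \<^term>\<open>sphere 0 1 :: complex set\<close>, with the smooth structure given by the
  local coordinates \<open>s \<mapsto> z * cis s\<close>. Since the dimension of the ambient Euclidean space is
  quantified over, \<open>\<real>\<^sup>n\<close> is the library's \<^const>\<open>Euclidean_space\<close>, whose points are the
  functions \<^typ>\<open>nat \<Rightarrow> real\<close> vanishing at all indices \<open>\<ge> n\<close>.
\<close>

definition inner_n :: "nat \<Rightarrow> (nat \<Rightarrow> real) \<Rightarrow> (nat \<Rightarrow> real) \<Rightarrow> real" where
  "inner_n n v w = (\<Sum>k<n. v k * w k)"

definition norm_n :: "nat \<Rightarrow> (nat \<Rightarrow> real) \<Rightarrow> real" where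
  "norm_n n v = L2_set v {..<n}"

subsection \<open>Smooth embeddings of the circle\<close>

definition smooth_real :: "(real \<Rightarrow> real) \<Rightarrow> bool" where
  "smooth_real g \<longleftrightarrow> (\<forall>m t. (deriv ^^ m) g field_differentiable at t)"

definition velocity :: "(complex \<Rightarrow> nat \<Rightarrow> real) \<Rightarrow> complex \<Rightarrow> nat \<Rightarrow> real" where
  "velocity e z = (\<lambda>k. deriv (\<lambda>s. e (z * cis s) k) 0)"

definition tangent_space :: "(complex \<Rightarrow> nat \<Rightarrow> real) \<Rightarrow> complex \<Rightarrow> (nat \<Rightarrow> real) set" where
  "tangent_space e z = {v. \<exists>c. v = (\<lambda>k. c * velocity e z k)}"

text \<open>Smooth map, immersion, and homeomorphism onto the image.\<close>

definition smooth_embedding :: "nat \<Rightarrow> (complex \<Rightarrow> nat \<Rightarrow> real) \<Rightarrow> bool" where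
  "smooth_embedding n e \<longleftrightarrow>
     (\<forall>k<n. smooth_real (\<lambda>t. e (cis t) k)) \<and>
     (\<forall>z\<in>sphere 0 1. \<exists>k<n. velocity e z k \<noteq> 0) \<and>
     embedding_map (top_of_set (sphere 0 1)) (Euclidean_space n) e"

subsection \<open>Periodic billiard trajectories\<close>

text \<open>
  A tuple \<open>(x\<^sub>1, \<dots>, x\<^sub>p)\<close> is a list of points of the abstract circle; the corresponding
  point of the embedded curve is \<open>e x\<^sub>i\<close>. Positions are read cyclically. The tuples below
  are those of \<open>M\<^sup>p\<close> whose class lies outside of \<open>\<Delta>\<close>.
\<close>

definition next_index :: "nat \<Rightarrow> nat \<Rightarrow> nat" where
  "next_index p i = (i + 1) mod p"

definition prev_index :: "nat \<Rightarrow> nat \<Rightarrow> nat" where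
  "prev_index p i = (i + p - 1) mod p"

definition admissible_tuples :: "nat \<Rightarrow> complex list set" where
  "admissible_tuples p = {xs. length xs = p \<and> set xs \<subseteq> sphere 0 1 \<and>
     (\<forall>i<p. xs ! i \<noteq> xs ! next_index p i)}"

definition unit_diff :: "nat \<Rightarrow> (nat \<Rightarrow> real) \<Rightarrow> (nat \<Rightarrow> real) \<Rightarrow> nat \<Rightarrow> real" where
  "unit_diff n a b = (\<lambda>k. (a k - b k) / norm_n n (\<lambda>l. a l - b l))"

definition billiard_trajectories ::
    "nat \<Rightarrow> nat \<Rightarrow> (complex \<Rightarrow> nat \<Rightarrow> real) \<Rightarrow> complex list set" where
  "billiard_trajectories p n e = {xs \<in> admissible_tuples p.
     \<forall>i<p. \<forall>v\<in>tangent_space e (xs ! i).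
       inner_n n (\<lambda>k. unit_diff n (e (xs ! i)) (e (xs ! next_index p i)) k
                     + unit_diff n (e (xs ! i)) (e (xs ! prev_index p i)) k) v = 0}"

text \<open>
  Orbits of the dihedral group. Both generators have finite order, so closing under them
  is the same as closing under the group.
\<close>

inductive_set dihedral_orbit :: "'a list \<Rightarrow> 'a list set" for xs :: "'a list" where
  base: "xs \<in> dihedral_orbit xs"
| rotation: "ys \<in> dihedral_orbit xs \<Longrightarrow> rotate1 ys \<in> dihedral_orbit xs"
| reflection: "ys \<in> dihedral_orbit xs \<Longrightarrow> rev ys \<in> dihedral_orbit xs"

text \<open>Infinite sets must not be counted as \<open>0\<close>, as \<^const>\<open>card\<close> would do.\<close>

definition ecard :: "'a set \<Rightarrow> enat" where
  "ecard A = (if finite A then enat (card A) else \<infinity>)"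

definition trajectory_count :: "nat \<Rightarrow> nat \<Rightarrow> (complex \<Rightarrow> nat \<Rightarrow> real) \<Rightarrow> enat" where
  "trajectory_count p n e = ecard (dihedral_orbit ` billiard_trajectories p n e)"

subsection \<open>The Morse condition on the length function\<close>

definition length_function :: "nat \<Rightarrow> (complex \<Rightarrow> nat \<Rightarrow> real) \<Rightarrow> complex list \<Rightarrow> real" where
  "length_function n e xs =
     (\<Sum>i<length xs. norm_n n (\<lambda>k. e (xs ! i) k - e (xs ! next_index (length xs) i) k))"

text \<open>
  The length function in the local coordinates \<open>(s\<^sub>1, \<dots>, s\<^sub>p)\<close> around \<open>xs\<close>, with \<open>xs\<close> at the
  origin. For an odd prime number of points the dihedral group acts freely on the admissible
  tuples, hence the quotient map is a local diffeomorphism there,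
  so these are also local coordinates of the quotient, and being a nondegenerate critical
  point may be tested in them. Only the coordinates with index below \<^term>\<open>length xs\<close> matter.
\<close>

definition local_length ::
    "nat \<Rightarrow> (complex \<Rightarrow> nat \<Rightarrow> real) \<Rightarrow> complex list \<Rightarrow> (nat \<Rightarrow> real) \<Rightarrow> real" where
  "local_length n e xs s =
     length_function n e (map (\<lambda>i. xs ! i * cis (s i)) [0..<length xs])"

definition partial_deriv :: "nat \<Rightarrow> ((nat \<Rightarrow> real) \<Rightarrow> real) \<Rightarrow> (nat \<Rightarrow> real) \<Rightarrow> real" where
  "partial_deriv j F s = deriv (\<lambda>u. F (s(j := u))) (s j)"

definition critical_at_origin :: "nat \<Rightarrow> ((nat \<Rightarrow> real) \<Rightarrow> real) \<Rightarrow> bool" where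
  "critical_at_origin p F \<longleftrightarrow> (\<forall>j<p. partial_deriv j F (\<lambda>_. 0) = 0)"

definition hessian_at_origin :: "((nat \<Rightarrow> real) \<Rightarrow> real) \<Rightarrow> nat \<Rightarrow> nat \<Rightarrow> real" where
  "hessian_at_origin F i j = partial_deriv i (partial_deriv j F) (\<lambda>_. 0)"

definition nondegenerate :: "nat \<Rightarrow> (nat \<Rightarrow> nat \<Rightarrow> real) \<Rightarrow> bool" where
  "nondegenerate p H \<longleftrightarrow>
     (\<forall>v. (\<forall>i<p. (\<Sum>j<p. H i j * v j) = 0) \<longrightarrow> (\<forall>j<p. v j = 0))"

definition morse_length :: "nat \<Rightarrow> nat \<Rightarrow> (complex \<Rightarrow> nat \<Rightarrow> real) \<Rightarrow> bool" where
  "morse_length p n e \<longleftrightarrow>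
     (\<forall>xs\<in>admissible_tuples p. critical_at_origin p (local_length n e xs) \<longrightarrow>
        nondegenerate p (hessian_at_origin (local_length n e xs)))"

subsection \<open>The minimal number of trajectories\<close>

text \<open>
  In \<^typ>\<open>enat\<close> the infimum of a nonempty set is attained, and that of the empty set is \<open>\<infinity>\<close>,
  so a finite value is a minimum.
\<close>

definition BT_circle :: "nat \<Rightarrow> enat" where
  "BT_circle p =
     Inf {trajectory_count p n e | n e. smooth_embedding n e \<and> morse_length p n e}"

end

theory Submission
  imports Defs
begin

text \<open>
  A \<open>p\<close>-gon inscribed in the curve lifts to a quasi-periodic sequence of angles with a winding number \<open>k\<close>, where
  \<open>0 < k < p\<close>; reversal exchanges \<open>k\<close> with \<open>p - k\<close>, so there are \<open>(p - 1) / 2\<close> classes of winding numbers.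

  Lower bound: every class contains at least two trajectories. One is a longest polygon. If there are only finitely many
  trajectories, a second one comes from a minimax argument. Degenerate \<open>p\<close>-gons are \<open>(p - 1)\<close>-gons in
  disguise; let \<open>Y\<close> be a longest one. Inserting a further vertex into \<open>Y\<close> and moving it once round
  the polygon joins a \<open>p\<close>-gon to its cyclic shift without shortening \<open>Y\<close>, and after rounding
  the corners the path stays strictly above the length of \<open>Y\<close> (unless an inserted vertex is itself
  critical at that level). The supremum of the levels below such paths is critical and lies below the
  maximum, since otherwise a whole arc would consist of vertices of longest polygons.

  Upper bound: for the curve \<open>z + \<epsilon> z ^ (p + 1)\<close> in the plane, with small \<open>\<epsilon>\<close>, critical polygons have almost
  equal steps, and there the gradient of the length is strictly monotone transversally to the simultaneous
  translation of all angles. By the symmetry of the curve only regular polygons are critical, at the angles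
  \<open>t\<close> with \<open>sin (p t) = 0\<close>; up to the dihedral group that leaves two for each class.
\<close>


text \<open>Gradient ascent must not run into degenerate p-gons, so all of those in the class have
  to be at most as long as \<open>Y\<close>. Deleting a vertex of a degenerate p-gon with winding
  number k leaves winding number k or k - 1, and the longest such (p - 1)-gon may be of the wrong
  kind, k - 1. Reversed, it has winding number p - k and serves the class p - k instead, which
  contains the same trajectories. So in each pair k, p - k only one class is treated. The two
  trajectories found there are told apart by their lengths, which the dihedral group preserves.

  On the round circle the regular polygons of a given winding number form a one-parameter family, so
  the length is degenerate along translations. The added power of z destroys this family but keeps
  the rotations by 2 pi / p, as p + 1 is 1 modulo p. Moreover z^(p+1) - w^(p+1) is divisible by z -
  w, so a chord of the wavy curve is a chord of the round circle times a factor close to 1. The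
  estimates are therefore uniform up to the diagonal, where the length itself is not
  differentiable.\<close>

section \<open>Equality cases of Cauchy-Schwarz and of the triangle inequality\<close>

lemma L2_set_sq: "(L2_set f A)\<^sup>2 = (\<Sum>i\<in>A. (f i)\<^sup>2)"
  by (simp add: L2_set_def sum_nonneg)

lemma L2_set_inner_le:
  "(\<Sum>i\<in>A. f i * g i) \<le> L2_set f A * L2_set g A" for f g :: "'a \<Rightarrow> real"
proof -
  have "(\<Sum>i\<in>A. f i * g i) \<le> (\<Sum>i\<in>A. \<bar>f i\<bar> * \<bar>g i\<bar>)"
    by (intro sum_mono) (metis abs_ge_self abs_mult)
  also have "\<dots> \<le> L2_set f A * L2_set g A" by (rule L2_set_mult_ineq)
  finally show ?thesis .
qed

text \<open>The vector |g| f - |f| g has squared norm 2 |f| |g| (|f| |g| - <f, g>), which vanishes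
  in the equality case. The conclusion is free of divisions, so it also covers zero vectors.\<close>

lemma L2_set_inner_eq_imp_parallel:
  fixes f g :: "'a \<Rightarrow> real"
  assumes "(\<Sum>i\<in>A. f i * g i) = L2_set f A * L2_set g A" "finite A" "i \<in> A"
  shows "L2_set g A * f i = L2_set f A * g i"
proof -
  let ?a = "L2_set f A" let ?b = "L2_set g A"
  have "(\<Sum>i\<in>A. (?b * f i - ?a * g i)\<^sup>2)
      = (\<Sum>i\<in>A. ?b\<^sup>2 * (f i)\<^sup>2 - 2 * ?a * ?b * (f i * g i) + ?a\<^sup>2 * (g i)\<^sup>2)"
    by (intro sum.cong) (auto simp: power2_eq_square algebra_simps)
  also have "\<dots> = ?b\<^sup>2 * (\<Sum>i\<in>A. (f i)\<^sup>2) - 2 * ?a * ?b * (\<Sum>i\<in>A. f i * g i)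
                  + ?a\<^sup>2 * (\<Sum>i\<in>A. (g i)\<^sup>2)"
    by (simp add: sum.distrib sum_subtractf sum_distrib_left)
  also have "\<dots> = 0"
    unfolding assms(1) L2_set_sq[symmetric] by (simp add: power2_eq_square)
  finally have "(?b * f i - ?a * g i)\<^sup>2 = 0"
    using assms(2,3) by (simp add: sum_nonneg_eq_0_iff)
  then show ?thesis by simp
qed

text \<open>Squaring reduces this to the equality case of Cauchy-Schwarz. It serves to force a point
  of the curve onto the straight segment between two others.\<close>

lemma L2_set_triangle_eq_imp_parallel:
  fixes f g :: "'a \<Rightarrow> real"
  assumes "L2_set (\<lambda>i. f i + g i) A = L2_set f A + L2_set g A" "finite A" "i \<in> A"
  shows "L2_set g A * f i = L2_set f A * g i"
proof -
  have "(L2_set (\<lambda>i. f i + g i) A)\<^sup>2 = (L2_set f A)\<^sup>2 + 2 * (\<Sum>i\<in>A. f i * g i) + (L2_set g A)\<^sup>2"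
    unfolding L2_set_sq by (simp add: power2_sum sum.distrib sum_distrib_left algebra_simps)
  then have "(\<Sum>i\<in>A. f i * g i) = L2_set f A * L2_set g A"
    unfolding assms(1) by (simp add: power2_eq_square algebra_simps)
  then show ?thesis using L2_set_inner_eq_imp_parallel assms by metis
qed

subsection \<open>Distances along a closed curve\<close>

text \<open>An immersed closed curve of class C1, parametrized by the angle and injective modulo
  \<open>2 * pi\<close>. Only the coordinates below \<open>n\<close> are constrained.\<close>

locale closed_curve =
  fixes n :: nat and c dc :: "real \<Rightarrow> nat \<Rightarrow> real"
  assumes deriv_c: "k < n \<Longrightarrow> ((\<lambda>t. c t k) has_real_derivative dc t k) (at t)"
    and cont_dc: "k < n \<Longrightarrow> continuous_on UNIV (\<lambda>t. dc t k)"
    and c_periodic: "k < n \<Longrightarrow> c (t + 2 * pi) k = c t k"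
    and c_inj: "(\<And>k. k < n \<Longrightarrow> c s k = c t k) \<Longrightarrow> \<exists>m::int. t - s = 2 * pi * m"
    and immersion: "\<exists>k<n. dc t k \<noteq> 0"
begin

definition D :: "real \<Rightarrow> real \<Rightarrow> real" where
  "D s t = L2_set (\<lambda>k. c s k - c t k) {..<n}"

text \<open>\<open>D1 s t\<close> is the derivative of \<open>D s t\<close> with respect to \<open>s\<close>; on the diagonal it is the junk value \<open>0\<close>.\<close>

definition D1 :: "real \<Rightarrow> real \<Rightarrow> real" where
  "D1 s t = (\<Sum>k<n. (c s k - c t k) * dc s k) / D s t"

definition speed :: "real \<Rightarrow> real" where
  "speed t = L2_set (dc t) {..<n}"

lemma D_nonneg [simp]: "0 \<le> D s t"
  by (simp add: D_def)

lemma D_sym: "D s t = D t s"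
  unfolding D_def L2_set_def by (simp add: power2_commute)

lemma D_triangle: "D s u \<le> D s t + D t u"
proof -
  have "D s u = L2_set (\<lambda>k. (c s k - c t k) + (c t k - c u k)) {..<n}"
    by (simp add: D_def)
  also have "\<dots> \<le> D s t + D t u"
    unfolding D_def by (rule L2_set_triangle_ineq)
  finally show ?thesis .
qed

lemma c_periodic_nat: "k < n \<Longrightarrow> c (t + 2 * pi * real m) k = c t k"
proof (induction m)
  case (Suc m)
  then show ?case using c_periodic[of k "t + 2 * pi * real m"] by (simp add: algebra_simps)
qed simp

lemma c_periodic_int: "k < n \<Longrightarrow> c (t + 2 * pi * of_int m) k = c t k"
  using c_periodic_nat[of k t "nat m"] c_periodic_nat[of k "t + 2 * pi * of_int m" "nat (- m)"]
  by (cases "m \<ge> 0") (auto simp: algebra_simps)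

lemma D_periodic: "D (s + 2 * pi * of_int m) t = D s t"
  "D s (t + 2 * pi * of_int m) = D s t"
  unfolding D_def L2_set_def by (simp_all add: c_periodic_int)

lemma dc_periodic_int: "k < n \<Longrightarrow> dc (t + 2 * pi * of_int m) k = dc t k"
proof -
  assume k: "k < n"
  have "((\<lambda>x. c (x + 2 * pi * of_int m) k) has_real_derivative dc (t + 2 * pi * of_int m) k * 1) (at t)"
    by (rule DERIV_chain2[where f = "\<lambda>y. c y k"]) (auto intro!: deriv_c k derivative_eq_intros)
  then show ?thesis
    using deriv_c[OF k, of t] by (simp add: c_periodic_int[OF k] DERIV_unique)
qed

lemma D1_periodic: "D1 (s + 2 * pi * of_int m) t = D1 s t"
  "D1 s (t + 2 * pi * of_int m) = D1 s t"
  unfolding D1_def by (simp_all add: c_periodic_int dc_periodic_int D_periodic)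

lemma D_eq_0_iff: "D s t = 0 \<longleftrightarrow> (\<exists>m::int. t - s = 2 * pi * m)"
proof
  assume "D s t = 0"
  then have "\<And>k. k < n \<Longrightarrow> c s k = c t k"
    by (simp add: D_def L2_set_eq_0_iff)
  then show "\<exists>m::int. t - s = 2 * pi * m" by (rule c_inj)
next
  assume "\<exists>m::int. t - s = 2 * pi * m"
  then obtain m :: int where "t = s + 2 * pi * m" by (auto simp: algebra_simps)
  then show "D s t = 0" by (simp add: D_periodic) (simp add: D_def L2_set_def)
qed

lemma D_self [simp]: "D s s = 0"
  using D_eq_0_iff[of s s] by (metis cancel_comm_monoid_add_class.diff_cancel mult_zero_right of_int_0)

lemma D_pos:
  assumes "s < t" "t < s + 2 * pi" shows "0 < D s t"
proof -
  have "\<not> (\<exists>m::int. t - s = 2 * pi * m)"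
  proof
    assume "\<exists>m::int. t - s = 2 * pi * m"
    then obtain m :: int where m: "t - s = 2 * pi * m" ..
    show False
    proof (cases "m \<le> 0")
      case True
      then have "2 * pi * m \<le> 0" by (simp add: mult_nonneg_nonpos)
      then show False using m assms by linarith
    next
      case False
      then have "2 * pi * 1 \<le> 2 * pi * m" by (intro mult_left_mono) auto
      then show False using m assms by linarith
    qed
  qed
  then have "D s t \<noteq> 0" using D_eq_0_iff[of s t] by blast
  then show ?thesis using D_nonneg[of s t] by linarith
qed

lemma tendsto_c:
  assumes "k < n" "(s \<longlongrightarrow> s0) F" shows "((\<lambda>x. c (s x) k) \<longlongrightarrow> c s0 k) F"
proof (rule isCont_tendsto_compose[OF _ assms(2)])
  show "isCont (\<lambda>t. c t k) s0"
    using deriv_c[OF assms(1)] by (rule DERIV_isCont)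
qed

lemma tendsto_dc:
  assumes "k < n" "(s \<longlongrightarrow> s0) F" shows "((\<lambda>x. dc (s x) k) \<longlongrightarrow> dc s0 k) F"
proof (rule isCont_tendsto_compose[OF _ assms(2)])
  show "isCont (\<lambda>t. dc t k) s0"
    using cont_dc[OF assms(1)] by (simp add: continuous_on_eq_continuous_at)
qed

lemma tendsto_D [tendsto_intros]:
  assumes "(s \<longlongrightarrow> s0) F" "(t \<longlongrightarrow> t0) F"
  shows "((\<lambda>x. D (s x) (t x)) \<longlongrightarrow> D s0 t0) F"
  unfolding D_def L2_set_def by (intro tendsto_intros tendsto_c assms) auto

lemma tendsto_D1 [tendsto_intros]:
  assumes "(s \<longlongrightarrow> s0) F" "(t \<longlongrightarrow> t0) F" "D s0 t0 \<noteq> 0"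
  shows "((\<lambda>x. D1 (s x) (t x)) \<longlongrightarrow> D1 s0 t0) F"
  unfolding D1_def by (intro tendsto_intros tendsto_c tendsto_dc assms) auto

lemma has_derivative_D:
  assumes s: "(s has_real_derivative s') (at x)" and t: "(t has_real_derivative t') (at x)"
    and nz: "D (s x) (t x) \<noteq> 0"
  shows "((\<lambda>x. D (s x) (t x)) has_real_derivative s' * D1 (s x) (t x) + t' * D1 (t x) (s x)) (at x)"
proof -
  define Q where "Q x = (\<Sum>k<n. (c (s x) k - c (t x) k)\<^sup>2)" for x
  have DQ: "D (s x) (t x) = sqrt (Q x)" for x by (simp add: D_def L2_set_def Q_def)
  have "((\<lambda>x. c (s x) k) has_real_derivative dc (s x) k * s') (at x)" if "k < n" for k
    by (rule DERIV_chain2[where f = "\<lambda>y. c y k"]) (auto intro!: deriv_c that s)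
  moreover have "((\<lambda>x. c (t x) k) has_real_derivative dc (t x) k * t') (at x)" if "k < n" for k
    by (rule DERIV_chain2[where f = "\<lambda>y. c y k"]) (auto intro!: deriv_c that t)
  ultimately have "(Q has_real_derivative (\<Sum>k<n. 2 * (c (s x) k - c (t x) k) *
      (dc (s x) k * s' - dc (t x) k * t'))) (at x)"
    unfolding Q_def by (intro DERIV_sum) (auto intro!: derivative_eq_intros)
  moreover have "Q x > 0"
    using nz D_nonneg[of "s x" "t x"] unfolding DQ by (smt (verit) real_sqrt_gt_0_iff)
  ultimately have der: "((\<lambda>x. sqrt (Q x)) has_real_derivative (\<Sum>k<n. 2 * (c (s x) k - c (t x) k) *
      (dc (s x) k * s' - dc (t x) k * t')) * (inverse (sqrt (Q x)) / 2)) (at x)"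
    by (auto intro!: derivative_eq_intros)
  have sum_eq: "(\<Sum>k<n. 2 * (c (s x) k - c (t x) k) * (dc (s x) k * s' - dc (t x) k * t'))
      = 2 * (s' * (\<Sum>k<n. (c (s x) k - c (t x) k) * dc (s x) k)
           + t' * (\<Sum>k<n. (c (t x) k - c (s x) k) * dc (t x) k))"
    by (simp add: sum_distrib_left sum.distrib[symmetric] algebra_simps)
  have arith: "2 * (s' * A + t' * B) * (inverse d / 2) = s' * (A / d) + t' * (B / d)" for A B d :: real
    by (cases "d = 0") (simp_all add: field_simps)
  show ?thesis
    using der[unfolded sum_eq arith] unfolding DQ[symmetric] D1_def D_sym[of "t x" "s x"] .
qed

lemma D1_le_speed: "\<bar>D1 s t\<bar> \<le> speed s"
proof (cases "D s t = 0")
  case False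
  then have pos: "D s t > 0" using D_nonneg[of s t] by linarith
  have "(\<Sum>k<n. (c s k - c t k) * dc s k) \<le> D s t * speed s"
    unfolding D_def speed_def by (rule L2_set_inner_le)
  moreover have "(\<Sum>k<n. (c t k - c s k) * dc s k) \<le> D t s * speed s"
    unfolding D_def speed_def by (rule L2_set_inner_le)
  moreover have "(\<Sum>k<n. (c t k - c s k) * dc s k) = - (\<Sum>k<n. (c s k - c t k) * dc s k)"
    by (simp add: sum_negf[symmetric] algebra_simps)
  ultimately have "\<bar>\<Sum>k<n. (c s k - c t k) * dc s k\<bar> \<le> speed s * D s t"
    by (simp add: D_sym[of t s] abs_le_iff mult.commute)
  then show ?thesis unfolding D1_def using pos by (simp add: abs_divide pos_divide_le_eq)
qed (simp add: D1_def speed_def)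

lemma speed_pos: "0 < speed t"
proof -
  obtain k where k: "k < n" "dc t k \<noteq> 0" using immersion by blast
  have "speed t \<noteq> 0" unfolding speed_def using k by (auto simp: L2_set_eq_0_iff)
  moreover have "0 \<le> speed t" by (simp add: speed_def)
  ultimately show ?thesis by simp
qed

end

subsection \<open>Lifts of polygons\<close>

text \<open>
  A lift is the sequence of angles of the vertices, read cyclically; \<open>k\<close> is its winding number. Every tuple with
  distinct consecutive vertices has an open lift, once the steps are normalized to lie between \<open>0\<close> and \<open>2 \<pi>\<close>.
\<close>

definition quasi_periodic :: "nat \<Rightarrow> int \<Rightarrow> (int \<Rightarrow> real) \<Rightarrow> bool" where
  "quasi_periodic N k \<theta> \<longleftrightarrow> (\<forall>i. \<theta> (i + int N) = \<theta> i + 2 * pi * of_int k)"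

definition closed_lifts :: "nat \<Rightarrow> int \<Rightarrow> (int \<Rightarrow> real) set" where
  "closed_lifts N k = {\<theta>. quasi_periodic N k \<theta> \<and> (\<forall>i. \<theta> i \<le> \<theta> (i + 1) \<and> \<theta> (i + 1) \<le> \<theta> i + 2 * pi)}"

definition open_lifts :: "nat \<Rightarrow> int \<Rightarrow> (int \<Rightarrow> real) set" where
  "open_lifts N k = {\<theta>. quasi_periodic N k \<theta> \<and> (\<forall>i. \<theta> i < \<theta> (i + 1) \<and> \<theta> (i + 1) < \<theta> i + 2 * pi)}"

definition shift :: "(int \<Rightarrow> real) \<Rightarrow> int \<Rightarrow> real" where
  "shift \<theta> = (\<lambda>i. \<theta> (i + 1))"

definition translate :: "int \<Rightarrow> (int \<Rightarrow> real) \<Rightarrow> int \<Rightarrow> real" where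
  "translate m \<theta> = (\<lambda>i. \<theta> i + 2 * pi * of_int m)"

lemma quasi_periodic_mult:
  assumes "quasi_periodic N k \<theta>"
  shows "\<theta> (i + int N * m) = \<theta> i + 2 * pi * of_int k * of_int m"
proof -
  have pos: "\<theta> (i + int N * int l) = \<theta> i + 2 * pi * of_int k * real l" for i l
  proof (induction l)
    case (Suc l)
    have "i + int N * int (Suc l) = (i + int N * int l) + int N" by (simp add: algebra_simps)
    then show ?case using Suc assms by (simp only: quasi_periodic_def) (simp add: algebra_simps)
  qed simp
  show ?thesis
  proof (cases "m \<ge> 0")
    case True
    then show ?thesis using pos[of i "nat m"] by simp
  next
    case False
    then show ?thesis using pos[of "i + int N * m" "nat (- m)"] by (simp add: algebra_simps)
  qed
qed

lemma quasi_periodic_mod: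
  assumes "quasi_periodic N k \<theta>"
  shows "\<theta> i = \<theta> (i mod int N) + 2 * pi * of_int k * of_int (i div int N)"
  using quasi_periodic_mult[OF assms, of "i mod int N" "i div int N"] by simp

lemma quasi_periodic_eqI:
  assumes "quasi_periodic N k \<theta>" "quasi_periodic N k \<xi>" "0 < N"
    and "\<And>i. 0 \<le> i \<Longrightarrow> i < int N \<Longrightarrow> \<theta> i = \<xi> i"
  shows "\<theta> = \<xi>"
proof
  fix i
  have "\<theta> (i mod int N) = \<xi> (i mod int N)" using assms(3) by (intro assms(4)) auto
  then show "\<theta> i = \<xi> i"
    using quasi_periodic_mod[OF assms(1), of i] quasi_periodic_mod[OF assms(2), of i] by simp
qed

lemma quasi_periodic_diff:
  assumes "quasi_periodic N k \<theta>"
  shows "\<theta> (i + 1) - \<theta> i = \<theta> (i mod int N + 1) - \<theta> (i mod int N)"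
  using quasi_periodic_mult[OF assms, of "i mod int N" "i div int N"]
    quasi_periodic_mult[OF assms, of "i mod int N + 1" "i div int N"]
  by (simp add: algebra_simps)

lemma open_lifts_subset: "open_lifts N k \<subseteq> closed_lifts N k"
  by (auto simp: open_lifts_def closed_lifts_def intro: less_imp_le)

lemma closed_liftsI:
  assumes "quasi_periodic N k \<theta>" "0 < N"
    and "\<And>i. 0 \<le> i \<Longrightarrow> i < int N \<Longrightarrow> \<theta> i \<le> \<theta> (i + 1) \<and> \<theta> (i + 1) \<le> \<theta> i + 2 * pi"
  shows "\<theta> \<in> closed_lifts N k"
proof -
  have "\<theta> i \<le> \<theta> (i + 1) \<and> \<theta> (i + 1) \<le> \<theta> i + 2 * pi" for i
    using assms(3)[of "i mod int N"] quasi_periodic_diff[OF assms(1), of i] assms(2) by auto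
  then show ?thesis using assms(1) by (simp add: closed_lifts_def)
qed

lemma open_liftsI:
  assumes "quasi_periodic N k \<theta>" "0 < N"
    and "\<And>i. 0 \<le> i \<Longrightarrow> i < int N \<Longrightarrow> \<theta> i < \<theta> (i + 1) \<and> \<theta> (i + 1) < \<theta> i + 2 * pi"
  shows "\<theta> \<in> open_lifts N k"
proof -
  have "\<theta> i < \<theta> (i + 1) \<and> \<theta> (i + 1) < \<theta> i + 2 * pi" for i
    using assms(3)[of "i mod int N"] quasi_periodic_diff[OF assms(1), of i] assms(2) by auto
  then show ?thesis using assms(1) by (simp add: open_lifts_def)
qed

lemma quasi_periodic_shift: "quasi_periodic N k \<theta> \<Longrightarrow> quasi_periodic N k (shift \<theta>)"
  unfolding quasi_periodic_def shift_def by (metis add.assoc add.commute)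

lemma shift_open: "\<theta> \<in> open_lifts N k \<Longrightarrow> shift \<theta> \<in> open_lifts N k"
  using quasi_periodic_shift[of N k \<theta>] unfolding open_lifts_def shift_def mem_Collect_eq by blast

lemma shift_closed: "\<theta> \<in> closed_lifts N k \<Longrightarrow> shift \<theta> \<in> closed_lifts N k"
  using quasi_periodic_shift[of N k \<theta>] unfolding closed_lifts_def shift_def mem_Collect_eq by blast

lemma shift_pow: "(shift ^^ j) \<theta> = (\<lambda>i. \<theta> (i + int j))"
  by (induction j) (auto simp: shift_def algebra_simps)

lemma shift_pow_open: "\<theta> \<in> open_lifts N k \<Longrightarrow> (shift ^^ j) \<theta> \<in> open_lifts N k"
  by (induction j) (simp_all add: shift_open)

lemma shift_pow_closed: "\<theta> \<in> closed_lifts N k \<Longrightarrow> (shift ^^ j) \<theta> \<in> closed_lifts N k"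
  by (induction j) (simp_all add: shift_closed)

lemma translate_open: "\<theta> \<in> open_lifts N k \<Longrightarrow> translate m \<theta> \<in> open_lifts N k"
  by (simp add: open_lifts_def quasi_periodic_def translate_def)

lemma translate_closed: "\<theta> \<in> closed_lifts N k \<Longrightarrow> translate m \<theta> \<in> closed_lifts N k"
  by (simp add: closed_lifts_def quasi_periodic_def translate_def)

lemma translate_normalize:
  obtains m where "0 \<le> translate m \<theta> 0" "translate m \<theta> 0 \<le> 2 * pi"
proof
  let ?m = "- \<lfloor>\<theta> 0 / (2 * pi)\<rfloor>"
  have "of_int \<lfloor>\<theta> 0 / (2 * pi)\<rfloor> \<le> \<theta> 0 / (2 * pi)" "\<theta> 0 / (2 * pi) < of_int \<lfloor>\<theta> 0 / (2 * pi)\<rfloor> + 1"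
    by linarith+
  then have "of_int \<lfloor>\<theta> 0 / (2 * pi)\<rfloor> * (2 * pi) \<le> \<theta> 0" "\<theta> 0 < (of_int \<lfloor>\<theta> 0 / (2 * pi)\<rfloor> + 1) * (2 * pi)"
    by (simp_all only: pos_le_divide_eq pos_divide_less_eq pi_gt_zero zero_less_mult_iff zero_less_numeral simp_thms)
  then show "0 \<le> translate ?m \<theta> 0" "translate ?m \<theta> 0 \<le> 2 * pi"
    by (simp_all add: translate_def algebra_simps)
qed

lemma sum_shift_periodic:
  fixes g :: "int \<Rightarrow> real"
  assumes "\<And>i. g (i + int N) = g i"
  shows "(\<Sum>i<N. g (int i + 1)) = (\<Sum>i<N. g (int i))"
proof -
  have "(\<Sum>i<N. g (int i + 1)) = (\<Sum>i<Suc N. g (int i)) - g 0"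
    by (subst sum.lessThan_Suc_shift) (simp add: add.commute)
  also have "\<dots> = (\<Sum>i<N. g (int i))" using assms[of 0] by simp
  finally show ?thesis .
qed

lemma sum_telescope_int: "(\<Sum>i<N. \<theta> (int i + 1) - \<theta> (int i)) = \<theta> (int N) - (\<theta> 0 :: real)"
  by (induction N) (simp_all add: add.commute)

lemma closed_lifts_bound:
  assumes "\<theta> \<in> closed_lifts N k" shows "\<bar>\<theta> i - \<theta> 0\<bar> \<le> 2 * pi * \<bar>of_int i\<bar>"
proof (induction i rule: int_induct[where k = 0])
  case (step1 i)
  have "\<theta> i \<le> \<theta> (i + 1)" "\<theta> (i + 1) \<le> \<theta> i + 2 * pi"
    using assms by (auto simp: closed_lifts_def)
  then show ?case using step1 by (auto simp: algebra_simps)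
next
  case (step2 i)
  have "\<theta> j \<le> \<theta> (j + 1) \<and> \<theta> (j + 1) \<le> \<theta> j + 2 * pi" for j
    using assms by (auto simp: closed_lifts_def)
  from this[of "i - 1"] show ?case using step2 by (auto simp: algebra_simps)
qed simp

lemma continuous_on_coordinate: "continuous_on S (\<lambda>\<theta> :: int \<Rightarrow> real. \<theta> i)"
  by (rule continuous_on_product_then_coordinatewise) (rule continuous_on_id)

lemma tendsto_coordinate: "((\<lambda>\<theta>. \<theta> i) \<longlongrightarrow> l i) (at l)" for l :: "int \<Rightarrow> real"
  using continuous_on_coordinate[of UNIV i] by (simp add: continuous_on_def)

lemma closed_closed_lifts: "closed (closed_lifts N k)"
  unfolding closed_lifts_def quasi_periodic_def
  by (intro closed_Collect_conj closed_Collect_all closed_Collect_le closed_Collect_eq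
      continuous_intros continuous_on_coordinate)

text \<open>Steps between 0 and \<open>2 * pi\<close> confine every coordinate to a bounded interval
  once \<open>\<theta> 0\<close> is normalized by full turns; Tychonoff's theorem does the
  rest.\<close>

lemma compact_closed_lifts: "compact {\<theta> \<in> closed_lifts N k. 0 \<le> \<theta> 0 \<and> \<theta> 0 \<le> 2 * pi}"
proof -
  define B where "B i = 2 * pi * (\<bar>of_int i\<bar> + 1)" for i :: int
  let ?K = "PiE UNIV (\<lambda>i. {- B i..B i})"
  have "compactin (product_topology (\<lambda>i::int. euclidean) UNIV) ?K"
    by (simp add: compactin_PiE)
  then have "compact ?K" by (simp add: euclidean_product_topology)
  moreover have "closed {\<theta> \<in> closed_lifts N k. 0 \<le> \<theta> 0 \<and> \<theta> 0 \<le> 2 * pi}"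
  proof -
    have "closed {\<theta> :: int \<Rightarrow> real. 0 \<le> \<theta> 0 \<and> \<theta> 0 \<le> 2 * pi}"
      by (intro closed_Collect_conj closed_Collect_le continuous_intros continuous_on_coordinate)
    from closed_Int[OF closed_closed_lifts[of N k] this] show ?thesis
      by (simp add: Int_def)
  qed
  moreover have "{\<theta> \<in> closed_lifts N k. 0 \<le> \<theta> 0 \<and> \<theta> 0 \<le> 2 * pi} \<subseteq> ?K"
  proof
    fix \<theta> assume \<theta>: "\<theta> \<in> {\<theta> \<in> closed_lifts N k. 0 \<le> \<theta> 0 \<and> \<theta> 0 \<le> 2 * pi}"
    have "\<bar>\<theta> i\<bar> \<le> B i" for i
      using closed_lifts_bound[of \<theta> N k i] \<theta> by (auto simp: B_def algebra_simps)
    then have "- B i \<le> \<theta> i \<and> \<theta> i \<le> B i" for i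
      by (simp add: abs_le_iff minus_le_iff)
    then show "\<theta> \<in> ?K" by (simp add: PiE_UNIV_domain)
  qed
  ultimately show ?thesis
    using compact_Int_closed[of ?K "{\<theta> \<in> closed_lifts N k. 0 \<le> \<theta> 0 \<and> \<theta> 0 \<le> 2 * pi}"]
    by (simp only: Int_absorb1)
qed

lemma closed_lifts_subseq:
  fixes \<theta> :: "nat \<Rightarrow> int \<Rightarrow> real"
  assumes "\<And>m. \<theta> m \<in> closed_lifts N k" "\<And>m. 0 \<le> \<theta> m 0" "\<And>m. \<theta> m 0 \<le> 2 * pi"
  obtains r l where "strict_mono (r :: nat \<Rightarrow> nat)" "l \<in> closed_lifts N k"
    "\<And>i. (\<lambda>m. \<theta> (r m) i) \<longlonglongrightarrow> l i"
proof -
  have "seq_compact {\<theta> \<in> closed_lifts N k. 0 \<le> \<theta> 0 \<and> \<theta> 0 \<le> 2 * pi}"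
    by (rule compact_imp_seq_compact[OF compact_closed_lifts])
  moreover have "\<And>m. \<theta> m \<in> {\<theta> \<in> closed_lifts N k. 0 \<le> \<theta> 0 \<and> \<theta> 0 \<le> 2 * pi}"
    using assms by simp
  ultimately obtain l r where l: "l \<in> closed_lifts N k" "strict_mono r" "(\<theta> \<circ> r) \<longlonglongrightarrow> l"
    unfolding seq_compact_def by (metis (no_types, lifting) mem_Collect_eq)
  have "(\<lambda>m. \<theta> (r m) i) \<longlonglongrightarrow> l i" for i
  proof -
    have "isCont (\<lambda>\<theta> :: int \<Rightarrow> real. \<theta> i) l"
      unfolding isCont_def by (rule tendsto_coordinate)
    from isCont_tendsto_compose[OF this l(3)] show ?thesis by simp
  qed
  then show ?thesis using that l by blast
qed

text \<open>Full turns move any lift into the compact normalized part without changing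
  \<open>F\<close>, so a maximum on that part is a maximum on \<open>S\<close>.\<close>

lemma closed_lifts_attains_max:
  fixes F :: "(int \<Rightarrow> real) \<Rightarrow> real"
  assumes "S \<subseteq> closed_lifts N k" "S \<noteq> {}" "closed S" "continuous_on UNIV F"
    and S: "\<And>\<theta> m. \<theta> \<in> S \<Longrightarrow> translate m \<theta> \<in> S"
    and F: "\<And>\<theta> m. F (translate m \<theta>) = F \<theta>"
  obtains \<theta> where "\<theta> \<in> S" "\<And>\<xi>. \<xi> \<in> S \<Longrightarrow> F \<xi> \<le> F \<theta>"
proof -
  let ?K = "{\<theta> \<in> closed_lifts N k. 0 \<le> \<theta> 0 \<and> \<theta> 0 \<le> 2 * pi} \<inter> S"
  have "compact ?K" using compact_closed_lifts assms(3) by (rule compact_Int_closed)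
  moreover have norm: "\<exists>m. translate m \<theta> \<in> ?K" if "\<theta> \<in> S" for \<theta>
    using translate_normalize[of \<theta>] S[OF that] assms(1) by blast
  moreover have "?K \<noteq> {}" using norm assms(2) by blast
  ultimately have "\<exists>\<theta>\<in>?K. \<forall>\<xi>\<in>?K. F \<xi> \<le> F \<theta>"
    by (intro continuous_attains_sup continuous_on_subset[OF assms(4) subset_UNIV])
  then obtain \<theta> where \<theta>: "\<theta> \<in> ?K" "\<And>\<xi>. \<xi> \<in> ?K \<Longrightarrow> F \<xi> \<le> F \<theta>"
    by blast
  have "F \<xi> \<le> F \<theta>" if "\<xi> \<in> S" for \<xi>
  proof -
    from norm[OF that] obtain m where "translate m \<xi> \<in> ?K" ..
    from \<theta>(2)[OF this] show ?thesis unfolding F .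
  qed
  moreover have "\<theta> \<in> S" using \<theta>(1) by simp
  ultimately show ?thesis using that by simp
qed

lemma closed_lifts_nonempty:
  assumes "0 < N" "0 \<le> k" "k \<le> int N"
  shows "closed_lifts N k \<noteq> {}"
proof -
  have "(\<lambda>i. 2 * pi * of_int k * of_int i / real N) \<in> closed_lifts N k"
    using assms by (auto simp: closed_lifts_def quasi_periodic_def field_simps)
      
  then show ?thesis by blast
qed

subsection \<open>The length of a polygon\<close>

context closed_curve
begin

definition len :: "nat \<Rightarrow> (int \<Rightarrow> real) \<Rightarrow> real" where
  "len N \<theta> = (\<Sum>i<N. D (\<theta> (int i)) (\<theta> (int i + 1)))"

definition grad :: "(int \<Rightarrow> real) \<Rightarrow> int \<Rightarrow> real" where
  "grad \<theta> i = D1 (\<theta> i) (\<theta> (i + 1)) + D1 (\<theta> i) (\<theta> (i - 1))"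

definition critical :: "(int \<Rightarrow> real) \<Rightarrow> bool" where
  "critical \<theta> \<longleftrightarrow> (\<forall>i. grad \<theta> i = 0)"

lemma tendsto_len:
  assumes "\<And>i. ((\<lambda>x. \<theta> x i) \<longlongrightarrow> l i) F" shows "((\<lambda>x. len N (\<theta> x)) \<longlongrightarrow> len N l) F"
  unfolding len_def by (intro tendsto_intros assms)

lemma continuous_on_len: "continuous_on S (len N)"
proof (rule continuous_at_imp_continuous_on, rule ballI)
  fix l show "isCont (len N) l"
    unfolding isCont_def by (rule tendsto_len) (rule tendsto_coordinate)
qed

lemma len_shift:
  assumes "quasi_periodic N k \<theta>" shows "len N (shift \<theta>) = len N \<theta>"
proof -
  have "len N (shift \<theta>) = (\<Sum>i<N. D (\<theta> (int i + 1)) (\<theta> (int i + 1 + 1)))"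
    by (simp add: len_def shift_def)
  also have "\<dots> = (\<Sum>i<N. D (\<theta> (int i)) (\<theta> (int i + 1)))"
  proof (rule sum_shift_periodic)
    fix i
    have "\<theta> (i + int N + 1) = \<theta> (i + 1) + 2 * pi * of_int k"
      using assms by (metis add.assoc add.commute quasi_periodic_def)
    then show "D (\<theta> (i + int N)) (\<theta> (i + int N + 1)) = D (\<theta> i) (\<theta> (i + 1))"
      using assms by (simp add: quasi_periodic_def D_periodic)
  qed
  finally show ?thesis by (simp add: len_def)
qed

lemma len_translate: "len N (translate m \<theta>) = len N \<theta>"
  by (simp add: len_def translate_def D_periodic)

lemma grad_periodic:
  assumes "quasi_periodic N k \<theta>" shows "grad \<theta> (i + int N) = grad \<theta> i"
proof -
  have "\<theta> (i + int N + 1) = \<theta> (i + 1) + 2 * pi * of_int k"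
    "\<theta> (i + int N - 1) = \<theta> (i - 1) + 2 * pi * of_int k"
    "\<theta> (i + int N) = \<theta> i + 2 * pi * of_int k"
    using assms unfolding quasi_periodic_def
    by (metis add.assoc add.commute, metis add_diff_eq add.commute, metis)
  then show ?thesis by (simp add: grad_def D1_periodic)
qed

lemma grad_mod:
  assumes "quasi_periodic N k \<theta>" shows "grad \<theta> i = grad \<theta> (i mod int N)"
proof -
  have per: "\<theta> (j + int N * m) = \<theta> j + 2 * pi * of_int (k * m)" for j m
    using quasi_periodic_mult[OF assms, of j m] by simp
  let ?m = "i div int N"
  have "i = i mod int N + int N * ?m" by simp
  then have "\<theta> i = \<theta> (i mod int N) + 2 * pi * of_int (k * ?m)"
    "\<theta> (i + 1) = \<theta> (i mod int N + 1) + 2 * pi * of_int (k * ?m)"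
    "\<theta> (i - 1) = \<theta> (i mod int N - 1) + 2 * pi * of_int (k * ?m)"
    by (metis per, metis per add.assoc add.commute, metis per add_diff_eq add.commute diff_add_eq)
  then show ?thesis by (simp only: grad_def D1_periodic)
qed

lemma grad_shift: "grad (shift \<theta>) i = grad \<theta> (i + 1)"
  by (simp add: grad_def shift_def add.commute)

lemma D_open_lifts:
  assumes "\<theta> \<in> open_lifts N k"
  shows "0 < D (\<theta> i) (\<theta> (i + 1))" "0 < D (\<theta> i) (\<theta> (i - 1))"
proof -
  have *: "0 < D (\<theta> j) (\<theta> (j + 1))" for j
    using assms by (intro D_pos) (auto simp: open_lifts_def)
  show "0 < D (\<theta> i) (\<theta> (i + 1))" "0 < D (\<theta> i) (\<theta> (i - 1))"
    using *[of i] *[of "i - 1"] by (simp_all add: D_sym)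
qed

text \<open>Every vertex is the end of one side and the start of the next. A cyclic shift of the
  index in the second half of the sum collects both contributions in \<open>grad\<close>.\<close>

lemma has_derivative_len:
  assumes per: "quasi_periodic N k \<theta>" "\<And>i. a (i + int N) = a i"
    and pos: "\<And>i. D (\<theta> i + x * a i) (\<theta> (i + 1) + x * a (i + 1)) \<noteq> 0"
  shows "((\<lambda>x. len N (\<lambda>i. \<theta> i + x * a i)) has_real_derivative
     (\<Sum>i<N. a (int i) * grad (\<lambda>i. \<theta> i + x * a i) (int i))) (at x)"
proof -
  define \<xi> where "\<xi> i = \<theta> i + x * a i" for i
  have per': "quasi_periodic N k \<xi>"
    using per by (simp add: quasi_periodic_def \<xi>_def)
  have "((\<lambda>x. len N (\<lambda>i. \<theta> i + x * a i)) has_real_derivative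
     (\<Sum>i<N. a (int i) * D1 (\<xi> (int i)) (\<xi> (int i + 1)) + a (int i + 1) * D1 (\<xi> (int i + 1)) (\<xi> (int i)))) (at x)"
    unfolding len_def \<xi>_def
    by (intro DERIV_sum has_derivative_D pos) (auto intro!: derivative_eq_intros)
  moreover have "(\<Sum>i<N. a (int i + 1) * D1 (\<xi> (int i + 1)) (\<xi> (int i)))
      = (\<Sum>i<N. (\<lambda>i. a i * D1 (\<xi> i) (\<xi> (i - 1))) (int i + 1))"
    by simp
  moreover have "\<dots> = (\<Sum>i<N. (\<lambda>i. a i * D1 (\<xi> i) (\<xi> (i - 1))) (int i))"
  proof (rule sum_shift_periodic)
    fix i
    have "\<xi> (i + int N - 1) = \<xi> (i - 1) + 2 * pi * of_int k" "\<xi> (i + int N) = \<xi> i + 2 * pi * of_int k"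
      using per' unfolding quasi_periodic_def by (metis add_diff_eq add.commute, metis)
    then show "a (i + int N) * D1 (\<xi> (i + int N)) (\<xi> (i + int N - 1)) = a i * D1 (\<xi> i) (\<xi> (i - 1))"
      by (simp add: per D1_periodic)
  qed
  ultimately show ?thesis
    unfolding grad_def \<xi>_def[symmetric] by (simp add: sum.distrib algebra_simps)
qed

text \<open>A variation has to respect the period, so a single coordinate is tested with the
  indicator of its residue class modulo \<open>N\<close>.\<close>

lemma critical_if_directional:
  assumes per: "quasi_periodic N k \<theta>" and N: "0 < N"
    and dir: "\<And>a. (\<And>i. a (i + int N) = a i) \<Longrightarrow> (\<Sum>i<N. a (int i) * grad \<theta> (int i)) = 0"
  shows "critical \<theta>"
  unfolding critical_def
proof
  fix j
  define a where "a i = (if i mod int N = j mod int N then 1 else 0 :: real)" for i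
  let ?j = "nat (j mod int N)"
  have j: "?j < N" "int ?j = j mod int N" using N by (auto simp: nat_less_iff)
  have "(\<Sum>i<N. a (int i) * grad \<theta> (int i)) = (\<Sum>i<N. if i = ?j then grad \<theta> (int i) else 0)"
  proof (rule sum.cong)
    fix i assume "i \<in> {..<N}"
    then have "int i mod int N = int i" by simp
    then have "int i mod int N = j mod int N \<longleftrightarrow> i = ?j" using j(2) by auto
    then show "a (int i) * grad \<theta> (int i) = (if i = ?j then grad \<theta> (int i) else 0)"
      by (simp add: a_def)
  qed simp
  also have "\<dots> = grad \<theta> (j mod int N)" using j by simp
  finally have "grad \<theta> (j mod int N) = 0" using dir[of a] by (simp add: a_def)
  then show "grad \<theta> j = 0" using grad_mod[OF per, of j] by simp
qed

text \<open>By periodicity the open conditions on the steps reduce to finitely many, one for each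
  side.\<close>

lemma open_lifts_line:
  assumes \<theta>: "\<theta> \<in> open_lifts N k" and per: "\<And>i. a (i + int N) = a i" and N: "0 < N"
  shows "\<exists>\<epsilon>>0. \<forall>x. \<bar>x\<bar> < \<epsilon> \<longrightarrow> (\<lambda>i. \<theta> i + x * a i) \<in> open_lifts N k"
proof -
  have "\<forall>\<^sub>F x in at 0. \<theta> i + x * a i < \<theta> (i + 1) + x * a (i + 1)
      \<and> \<theta> (i + 1) + x * a (i + 1) < \<theta> i + x * a i + 2 * pi" for i
  proof -
    have lim: "((\<lambda>x. (\<theta> (i + 1) + x * a (i + 1)) - (\<theta> i + x * a i)) \<longlongrightarrow> \<theta> (i + 1) - \<theta> i) (at 0)"
      by (auto intro!: tendsto_eq_intros)
    have "0 < \<theta> (i + 1) - \<theta> i" "\<theta> (i + 1) - \<theta> i < 2 * pi"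
      using \<theta> by (auto simp: open_lifts_def algebra_simps)
    from order_tendstoD(1)[OF lim this(1)] order_tendstoD(2)[OF lim this(2)]
    show ?thesis by eventually_elim auto
  qed
  then have "\<forall>\<^sub>F x in at 0. \<forall>i\<in>{0..<int N}. \<theta> i + x * a i < \<theta> (i + 1) + x * a (i + 1)
      \<and> \<theta> (i + 1) + x * a (i + 1) < \<theta> i + x * a i + 2 * pi"
    by (intro eventually_ball_finite) auto
  then obtain \<epsilon> where \<epsilon>: "\<epsilon> > 0" "\<And>x. x \<noteq> 0 \<Longrightarrow> \<bar>x\<bar> < \<epsilon> \<Longrightarrow> \<forall>i\<in>{0..<int N}.
      \<theta> i + x * a i < \<theta> (i + 1) + x * a (i + 1) \<and> \<theta> (i + 1) + x * a (i + 1) < \<theta> i + x * a i + 2 * pi"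
    unfolding eventually_at by (auto simp: dist_real_def)
  have "(\<lambda>i. \<theta> i + x * a i) \<in> open_lifts N k" if "\<bar>x\<bar> < \<epsilon>" for x
  proof (cases "x = 0")
    case False
    have "quasi_periodic N k (\<lambda>i. \<theta> i + x * a i)"
      using \<theta> per by (simp add: quasi_periodic_def open_lifts_def)
    then show ?thesis using \<epsilon>(2)[OF False that] N by (intro open_liftsI) auto
  qed (use \<theta> in simp)
  then show ?thesis using \<epsilon>(1) by blast
qed

text \<open>The tie-break among maximizers that keeps consecutive points apart.\<close>

definition spread :: "nat \<Rightarrow> (int \<Rightarrow> real) \<Rightarrow> real" where
  "spread N \<theta> = (\<Sum>i<N. (\<theta> (int i + 1) - \<theta> (int i)) * (2 * pi - (\<theta> (int i + 1) - \<theta> (int i))))"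

lemma spread_shift:
  assumes "quasi_periodic N k \<theta>" shows "spread N (shift \<theta>) = spread N \<theta>"
  unfolding spread_def shift_def
  by (rule sum_shift_periodic[where g = "\<lambda>i. (\<theta> (i + 1) - \<theta> i) * (2 * pi - (\<theta> (i + 1) - \<theta> i))"])
    (use assms in \<open>simp add: quasi_periodic_diff[OF assms, of "_ + int N"] quasi_periodic_diff[OF assms, symmetric]\<close>)

text \<open>Moving the residue class of vertex 1 affects only the sides from 0 to 1 and from 1 to 2.
  The summand \<open>h\<close> is arbitrary so that the formula applies to both \<open>len\<close>
  and \<open>spread\<close>.\<close>

lemma bump_sum:
  fixes h :: "real \<Rightarrow> real \<Rightarrow> real"
  assumes "2 \<le> N" and \<xi>: "\<And>i. \<xi> i = (if i mod int N = 1 then \<theta> i + s else \<theta> i)"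
  shows "(\<Sum>i<N. h (\<xi> (int i)) (\<xi> (int i + 1))) - (\<Sum>i<N. h (\<theta> (int i)) (\<theta> (int i + 1)))
     = h (\<theta> 0) (\<theta> 1 + s) + h (\<theta> 1 + s) (\<theta> 2) - h (\<theta> 0) (\<theta> 1) - h (\<theta> 1) (\<theta> 2)"
proof -
  obtain M where M: "N = Suc (Suc M)" using assms(1) by (metis Suc_le_D numeral_2_eq_2 Suc_le_mono)
  have small: "\<xi> (int i) = \<theta> (int i)" if "2 \<le> i" "i \<le> N" for i
  proof -
    have "int i mod int N \<noteq> 1" using that assms(1) by (cases "i = N") auto
    then show ?thesis by (simp add: \<xi>)
  qed
  have "(\<Sum>i<M. h (\<xi> (int (Suc (Suc i)))) (\<xi> (int (Suc (Suc i)) + 1)))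
      = (\<Sum>i<M. h (\<theta> (int (Suc (Suc i)))) (\<theta> (int (Suc (Suc i)) + 1)))"
  proof (rule sum.cong)
    fix i assume "i \<in> {..<M}"
    then show "h (\<xi> (int (Suc (Suc i)))) (\<xi> (int (Suc (Suc i)) + 1))
      = h (\<theta> (int (Suc (Suc i)))) (\<theta> (int (Suc (Suc i)) + 1))"
      using small[of "Suc (Suc i)"] small[of "Suc (Suc (Suc i))"] M by (simp add: add.commute)
  qed simp
  moreover have "\<xi> 0 = \<theta> 0" "\<xi> 1 = \<theta> 1 + s" "\<xi> 2 = \<theta> 2"
    using small[of 2] assms(1) by (auto simp: \<xi>)
  ultimately show ?thesis
    unfolding M by (simp only: sum.lessThan_Suc_shift) (simp add: add.commute)
qed

lemma bump_closed:
  assumes \<theta>: "\<theta> \<in> closed_lifts N k" and N: "2 \<le> N"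
    and \<xi>: "\<And>i. \<xi> i = (if i mod int N = 1 then \<theta> i + s else \<theta> i)"
    and s: "0 \<le> \<theta> 1 + s - \<theta> 0" "\<theta> 1 + s - \<theta> 0 \<le> 2 * pi" "0 \<le> \<theta> 2 - (\<theta> 1 + s)" "\<theta> 2 - (\<theta> 1 + s) \<le> 2 * pi"
  shows "\<xi> \<in> closed_lifts N k"
proof (rule closed_liftsI)
  show "quasi_periodic N k \<xi>"
    using \<theta> by (auto simp: closed_lifts_def quasi_periodic_def \<xi>)
  show "0 < N" using N by simp
  fix i assume i: "0 \<le> i" "i < int N"
  have small: "\<xi> j = \<theta> j" if "2 \<le> j" "j \<le> int N" for j
  proof -
    have "j mod int N \<noteq> 1" using that N by (cases "j = int N") auto
    then show ?thesis by (simp add: \<xi>)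
  qed
  have 012: "\<xi> 0 = \<theta> 0" "\<xi> 1 = \<theta> 1 + s" "\<xi> 2 = \<theta> 2"
    using small[of 2] N by (auto simp: \<xi>)
  consider "i = 0" | "i = 1" | "2 \<le> i" using i by linarith
  then show "\<xi> i \<le> \<xi> (i + 1) \<and> \<xi> (i + 1) \<le> \<xi> i + 2 * pi"
  proof cases
    case 3
    then show ?thesis using small[of i] small[of "i + 1"] i \<theta> by (auto simp: closed_lifts_def)
  qed (use 012 s in auto)
qed

text \<open>A maximizer over the closed lifts may have steps 0 or \<open>2 * pi\<close>, so one with
  largest \<open>spread\<close> is taken among all maximizers. If a degenerate side were followed by
  one that is not degenerate in the same way, moving the vertex between them could increase
  \<open>spread\<close> without shortening the polygon. Hence one degenerate side makes all sides
  degenerate, and the winding number would be 0 or \<open>N\<close>.\<close>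

lemma len_max_interior:
  assumes N: "2 \<le> N" and k: "1 \<le> k" "k < int N"
  obtains \<theta> where "\<theta> \<in> open_lifts N k" "\<And>\<xi>. \<xi> \<in> closed_lifts N k \<Longrightarrow> len N \<xi> \<le> len N \<theta>"
proof -
  have ne: "closed_lifts N k \<noteq> {}" using assms by (intro closed_lifts_nonempty) auto
  obtain \<theta>0 where \<theta>0: "\<theta>0 \<in> closed_lifts N k" "\<And>\<xi>. \<xi> \<in> closed_lifts N k \<Longrightarrow> len N \<xi> \<le> len N \<theta>0"
    using closed_lifts_attains_max[of "closed_lifts N k" N k "len N"] ne
    by (auto simp: closed_closed_lifts continuous_on_len translate_closed len_translate)
  define S where "S = closed_lifts N k \<inter> {\<theta>. len N \<theta>0 \<le> len N \<theta>}"
  have clS: "closed S"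
    unfolding S_def by (intro closed_Int closed_closed_lifts closed_Collect_le continuous_on_len continuous_intros)
  have cont: "continuous_on UNIV (spread N)"
    unfolding spread_def by (intro continuous_intros continuous_on_coordinate)
  have tr: "spread N (translate m \<theta>) = spread N \<theta>" for m \<theta> by (simp add: spread_def translate_def)
  have S_sub: "S \<subseteq> closed_lifts N k" and S_ne: "S \<noteq> {}" using \<theta>0 by (auto simp: S_def)
  obtain \<theta> where \<theta>: "\<theta> \<in> S" "\<And>\<xi>. \<xi> \<in> S \<Longrightarrow> spread N \<xi> \<le> spread N \<theta>"
    using closed_lifts_attains_max[OF S_sub S_ne clS cont] tr
    by (auto simp: S_def translate_closed len_translate)
  \<comment> \<open>With d and d' the steps before and after vertex 1, moving that vertex by
    \<open>s\<close> changes \<open>spread\<close> by 2 s (d' - d - s). The last condition says that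
    this is an increase.\<close>
  have step: "\<not> (\<exists>s. s \<noteq> 0 \<and> D (\<eta> 0) (\<eta> 1) = 0 \<and> 0 \<le> \<eta> 1 + s - \<eta> 0 \<and> \<eta> 1 + s - \<eta> 0 \<le> 2 * pi
      \<and> 0 \<le> \<eta> 2 - (\<eta> 1 + s) \<and> \<eta> 2 - (\<eta> 1 + s) \<le> 2 * pi
      \<and> s * ((\<eta> 2 - \<eta> 1) - (\<eta> 1 - \<eta> 0) - s) > 0)"
    if \<eta>: "\<eta> \<in> S" "spread N \<eta> = spread N \<theta>" for \<eta>
  proof
    assume "\<exists>s. s \<noteq> 0 \<and> D (\<eta> 0) (\<eta> 1) = 0 \<and> 0 \<le> \<eta> 1 + s - \<eta> 0 \<and> \<eta> 1 + s - \<eta> 0 \<le> 2 * pi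
      \<and> 0 \<le> \<eta> 2 - (\<eta> 1 + s) \<and> \<eta> 2 - (\<eta> 1 + s) \<le> 2 * pi
      \<and> s * ((\<eta> 2 - \<eta> 1) - (\<eta> 1 - \<eta> 0) - s) > 0"
    then obtain s where s: "D (\<eta> 0) (\<eta> 1) = 0" "0 \<le> \<eta> 1 + s - \<eta> 0" "\<eta> 1 + s - \<eta> 0 \<le> 2 * pi"
      "0 \<le> \<eta> 2 - (\<eta> 1 + s)" "\<eta> 2 - (\<eta> 1 + s) \<le> 2 * pi" "s * ((\<eta> 2 - \<eta> 1) - (\<eta> 1 - \<eta> 0) - s) > 0"
      by blast
    define \<xi> where "\<xi> i = (if i mod int N = 1 then \<eta> i + s else \<eta> i)" for i
    have cl: "\<xi> \<in> closed_lifts N k"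
      using \<eta>(1) by (intro bump_closed[of \<eta> N k \<xi> s] N s \<xi>_def) (auto simp: S_def)
    \<comment> \<open>Vertices 0 and 1 coincide on the curve, so the two old sides together are as
      long as the chord from 0 to 2, and no detour is shorter than that chord.\<close>
    have "len N \<xi> - len N \<eta> = D (\<eta> 0) (\<eta> 1 + s) + D (\<eta> 1 + s) (\<eta> 2) - D (\<eta> 0) (\<eta> 1) - D (\<eta> 1) (\<eta> 2)"
      unfolding len_def by (rule bump_sum[OF N \<xi>_def])
    moreover have "D (\<eta> 1) (\<eta> 2) \<le> D (\<eta> 1) (\<eta> 0) + D (\<eta> 0) (\<eta> 2)" by (rule D_triangle)
    moreover have "D (\<eta> 0) (\<eta> 2) \<le> D (\<eta> 0) (\<eta> 1 + s) + D (\<eta> 1 + s) (\<eta> 2)" by (rule D_triangle)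
    ultimately have "len N \<eta> \<le> len N \<xi>" using s(1) D_sym[of "\<eta> 1" "\<eta> 0"] by linarith
    then have "\<xi> \<in> S" using cl \<eta>(1) by (auto simp: S_def)
    then have "spread N \<xi> \<le> spread N \<eta>" using \<theta>(2) \<eta>(2) by simp
    moreover have "spread N \<xi> - spread N \<eta> =
        (\<lambda>x y. (y - x) * (2 * pi - (y - x))) (\<eta> 0) (\<eta> 1 + s) + (\<lambda>x y. (y - x) * (2 * pi - (y - x))) (\<eta> 1 + s) (\<eta> 2)
        - (\<lambda>x y. (y - x) * (2 * pi - (y - x))) (\<eta> 0) (\<eta> 1) - (\<lambda>x y. (y - x) * (2 * pi - (y - x))) (\<eta> 1) (\<eta> 2)"
      unfolding spread_def by (rule bump_sum[OF N \<xi>_def])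
    moreover have "\<dots> = 2 * (s * ((\<eta> 2 - \<eta> 1) - (\<eta> 1 - \<eta> 0) - s))"
      by (simp add: algebra_simps)
    ultimately show False using s(6) by simp
  qed
  have propagate: "(\<theta> (i + 1) = \<theta> i \<longrightarrow> \<theta> (i + 2) = \<theta> (i + 1))
      \<and> (\<theta> (i + 1) = \<theta> i + 2 * pi \<longrightarrow> \<theta> (i + 2) = \<theta> (i + 1) + 2 * pi)" if "0 \<le> i" for i
  proof -
    define \<eta> where "\<eta> = (shift ^^ nat i) \<theta>"
    have qp: "quasi_periodic N k ((shift ^^ j) \<theta>)" for j
      using \<theta>(1) shift_pow_closed[of \<theta> N k j] by (auto simp: S_def closed_lifts_def)
    have inv: "len N ((shift ^^ j) \<theta>) = len N \<theta> \<and> spread N ((shift ^^ j) \<theta>) = spread N \<theta>" for j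
      by (induction j) (simp_all add: len_shift[OF qp] spread_shift[OF qp])
    have \<eta>S: "\<eta> \<in> S" and \<eta>q: "spread N \<eta> = spread N \<theta>"
      using inv \<theta>(1) shift_pow_closed[of \<theta> N k "nat i"] by (auto simp: S_def \<eta>_def)
    have \<eta>: "\<eta> 0 = \<theta> i" "\<eta> 1 = \<theta> (i + 1)" "\<eta> 2 = \<theta> (i + 2)"
      using that by (simp_all add: \<eta>_def shift_pow add.commute)
    have d1: "0 \<le> \<eta> 2 - \<eta> 1" "\<eta> 2 - \<eta> 1 \<le> 2 * pi"
    proof -
      have "\<theta> (i + 1) \<le> \<theta> (i + 1 + 1) \<and> \<theta> (i + 1 + 1) \<le> \<theta> (i + 1) + 2 * pi"
        using \<theta>(1) unfolding S_def closed_lifts_def by blast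
      then show "0 \<le> \<eta> 2 - \<eta> 1" "\<eta> 2 - \<eta> 1 \<le> 2 * pi" by (simp_all add: \<eta> add.commute)
    qed
    have "\<eta> 2 = \<eta> 1" if "\<eta> 1 = \<eta> 0"
    proof (rule ccontr)
      assume "\<eta> 2 \<noteq> \<eta> 1"
      then have "0 < \<eta> 2 - \<eta> 1" using d1 by simp
      \<comment> \<open>The value that makes the two steps equal.\<close>
      define s where "s = (\<eta> 2 - \<eta> 1) / 2"
      have s: "0 < s" "\<eta> 2 - \<eta> 1 = 2 * s" using \<open>0 < \<eta> 2 - \<eta> 1\<close> by (auto simp: s_def)
      have "(\<eta> 2 - \<eta> 1) - (\<eta> 1 - \<eta> 0) - s = s" using s that by linarith
      then have "0 < s * ((\<eta> 2 - \<eta> 1) - (\<eta> 1 - \<eta> 0) - s)"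
        using mult_pos_pos[OF s(1) s(1)] by (simp only:)
      moreover have "D (\<eta> 0) (\<eta> 1) = 0" using that by simp
      moreover have "0 \<le> \<eta> 1 + s - \<eta> 0" "\<eta> 1 + s - \<eta> 0 \<le> 2 * pi" "0 \<le> \<eta> 2 - (\<eta> 1 + s)" "\<eta> 2 - (\<eta> 1 + s) \<le> 2 * pi" "s \<noteq> 0"
        using d1 s that by linarith+
      ultimately show False using step[OF \<eta>S \<eta>q] by blast
    qed
    moreover have "\<eta> 2 = \<eta> 1 + 2 * pi" if "\<eta> 1 = \<eta> 0 + 2 * pi"
    proof (rule ccontr)
      assume "\<eta> 2 \<noteq> \<eta> 1 + 2 * pi"
      then have e: "0 < 2 * pi - (\<eta> 2 - \<eta> 1)" using d1 by simp
      have z: "D (\<eta> 0) (\<eta> 1) = 0" using D_eq_0_iff[of "\<eta> 0" "\<eta> 1"] that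
        by (metis add_diff_cancel_left' mult.right_neutral of_int_1)
      \<comment> \<open>Again the value that makes the two steps equal, now by moving the vertex
        backwards.\<close>
      define s where "s = - (2 * pi - (\<eta> 2 - \<eta> 1)) / 2"
      have s: "s < 0" "\<eta> 2 - \<eta> 1 = 2 * pi + 2 * s" using e by (auto simp: s_def field_simps)
      have "0 < s * s" using s(1) by (simp add: mult_neg_neg)
      moreover have "(\<eta> 2 - \<eta> 1) - (\<eta> 1 - \<eta> 0) - s = s" using s that by linarith
      ultimately have "0 < s * ((\<eta> 2 - \<eta> 1) - (\<eta> 1 - \<eta> 0) - s)" by (simp only:)
      moreover have "0 \<le> \<eta> 1 + s - \<eta> 0" "\<eta> 1 + s - \<eta> 0 \<le> 2 * pi" "0 \<le> \<eta> 2 - (\<eta> 1 + s)" "\<eta> 2 - (\<eta> 1 + s) \<le> 2 * pi" "s \<noteq> 0"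
        using d1 s that by linarith+
      ultimately show False using step[OF \<eta>S \<eta>q] z by blast
    qed
    ultimately show ?thesis by (simp add: \<eta>)
  qed
  have qp: "quasi_periodic N k \<theta>" using \<theta>(1) by (simp add: S_def closed_lifts_def)
  have sum_d: "(\<Sum>i<N. \<eta> (int i + 1) - \<eta> (int i)) = 2 * pi * of_int k" if "quasi_periodic N k \<eta>" for \<eta>
    using that sum_telescope_int[of \<eta> N] unfolding quasi_periodic_def by (metis add_0 add_diff_cancel_left')
  have strict: "\<theta> i \<noteq> \<theta> (i + 1) \<and> \<theta> (i + 1) \<noteq> \<theta> i + 2 * pi" if i: "0 \<le> i" for i
  proof -
    have all0: "\<theta> (i + int j + 1) = \<theta> (i + int j)" if "\<theta> (i + 1) = \<theta> i" for j
    proof (induction j)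
      case (Suc j)
      then show ?case using propagate[of "i + int j"] i by (simp add: algebra_simps)
    qed (use that in simp)
    have all1: "\<theta> (i + int j + 1) = \<theta> (i + int j) + 2 * pi" if "\<theta> (i + 1) = \<theta> i + 2 * pi" for j
    proof (induction j)
      case (Suc j)
      then show ?case using propagate[of "i + int j"] i by (simp add: algebra_simps)
    qed (use that in simp)
    let ?\<eta> = "(shift ^^ nat i) \<theta>"
    have "quasi_periodic N k ?\<eta>"
      using \<theta>(1) shift_pow_closed[of \<theta> N k "nat i"] by (auto simp: S_def closed_lifts_def)
    from sum_d[OF this] have S: "(\<Sum>j<N. \<theta> (i + int j + 1) - \<theta> (i + int j)) = 2 * pi * of_int k"
      using i by (simp add: shift_pow algebra_simps)
    show ?thesis
    proof (intro conjI notI)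
      assume "\<theta> i = \<theta> (i + 1)"
      then have "2 * pi * of_int k = (0 :: real)" using S all0 by simp
      then show False using k by simp
    next
      assume "\<theta> (i + 1) = \<theta> i + 2 * pi"
      then have "(\<Sum>j<N. \<theta> (i + int j + 1) - \<theta> (i + int j)) = (\<Sum>j<N. 2 * pi)"
        using all1 by (intro sum.cong) auto
      then have "2 * pi * real N = 2 * pi * of_int k" using S by simp
      then have "real N = of_int k" by simp
      then show False using k by linarith
    qed
  qed
  have "\<theta> \<in> open_lifts N k"
  proof (rule open_liftsI[OF qp])
    show "0 < N" using N by simp
    fix i assume "0 \<le> i" "i < int N"
    then show "\<theta> i < \<theta> (i + 1) \<and> \<theta> (i + 1) < \<theta> i + 2 * pi"
      using strict[of i] \<theta>(1) unfolding S_def closed_lifts_def by (auto simp: less_le)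
  qed
  moreover have "len N \<xi> \<le> len N \<theta>" if "\<xi> \<in> closed_lifts N k" for \<xi>
    using \<theta>0(2)[OF that] \<theta>(1) by (simp add: S_def)
  ultimately show ?thesis using that by blast
qed

end

section \<open>Reversal, deletion of degenerate vertices, and dominating polygons\<close>

definition extend :: "nat \<Rightarrow> int \<Rightarrow> (int \<Rightarrow> real) \<Rightarrow> int \<Rightarrow> real" where
  "extend N k g = (\<lambda>i. g (i mod int N) + 2 * pi * of_int k * of_int (i div int N))"

lemma quasi_periodic_extend: "0 < N \<Longrightarrow> quasi_periodic N k (extend N k g)"
  by (simp add: quasi_periodic_def extend_def algebra_simps)

lemma extend_eq: "0 \<le> i \<Longrightarrow> i < int N \<Longrightarrow> extend N k g i = g i"
  by (simp add: extend_def)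

text \<open>Traversing backwards turns a step d into -d; the added turn per index makes it
  \<open>2 * pi\<close> - d, which is again between 0 and \<open>2 * pi\<close>. This is why the
  winding number \<open>k\<close> becomes \<open>N - k\<close>.\<close>

definition reverse :: "(int \<Rightarrow> real) \<Rightarrow> int \<Rightarrow> real" where
  "reverse \<theta> = (\<lambda>i. \<theta> (- i) + 2 * pi * of_int i)"

lemma quasi_periodic_reverse:
  assumes "quasi_periodic N k \<theta>" shows "quasi_periodic N (int N - k) (reverse \<theta>)"
proof -
  have "\<theta> (- i) = \<theta> (- (i + int N)) + 2 * pi * of_int k" for i
    using assms unfolding quasi_periodic_def by (metis add.commute minus_add_cancel minus_add_distrib)
  then show ?thesis
    unfolding quasi_periodic_def reverse_def by (simp add: algebra_simps)
qed

lemma reverse_closed: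
  assumes "\<theta> \<in> closed_lifts N k" shows "reverse \<theta> \<in> closed_lifts N (int N - k)"
proof -
  have "\<theta> (- (i + 1)) \<le> \<theta> (- (i + 1) + 1) \<and> \<theta> (- (i + 1) + 1) \<le> \<theta> (- (i + 1)) + 2 * pi" for i
    using assms unfolding closed_lifts_def by blast
  then have "\<theta> (- (i + 1)) \<le> \<theta> (- i) \<and> \<theta> (- i) \<le> \<theta> (- (i + 1)) + 2 * pi" for i
    by (metis add.commute minus_add_cancel minus_add_distrib)
  then show ?thesis
    using assms quasi_periodic_reverse by (simp add: closed_lifts_def) (simp add: reverse_def algebra_simps)
qed

lemma reverse_open:
  assumes "\<theta> \<in> open_lifts N k" shows "reverse \<theta> \<in> open_lifts N (int N - k)"
proof -
  have "\<theta> (- (i + 1)) < \<theta> (- (i + 1) + 1) \<and> \<theta> (- (i + 1) + 1) < \<theta> (- (i + 1)) + 2 * pi" for i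
    using assms unfolding open_lifts_def by blast
  then have "\<theta> (- (i + 1)) < \<theta> (- i) \<and> \<theta> (- i) < \<theta> (- (i + 1)) + 2 * pi" for i
    by (metis add.commute minus_add_cancel minus_add_distrib)
  then show ?thesis
    using assms quasi_periodic_reverse by (simp add: open_lifts_def) (simp add: reverse_def algebra_simps)
qed

context closed_curve
begin

lemma len_reverse:
  assumes "quasi_periodic N k \<theta>" shows "len N (reverse \<theta>) = len N \<theta>"
proof -
  have "len N (reverse \<theta>) = (\<Sum>i<N. D (\<theta> (- int i)) (\<theta> (- int i - 1)))"
  proof -
    have "D (reverse \<theta> i) (reverse \<theta> (i + 1)) = D (\<theta> (- i)) (\<theta> (- i - 1))" for i
      using D_periodic(1)[of "\<theta> (- i)" i] D_periodic(2)[of _ "\<theta> (- i - 1)" "i + 1"]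
      by (simp add: reverse_def)
    then show ?thesis by (simp add: len_def)
  qed
  also have "\<dots> = (\<Sum>i<N. D (\<theta> (int i)) (\<theta> (int i + 1)))"
  proof (rule sum.reindex_bij_witness[where i = "\<lambda>i. N - Suc i" and j = "\<lambda>i. N - Suc i"])
    fix i assume "i \<in> {..<N}"
    then have e: "int (N - Suc i) = (- int i - 1) + int N" "int (N - Suc i) + 1 = - int i + int N" by auto
    have "\<theta> (int (N - Suc i)) = \<theta> (- int i - 1) + 2 * pi * of_int k"
      using assms unfolding e(1) quasi_periodic_def by blast
    moreover have "\<theta> (int (N - Suc i) + 1) = \<theta> (- int i) + 2 * pi * of_int k"
      using assms unfolding e(2) quasi_periodic_def by blast
    ultimately show "D (\<theta> (int (N - Suc i))) (\<theta> (int (N - Suc i) + 1)) = D (\<theta> (- int i)) (\<theta> (- int i - 1))"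
      by (simp add: D_periodic) (rule D_sym)
  qed auto
  finally show ?thesis by (simp add: len_def)
qed

text \<open>Vertex \<open>N\<close> coincides on the curve with vertex \<open>N + 1\<close>, the
  next copy of vertex 0, so it can itself close up an \<open>N\<close>-gon. The winding number drops
  by the \<open>e\<close> turns contained in the deleted side.\<close>

lemma boundary_delete_last:
  assumes \<theta>: "\<theta> \<in> closed_lifts (Suc N) k" and N: "1 \<le> N"
    and e: "\<theta> (int N + 1) = \<theta> (int N) + 2 * pi * of_int e"
  shows "\<exists>\<eta>\<in>closed_lifts N (k - e). len N \<eta> = len (Suc N) \<theta>"
proof
  let ?\<eta> = "extend N (k - e) \<theta>"
  have qp: "quasi_periodic N (k - e) ?\<eta>" using N by (intro quasi_periodic_extend) auto
  have "\<theta> (0 + int (Suc N)) = \<theta> 0 + 2 * pi * of_int k"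
    using \<theta> unfolding closed_lifts_def quasi_periodic_def by blast
  then have \<theta>0: "\<theta> 0 + 2 * pi * of_int (k - e) = \<theta> (int N)" using e by (simp add: algebra_simps)
  have "?\<eta> (0 + int N) = ?\<eta> 0 + 2 * pi * of_int (k - e)"
    using qp unfolding quasi_periodic_def by blast
  then have eqN: "?\<eta> (int N) = \<theta> (int N)" using \<theta>0 N by (simp add: extend_eq)
  have eq: "?\<eta> i = \<theta> i" if "0 \<le> i" "i \<le> int N" for i
    using that eqN by (cases "i = int N") (auto simp: extend_eq)
  show "?\<eta> \<in> closed_lifts N (k - e)"
    using \<theta> N by (intro closed_liftsI qp) (auto simp: eq closed_lifts_def)
  have "D (\<theta> (int N)) (\<theta> (int N + 1)) = 0" by (simp add: e D_periodic)
  moreover have "len N ?\<eta> = (\<Sum>i<N. D (\<theta> (int i)) (\<theta> (int i + 1)))"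
    unfolding len_def by (intro sum.cong) (auto simp: eq)
  ultimately show "len N ?\<eta> = len (Suc N) \<theta>" by (simp add: len_def)
qed

lemma len_shift_pow:
  assumes "quasi_periodic N k \<theta>" shows "len N ((shift ^^ j) \<theta>) = len N \<theta>"
proof -
  have qp: "quasi_periodic N k ((shift ^^ j) \<theta>)" for j
    by (induction j) (simp_all add: assms quasi_periodic_shift)
  show ?thesis by (induction j) (simp_all add: len_shift[OF qp])
qed

text \<open>A closed lift that is not open has a step 0 or \<open>2 * pi\<close>; a cyclic shift
  makes it the last one.\<close>

lemma boundary_delete:
  assumes \<theta>: "\<theta> \<in> closed_lifts (Suc N) k" "\<theta> \<notin> open_lifts (Suc N) k" and N: "1 \<le> N"
  shows "\<exists>e\<in>{0, 1}. \<exists>\<eta>\<in>closed_lifts N (k - e). len N \<eta> = len (Suc N) \<theta>"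
proof -
  have qp: "quasi_periodic (Suc N) k \<theta>" using \<theta>(1) by (simp add: closed_lifts_def)
  obtain i where i: "0 \<le> i" "i < int (Suc N)" "\<not> (\<theta> i < \<theta> (i + 1) \<and> \<theta> (i + 1) < \<theta> i + 2 * pi)"
    using open_liftsI[OF qp] \<theta>(2) by blast
  then have "\<exists>e\<in>{0, 1}. \<theta> (i + 1) = \<theta> i + 2 * pi * of_int e"
    using \<theta>(1) unfolding closed_lifts_def by (auto simp: not_less intro: antisym)
  then obtain e :: int where e: "e \<in> {0, 1}" "\<theta> (i + 1) = \<theta> i + 2 * pi * of_int e" ..
  let ?\<eta> = "(shift ^^ nat (i + 1)) \<theta>"
  have "\<theta> (i + int (Suc N)) = \<theta> i + 2 * pi * of_int k" "\<theta> (i + 1 + int (Suc N)) = \<theta> (i + 1) + 2 * pi * of_int k"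
    using qp unfolding quasi_periodic_def by blast+
  moreover have "?\<eta> (int N) = \<theta> (i + int (Suc N))" "?\<eta> (int N + 1) = \<theta> (i + 1 + int (Suc N))"
    using i(1) by (simp_all add: shift_pow algebra_simps)
  ultimately have "?\<eta> (int N + 1) = ?\<eta> (int N) + 2 * pi * of_int e"
    using e(2) by simp
  from boundary_delete_last[OF shift_pow_closed[OF \<theta>(1)] N this] e(1) show ?thesis
    by (auto simp: len_shift_pow[OF qp])
qed

lemma len_nonneg: "0 \<le> len N \<theta>"
  by (simp add: len_def sum_nonneg)

lemma len_closed_lifts_0:
  assumes "\<theta> \<in> closed_lifts N 0" shows "len N \<theta> = 0"
proof -
  have le: "\<theta> i \<le> \<theta> (i + 1)" for i using assms by (simp add: closed_lifts_def)
  have "\<theta> (0 + int N) = \<theta> 0 + 2 * pi * of_int 0"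
    using assms unfolding closed_lifts_def quasi_periodic_def by blast
  then have "(\<Sum>i<N. \<theta> (int i + 1) - \<theta> (int i)) = 0"
    using sum_telescope_int[of \<theta> N] by simp
  then have "\<forall>i\<in>{..<N}. \<theta> (int i + 1) - \<theta> (int i) = 0"
    using le by (subst (asm) sum_nonneg_eq_0_iff) auto
  then show ?thesis by (simp add: len_def)
qed

text \<open>By \<open>boundary_delete\<close>, such a \<open>Y\<close> is at least as long as every
  degenerate polygon with one more vertex and winding number \<open>k\<close>. Its own winding
  number is \<open>k\<close> as well, so that inserting a vertex into \<open>Y\<close> stays in that
  class.\<close>

definition dominating :: "nat \<Rightarrow> int \<Rightarrow> (int \<Rightarrow> real) \<Rightarrow> bool" where
  "dominating N k Y \<longleftrightarrow> Y \<in> open_lifts N k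
     \<and> (\<forall>\<eta>\<in>closed_lifts N k \<union> closed_lifts N (k - 1). len N \<eta> \<le> len N Y)"

text \<open>Either a longest \<open>N\<close>-gon \<open>Y\<close> with winding number
  \<open>k\<close> dominates, or a longest \<open>X\<close> with winding number \<open>k - 1\<close>
  is at least as long as \<open>Y\<close>. Reversal sends \<open>k - 1\<close> to
  \<open>N + 1 - k\<close> and \<open>k\<close> to \<open>N - k\<close>, which is one less, so in
  the second case the reverse of \<open>X\<close> dominates.\<close>

lemma ex_dominating:
  assumes k: "1 \<le> k" "2 * k \<le> int N"
  shows "\<exists>k'\<in>{k, int N + 1 - k}. \<exists>Y. dominating N k' Y"
proof -
  have N: "2 \<le> N" using k by linarith
  obtain Y where Y: "Y \<in> open_lifts N k" "\<And>\<xi>. \<xi> \<in> closed_lifts N k \<Longrightarrow> len N \<xi> \<le> len N Y"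
    using len_max_interior[OF N, of k] k by auto
  show ?thesis
  proof (cases "\<forall>\<eta>\<in>closed_lifts N (k - 1). len N \<eta> \<le> len N Y")
    case True
    then show ?thesis using Y by (auto simp: dominating_def)
  next
    case False
    \<comment> \<open>For \<open>k = 1\<close> the competing winding number is 0, where all lengths
      vanish. So \<open>k - 1\<close> is at least 1, as \<open>len_max_interior\<close>
      requires.\<close>
    then have "k \<noteq> 1" using len_closed_lifts_0 len_nonneg by force
    then obtain X where X: "X \<in> open_lifts N (k - 1)"
      "\<And>\<xi>. \<xi> \<in> closed_lifts N (k - 1) \<Longrightarrow> len N \<xi> \<le> len N X"
      using len_max_interior[OF N, of "k - 1"] k by auto
    have YX: "len N Y \<le> len N X" using False X(2) by (meson linear order_trans)
    have qpX: "quasi_periodic N (k - 1) X" using X(1) by (simp add: open_lifts_def)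
    have "dominating N (int N + 1 - k) (reverse X)"
      unfolding dominating_def
    proof (intro conjI ballI)
      show "reverse X \<in> open_lifts N (int N + 1 - k)"
        using reverse_open[OF X(1)] by (simp add: algebra_simps)
      fix \<eta> assume "\<eta> \<in> closed_lifts N (int N + 1 - k) \<union> closed_lifts N (int N + 1 - k - 1)"
      then show "len N \<eta> \<le> len N (reverse X)"
      proof
        assume \<eta>: "\<eta> \<in> closed_lifts N (int N + 1 - k)"
        have "len N (reverse \<eta>) \<le> len N X"
          using reverse_closed[OF \<eta>] by (intro X(2)) (simp add: algebra_simps)
        moreover have "quasi_periodic N (int N + 1 - k) \<eta>" using \<eta> by (simp add: closed_lifts_def)
        ultimately show ?thesis
          using len_reverse[OF qpX] len_reverse by metis
      next
        assume \<eta>: "\<eta> \<in> closed_lifts N (int N + 1 - k - 1)"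
        have "len N (reverse \<eta>) \<le> len N Y"
          using reverse_closed[OF \<eta>] by (intro Y(2)) (simp add: algebra_simps)
        moreover have "quasi_periodic N (int N + 1 - k - 1) \<eta>" using \<eta> by (simp add: closed_lifts_def)
        ultimately show ?thesis
          using len_reverse[OF qpX] len_reverse YX by (metis order_trans)
      qed
    qed
    then show ?thesis by blast
  qed
qed

lemma critical_if_max:
  assumes Y: "Y \<in> open_lifts N k" and max: "\<And>\<eta>. \<eta> \<in> open_lifts N k \<Longrightarrow> len N \<eta> \<le> len N Y"
    and N: "0 < N"
  shows "critical Y"
proof (rule critical_if_directional[OF _ N])
  show qp: "quasi_periodic N k Y" using Y by (simp add: open_lifts_def)
  fix a :: "int \<Rightarrow> real" assume a: "\<And>i. a (i + int N) = a i"
  obtain \<epsilon> where \<epsilon>: "\<epsilon> > 0" "\<And>x. \<bar>x\<bar> < \<epsilon> \<Longrightarrow> (\<lambda>i. Y i + x * a i) \<in> open_lifts N k"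
    using open_lifts_line[where a = a, OF Y a N] by blast
  have "((\<lambda>x. len N (\<lambda>i. Y i + x * a i)) has_real_derivative
     (\<Sum>i<N. a (int i) * grad (\<lambda>i. Y i + 0 * a i) (int i))) (at 0)"
    using D_open_lifts(1)[OF Y] by (intro has_derivative_len[where a = a, OF qp a]) (simp add: less_imp_neq[symmetric])
  then have "(\<Sum>i<N. a (int i) * grad (\<lambda>i. Y i + 0 * a i) (int i)) = 0"
    by (rule DERIV_local_max[OF _ \<epsilon>(1)]) (use max[OF \<epsilon>(2)] in auto)
  then show "(\<Sum>i<N. a (int i) * grad Y (int i)) = 0" by simp
qed

end

subsection \<open>Moving an inserted vertex round a polygon\<close>

text \<open>The vertex \<open>Y (int N)\<close> is split into a pair \<open>a\<close>,
  \<open>b\<close> at the positions \<open>N\<close> and \<open>N + 1\<close>. The latter is 0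
  modulo \<open>N + 1\<close>, which explains the value at 0. A vertex is inserted on the side
  before \<open>Y (int N)\<close> when \<open>b\<close> is that vertex, and on the side after it
  when \<open>a\<close> is.\<close>

definition insert_vertex :: "nat \<Rightarrow> int \<Rightarrow> (int \<Rightarrow> real) \<Rightarrow> real \<Rightarrow> real \<Rightarrow> int \<Rightarrow> real" where
  "insert_vertex N k Y a b = extend (Suc N) k
     (\<lambda>i. if i = int N then a else if i = 0 then b - 2 * pi * of_int k else Y i)"

lemma quasi_periodic_insert: "quasi_periodic (Suc N) k (insert_vertex N k Y a b)"
  unfolding insert_vertex_def by (rule quasi_periodic_extend) simp

lemma insert_vertex_eq:
  assumes "1 \<le> N"
  shows "insert_vertex N k Y a b 0 = b - 2 * pi * of_int k"
    "0 < i \<Longrightarrow> i < int N \<Longrightarrow> insert_vertex N k Y a b i = Y i"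
    "insert_vertex N k Y a b (int N) = a"
    "insert_vertex N k Y a b (int N + 1) = b"
proof -
  show 0: "insert_vertex N k Y a b 0 = b - 2 * pi * of_int k"
    using assms by (simp add: insert_vertex_def extend_eq)
  show "0 < i \<Longrightarrow> i < int N \<Longrightarrow> insert_vertex N k Y a b i = Y i"
    "insert_vertex N k Y a b (int N) = a"
    by (simp_all add: insert_vertex_def extend_eq)
  have "insert_vertex N k Y a b (0 + int (Suc N)) = insert_vertex N k Y a b 0 + 2 * pi * of_int k"
    using quasi_periodic_insert unfolding quasi_periodic_def by blast
  then show "insert_vertex N k Y a b (int N + 1) = b" using 0 by (simp add: add.commute)
qed

lemma insert_vertex_open:
  assumes Y: "Y \<in> open_lifts N k" and N: "2 \<le> N"
    and a: "Y (int N - 1) < a" "a < Y (int N - 1) + 2 * pi" "a < b" "b < a + 2 * pi"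
    and b: "b < Y (int N + 1)" "Y (int N + 1) < b + 2 * pi"
  shows "insert_vertex N k Y a b \<in> open_lifts (Suc N) k"
proof (rule open_liftsI[OF quasi_periodic_insert])
  fix i assume i: "0 \<le> i" "i < int (Suc N)"
  have N1: "1 \<le> N" using N by simp
  note eq = insert_vertex_eq[OF N1, where k = k and Y = Y and a = a and b = b]
  have "Y (1 + int N) = Y 1 + 2 * pi * of_int k"
    using Y unfolding open_lifts_def quasi_periodic_def by blast
  then have Y1: "Y 1 = Y (int N + 1) - 2 * pi * of_int k" by (simp add: add.commute)
  consider "i = 0" | "0 < i" "i < int N - 1" | "0 < i" "i = int N - 1" | "i = int N" using i N by linarith
  then show "insert_vertex N k Y a b i < insert_vertex N k Y a b (i + 1)
      \<and> insert_vertex N k Y a b (i + 1) < insert_vertex N k Y a b i + 2 * pi"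
  proof cases
    case 1
    then show ?thesis using eq(1) eq(2)[of 1] N b Y1 by auto
  next
    case 2
    then show ?thesis using eq(2)[of i] eq(2)[of "i + 1"] Y by (auto simp: open_lifts_def)
  next
    case 3
    then show ?thesis using eq(2)[of i] eq(3) a by auto
  next
    case 4
    then show ?thesis using eq(3,4) a by auto
  qed
qed simp

lemma insert_vertex_convex:
  "(\<lambda>i. (1 - t) * insert_vertex N k Y a b i + t * insert_vertex N k Y a' b' i)
     = insert_vertex N k Y ((1 - t) * a + t * a') ((1 - t) * b + t * b')"
  by (rule ext) (simp add: insert_vertex_def extend_def algebra_simps)

text \<open>A variation of the enlarged polygon is a variation of \<open>Y\<close> together with
  independent motions of \<open>a\<close> and \<open>b\<close>. The index \<open>i mod int N\<close>
  lets \<open>Y (int N)\<close> move by \<open>x 0\<close>, exactly as \<open>b\<close>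
  does.\<close>

lemma insert_vertex_line:
  assumes N: "1 \<le> N" and x: "\<And>i. x (i + int (Suc N)) = x i"
  shows "(\<lambda>i. insert_vertex N k Y a b i + z * x i)
     = insert_vertex N k (\<lambda>i. Y i + z * x (i mod int N)) (a + z * x (int N)) (b + z * x 0)"
proof (rule quasi_periodic_eqI)
  show "quasi_periodic (Suc N) k (\<lambda>i. insert_vertex N k Y a b i + z * x i)"
    using quasi_periodic_insert[of N k Y a b] x by (simp add: quasi_periodic_def)
  fix i assume "0 \<le> i" "i < int (Suc N)"
  then consider "i = 0" | "0 < i" "i < int N" | "i = int N" by linarith
  then show "insert_vertex N k Y a b i + z * x i
      = insert_vertex N k (\<lambda>i. Y i + z * x (i mod int N)) (a + z * x (int N)) (b + z * x 0) i"
    by cases (simp_all add: insert_vertex_eq[OF N])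
qed (simp_all add: quasi_periodic_insert)

lemma path_component_segment:
  fixes \<theta> \<xi> :: "int \<Rightarrow> real"
  assumes "\<And>t. 0 \<le> t \<Longrightarrow> t \<le> 1 \<Longrightarrow> (\<lambda>i. (1 - t) * \<theta> i + t * \<xi> i) \<in> S"
  shows "path_component S \<theta> \<xi>"
proof -
  let ?g = "\<lambda>t i. (1 - t) * \<theta> i + t * \<xi> i"
  have "path ?g"
    unfolding path_def by (intro continuous_on_coordinatewise_then_product continuous_intros)
  moreover have "path_image ?g \<subseteq> S" using assms by (auto simp: path_image_def)
  ultimately show ?thesis
    unfolding path_component_def by (intro exI[of _ ?g]) (auto simp: pathstart_def pathfinish_def)
qed

lemma path_component_image:
  assumes "path_component S x y" "continuous_on S h" "h ` S \<subseteq> T"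
  shows "path_component T (h x) (h y)"
proof -
  obtain g where g: "path g" "path_image g \<subseteq> S" "pathstart g = x" "pathfinish g = y"
    using assms(1) by (auto simp: path_component_def)
  have "path (h \<circ> g)"
    by (rule path_continuous_image[OF g(1) continuous_on_subset[OF assms(2) g(2)]])
  moreover have "path_image (h \<circ> g) \<subseteq> T" 
    unfolding path_image_compose using g(2) assms(3) by blast
  moreover have "pathstart (h \<circ> g) = h x" "pathfinish (h \<circ> g) = h y"
    using g(3,4) by (simp_all add: pathstart_def pathfinish_def)
  ultimately show ?thesis unfolding path_component_def by blast
qed

lemma continuous_on_shift: "continuous_on S shift"
  unfolding shift_def by (intro continuous_on_coordinatewise_then_product continuous_on_coordinate)

context closed_curve
begin

text \<open>The gain in length from splitting \<open>Y (int N)\<close> into \<open>a\<close> and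
  \<open>b\<close>. For \<open>b = Y (int N)\<close> it is the defect in the triangle inequality for
  \<open>a\<close> and the side ending at that vertex.\<close>

definition excess :: "nat \<Rightarrow> (int \<Rightarrow> real) \<Rightarrow> real \<Rightarrow> real \<Rightarrow> real" where
  "excess N Y a b = D (Y (int N - 1)) a + D a b + D b (Y (int N + 1))
     - D (Y (int N - 1)) (Y (int N)) - D (Y (int N)) (Y (int N + 1))"

lemma len_insert:
  assumes N: "2 \<le> N" and Y: "quasi_periodic N k Y"
  shows "len (Suc N) (insert_vertex N k Y a b) - len N Y = excess N Y a b"
proof -
  obtain M where M: "N = Suc (Suc M)" using N by (metis Suc_le_D numeral_2_eq_2 Suc_le_mono)
  have N1: "1 \<le> N" using N by simp
  note eq = insert_vertex_eq[OF N1, where k = k and Y = Y and a = a and b = b]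
  let ?\<theta> = "insert_vertex N k Y a b"
  have Y1: "Y (int N + 1) = Y 1 + 2 * pi * of_int k" "Y (int N) = Y 0 + 2 * pi * of_int k"
    using Y unfolding quasi_periodic_def by (metis add.commute, metis add_0)
  have "D (?\<theta> 0) (?\<theta> 1) = D b (Y (int N + 1))"
  proof -
    have "D (?\<theta> 0) (?\<theta> 1) = D (b - 2 * pi * of_int k) (Y 1)" using eq(1) eq(2)[of 1] N by simp
    also have "\<dots> = D (b - 2 * pi * of_int k + 2 * pi * of_int k) (Y 1 + 2 * pi * of_int k)"
      by (simp only: D_periodic)
    finally show ?thesis using Y1 by simp
  qed
  moreover have "(\<Sum>i<M. D (?\<theta> (int (Suc i))) (?\<theta> (int (Suc i) + 1)))
      = (\<Sum>i<M. D (Y (int (Suc i))) (Y (int (Suc i) + 1)))"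
  proof (rule sum.cong)
    fix i assume "i \<in> {..<M}"
    then show "D (?\<theta> (int (Suc i))) (?\<theta> (int (Suc i) + 1)) = D (Y (int (Suc i))) (Y (int (Suc i) + 1))"
      using eq(2)[of "int (Suc i)"] eq(2)[of "int (Suc i) + 1"] M by simp
  qed simp
  moreover have "D (?\<theta> (int (Suc M))) (?\<theta> (int (Suc M) + 1)) = D (Y (int N - 1)) a"
    using eq(2)[of "int (Suc M)"] eq(3) M by (simp add: add.commute)
  moreover have "D (?\<theta> (int (Suc (Suc M)))) (?\<theta> (int (Suc (Suc M)) + 1)) = D a b"
    using eq(3,4) M by (simp add: add.commute)
  moreover have "D (Y 0) (Y 1) = D (Y (int N)) (Y (int N + 1))"
    using Y1 by (simp add: D_periodic)
  moreover have "D (Y (int (Suc M))) (Y (int (Suc M) + 1)) = D (Y (int N - 1)) (Y (int N))"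
    using M by (simp add: add.commute)
  moreover have "len (Suc N) ?\<theta> = D (?\<theta> 0) (?\<theta> 1) + (\<Sum>i<M. D (?\<theta> (int (Suc i))) (?\<theta> (int (Suc i) + 1)))
      + D (?\<theta> (int (Suc M))) (?\<theta> (int (Suc M) + 1)) + D (?\<theta> (int (Suc (Suc M)))) (?\<theta> (int (Suc (Suc M)) + 1))"
    unfolding len_def sum.lessThan_Suc[of _ N] unfolding M sum.lessThan_Suc[of _ "Suc M"] sum.lessThan_Suc_shift[of _ M] by simp
  moreover have "len N Y = D (Y 0) (Y 1) + (\<Sum>i<M. D (Y (int (Suc i))) (Y (int (Suc i) + 1)))
      + D (Y (int (Suc M))) (Y (int (Suc M) + 1))"
    unfolding len_def M sum.lessThan_Suc[of _ "Suc M"] sum.lessThan_Suc_shift[of _ M] by simp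
  ultimately show ?thesis by (simp add: excess_def)
qed

text \<open>Zero excess means that the curve meets the chord itself at \<open>a\<close>. Along any
  variation the enlarged polygon is at least as long as the varied \<open>Y\<close>, with equality
  at the start, so both lengths have the same derivative there; that of \<open>Y\<close> is zero by
  maximality.\<close>

lemma insert_on_side_critical:
  assumes N: "2 \<le> N" and Y: "Y \<in> open_lifts N k"
    and max: "\<And>\<eta>. \<eta> \<in> closed_lifts N k \<Longrightarrow> len N \<eta> \<le> len N Y"
    and a: "Y (int N - 1) < a" "a < Y (int N)" and ex: "excess N Y a (Y (int N)) = 0"
  shows "insert_vertex N k Y a (Y (int N)) \<in> open_lifts (Suc N) k"
    "len (Suc N) (insert_vertex N k Y a (Y (int N))) = len N Y"
    "critical (insert_vertex N k Y a (Y (int N)))"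
proof -
  let ?\<theta> = "insert_vertex N k Y a (Y (int N))"
  have qpY: "quasi_periodic N k Y" using Y by (simp add: open_lifts_def)
  have YN: "Y (int N - 1) < Y (int N - 1 + 1) \<and> Y (int N - 1 + 1) < Y (int N - 1) + 2 * pi"
    "Y (int N) < Y (int N + 1) \<and> Y (int N + 1) < Y (int N) + 2 * pi"
    using Y unfolding open_lifts_def by blast+
  show op: "?\<theta> \<in> open_lifts (Suc N) k"
    using a YN by (intro insert_vertex_open Y N) auto
  show "len (Suc N) ?\<theta> = len N Y" using len_insert[OF N qpY, of a "Y (int N)"] ex by simp
  show "critical ?\<theta>"
  proof (rule critical_if_directional[OF quasi_periodic_insert])
    fix x :: "int \<Rightarrow> real" assume x: "\<And>i. x (i + int (Suc N)) = x i"
    define y where "y i = x (i mod int N)" for i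
    have y: "y (i + int N) = y i" for i by (simp add: y_def)
    have y0: "y (int N) = x 0" by (simp add: y_def)
    define g where "g = (\<Sum>i<Suc N. x (int i) * grad (\<lambda>i. ?\<theta> i + 0 * x i) (int i))"
    define h where "h = (\<Sum>i<N. y (int i) * grad (\<lambda>i. Y i + 0 * y i) (int i))"
    let ?G = "\<lambda>z. len (Suc N) (\<lambda>i. ?\<theta> i + z * x i)"
    let ?H = "\<lambda>z. len N (\<lambda>i. Y i + z * y i)"
    have G: "(?G has_real_derivative g) (at 0)"
      unfolding g_def using D_open_lifts(1)[OF op]
      by (intro has_derivative_len[where a = x, OF quasi_periodic_insert x]) (simp add: less_imp_neq[symmetric])
    have H: "(?H has_real_derivative h) (at 0)"
      unfolding h_def using D_open_lifts(1)[OF Y]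
      by (intro has_derivative_len[where a = y, OF qpY y]) (simp add: less_imp_neq[symmetric])
    obtain \<epsilon> where \<epsilon>: "\<epsilon> > 0" "\<And>z. \<bar>z\<bar> < \<epsilon> \<Longrightarrow> (\<lambda>i. Y i + z * y i) \<in> open_lifts N k"
      using open_lifts_line[where a = y, OF Y y] N by auto
    have "h = 0"
      by (rule DERIV_local_max[OF H \<epsilon>(1)]) (use max[OF subsetD[OF open_lifts_subset \<epsilon>(2)]] in auto)
    have GH: "?G z - ?H z \<ge> 0" for z
    proof -
      define Z where "Z = (\<lambda>i. Y i + z * y i)"
      have qpZ: "quasi_periodic N k Z" using qpY y by (simp add: quasi_periodic_def Z_def)
      have "(\<lambda>i. ?\<theta> i + z * x i) = insert_vertex N k Z (a + z * x (int N)) (Z (int N))"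
        using insert_vertex_line[of N x k Y a "Y (int N)" z] N x by (simp add: Z_def y_def)
      then have "?G z - ?H z = excess N Z (a + z * x (int N)) (Z (int N))"
        using len_insert[OF N qpZ] by (simp add: Z_def)
      also have "\<dots> \<ge> 0"
        using D_triangle[of "Z (int N - 1)" "Z (int N)" "a + z * x (int N)"] by (simp add: excess_def)
      finally show ?thesis .
    qed
    have GH0: "?G 0 - ?H 0 = 0" using len_insert[OF N qpY, of a "Y (int N)"] ex by simp
    have "((\<lambda>z. ?G z - ?H z) has_real_derivative g - h) (at 0)" by (rule DERIV_diff[OF G H])
    then have "g - h = 0"
      by (rule DERIV_local_min[of _ _ _ 1]) (use GH GH0 in auto)
    then show "(\<Sum>i<Suc N. x (int i) * grad ?\<theta> (int i)) = 0"
      using \<open>h = 0\<close> by (simp add: g_def)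
  qed simp
qed

text \<open>Maximality tested on one vertex. The shift by \<open>N - 1\<close> brings that vertex to
  position 1, where \<open>bump_closed\<close> and \<open>bump_sum\<close> apply.\<close>

lemma vertex_max:
  assumes N: "2 \<le> N" and Y: "Y \<in> closed_lifts N k"
    and max: "\<And>\<eta>. \<eta> \<in> closed_lifts N k \<Longrightarrow> len N \<eta> \<le> len N Y"
    and a: "Y (int N - 1) \<le> a" "a \<le> Y (int N - 1) + 2 * pi" "a \<le> Y (int N + 1)" "Y (int N + 1) \<le> a + 2 * pi"
  shows "D (Y (int N - 1)) a + D a (Y (int N + 1)) \<le> D (Y (int N - 1)) (Y (int N)) + D (Y (int N)) (Y (int N + 1))"
proof -
  define Z where "Z = (shift ^^ (N - 1)) Y"
  define \<xi> where "\<xi> i = (if i mod int N = 1 then Z i + (a - Y (int N)) else Z i)" for i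
  have Z: "Z 0 = Y (int N - 1)" "Z 1 = Y (int N)" "Z 2 = Y (int N + 1)"
    using N by (simp_all add: Z_def shift_pow of_nat_diff algebra_simps)
  have Zcl: "Z \<in> closed_lifts N k" unfolding Z_def by (rule shift_pow_closed[OF Y])
  have "\<xi> \<in> closed_lifts N k"
    using a by (intro bump_closed[of Z N k \<xi> "a - Y (int N)"] Zcl N \<xi>_def) (auto simp: Z)
  then have "len N \<xi> \<le> len N Z"
    using max[of \<xi>] len_shift_pow[of N k Y] Y by (simp add: Z_def closed_lifts_def)
  moreover have "len N \<xi> - len N Z = D (Z 0) (Z 1 + (a - Y (int N))) + D (Z 1 + (a - Y (int N))) (Z 2) - D (Z 0) (Z 1) - D (Z 1) (Z 2)"
    unfolding len_def by (rule bump_sum[OF N \<xi>_def])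
  ultimately show ?thesis by (simp add: Z)
qed

text \<open>If the incoming side at the last vertex is tangent to the curve, then so is the outgoing one, and
  maximality forces nearby points of the curve onto that side.\<close>

lemma tangent_side:
  assumes N: "2 \<le> N" and Y: "Y \<in> open_lifts N k"
    and max: "\<And>\<eta>. \<eta> \<in> closed_lifts N k \<Longrightarrow> len N \<eta> \<le> len N Y"
    and tan: "D1 (Y (int N)) (Y (int N - 1)) = speed (Y (int N))"
  shows "\<exists>a. Y (int N - 1) < a \<and> a < Y (int N) \<and> excess N Y a (Y (int N)) = 0"
proof -
  define y x z where "y = Y (int N)" and "x = Y (int N - 1)" and "z = Y (int N + 1)"
  define v where "v = speed y"
  have v: "0 < v" unfolding v_def by (rule speed_pos)
  have "critical Y"
    using max open_lifts_subset N by (intro critical_if_max[OF Y]) auto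
  then have "D1 y z + D1 y x = 0" unfolding critical_def grad_def x_def y_def z_def by blast
  then have tan': "D1 y x = v" "D1 y z = - v" using tan by (simp_all add: v_def x_def y_def)
  have "0 < D y x" "0 < D y z"
    using D_open_lifts[OF Y, of "int N"] by (simp_all add: x_def y_def z_def)
  then have pos: "0 < D x y" "0 < D y z" by (simp_all add: D_sym)
  have xyz: "x < y" "y < x + 2 * pi" "y < z" "z < y + 2 * pi"
  proof -
    have "Y (int N - 1) < Y (int N - 1 + 1) \<and> Y (int N - 1 + 1) < Y (int N - 1) + 2 * pi"
      "Y (int N) < Y (int N + 1) \<and> Y (int N + 1) < Y (int N) + 2 * pi"
      using Y unfolding open_lifts_def by blast+
    then show "x < y" "y < x + 2 * pi" "y < z" "z < y + 2 * pi" by (simp_all add: x_def y_def z_def)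
  qed
  \<comment> \<open>Equality in Cauchy-Schwarz: both sides at \<open>y\<close> are positive
    multiples of the velocity, so x, y, z lie on a line in this order.\<close>
  have p: "c y k - c x k = D x y / v * dc y k" if "k < n" for k
  proof -
    have "(\<Sum>k<n. (c y k - c x k) * dc y k) = L2_set (\<lambda>k. c y k - c x k) {..<n} * L2_set (dc y) {..<n}"
      using tan'(1) pos(1) D_sym[of x y] unfolding D1_def D_def[symmetric] speed_def[symmetric] v_def[symmetric]
      by (simp add: field_simps)
    from L2_set_inner_eq_imp_parallel[OF this, of k] that show ?thesis
      unfolding D_def[symmetric] speed_def[symmetric] v_def[symmetric] using v D_sym[of x y] by (simp add: field_simps)
  qed
  have q: "c z k - c y k = D y z / v * dc y k" if "k < n" for k
  proof -
    have "(\<Sum>k<n. (c y k - c z k) * dc y k) = - (D y z * v)"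
      using tan'(2) pos(2) unfolding D1_def by (simp add: field_simps)
    then have "(\<Sum>k<n. (c z k - c y k) * dc y k) = D z y * v"
      using D_sym[of y z] by (simp add: sum_negf[symmetric] algebra_simps sum_subtractf)
    then have "(\<Sum>k<n. (c z k - c y k) * dc y k) = L2_set (\<lambda>k. c z k - c y k) {..<n} * L2_set (dc y) {..<n}"
      unfolding D_def speed_def v_def .
    from L2_set_inner_eq_imp_parallel[OF this, of k] that show ?thesis
      unfolding D_def[symmetric] speed_def[symmetric] v_def[symmetric] using v D_sym[of z y] by (simp add: field_simps)
  qed
  have multiple: "D s t = \<bar>r\<bar> * v" if "\<And>k. k < n \<Longrightarrow> c t k - c s k = r * dc y k" for s t r
  proof -
    have "D s t = L2_set (\<lambda>k. r * dc y k) {..<n}"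
      unfolding D_sym[of s t] unfolding D_def using that by (intro L2_set_cong) auto
    also have "\<dots> = sqrt (r\<^sup>2 * (\<Sum>k<n. (dc y k)\<^sup>2))"
      by (simp add: L2_set_def power_mult_distrib sum_distrib_left)
    finally show ?thesis by (simp add: real_sqrt_mult v_def speed_def L2_set_def)
  qed
  define L where "L = D x y + D y z"
  have L: "0 < L" using pos by (simp add: L_def)
  have pq: "c z k - c x k = L / v * dc y k" if "k < n" for k
    using p[OF that] q[OF that] by (simp add: L_def add_divide_distrib algebra_simps)
  have xz: "D x z = L" using multiple[of z x "L / v"] pq v L by simp
  have deriv: "((\<lambda>a. D x a) has_real_derivative v) (at y)"
    using has_derivative_D[of "\<lambda>_. x" 0 y "\<lambda>a. a" 1] pos(1) tan'(1) by simp
  obtain d where d: "d > 0" "\<And>h. h > 0 \<Longrightarrow> h < d \<Longrightarrow> D x (y - h) < D x y"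
    using DERIV_pos_inc_left[OF deriv v] by blast
  \<comment> \<open>Small enough for the incoming side to be longer than the chord from
    \<open>x\<close> to \<open>a\<close>, and for \<open>a\<close> to be an allowed position of the
    vertex in \<open>vertex_max\<close>.\<close>
  define h where "h = Min {d, y - x, y + 2 * pi - z} / 2"
  have h: "0 < h" "h < d" "h < y - x" "h < y + 2 * pi - z"
    using d(1) xyz by (auto simp: h_def min_def field_simps)
  define a where "a = y - h"
  have a: "x < a" "a < y" "z < a + 2 * pi" "D x a < D x y" using h d(2)[of h] by (auto simp: a_def)
  \<comment> \<open>The right-hand side is \<open>D x z\<close>, so maximality reverses the triangle
    inequality and puts \<open>a\<close> on the segment from x to z.\<close>
  have "D x a + D a z \<le> D x y + D y z"
    using vertex_max[where a = a, OF N _ max] Y open_lifts_subset a xyz by (auto simp: x_def y_def z_def)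
  then have eq: "D x z = D x a + D a z" using D_triangle[of x z a] xz by (simp add: L_def)
  have ca: "c a k - c x k = D x a / v * dc y k" if "k < n" for k
  proof -
    have "L2_set (\<lambda>k. (c z k - c a k) + (c a k - c x k)) {..<n}
        = L2_set (\<lambda>k. c z k - c a k) {..<n} + L2_set (\<lambda>k. c a k - c x k) {..<n}"
      using eq D_sym[of x z] D_sym[of x a] D_sym[of a z] unfolding D_def by simp
    from L2_set_triangle_eq_imp_parallel[OF this, of k] that
    have "D x a * (c z k - c a k) = D a z * (c a k - c x k)"
      unfolding D_def[symmetric] by (simp add: D_sym)
    then have "D x a * (c z k - c x k) = L * (c a k - c x k)"
      using eq xz by (simp add: algebra_simps)
    then have "L * (c a k - c x k) = L * (D x a / v * dc y k)"
      using pq[OF that] by (simp add: algebra_simps)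
    then show ?thesis using L by (metis less_irrefl mult_left_cancel)
  qed
  have "c y k - c a k = (D x y - D x a) / v * dc y k" if "k < n" for k
    using p[OF that] ca[OF that] by (simp add: diff_divide_distrib algebra_simps)
  then have "D a y = D x y - D x a"
    using multiple[of y a "(D x y - D x a) / v"] v a(4) by simp
  then have "excess N Y a (Y (int N)) = 0"
    by (simp add: excess_def x_def y_def z_def)
  then show ?thesis using a by (auto simp: x_def y_def)
qed

text \<open>Tangency of the incoming side is excluded by \<open>tangent_side\<close>, so the
  derivative q of its length is strictly below the speed. When the vertex is pulled apart into
  \<open>a\<close> and \<open>b\<close>, the new side between them grows at first order with the
  speed, while the adjacent sides lose at most q times the same displacement.\<close>

lemma corner:
  assumes N: "2 \<le> N" and Y: "Y \<in> open_lifts N k"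
    and max: "\<And>\<eta>. \<eta> \<in> closed_lifts N k \<Longrightarrow> len N \<eta> \<le> len N Y"
    and no_side: "\<And>a. Y (int N - 1) < a \<Longrightarrow> a < Y (int N) \<Longrightarrow> excess N Y a (Y (int N)) \<noteq> 0"
  obtains s where "0 < s" "Y (int N - 1) < Y (int N) - s" "Y (int N) + s < Y (int N + 1)" "s < 2 * pi"
    "\<And>u v. 0 \<le> u \<Longrightarrow> u \<le> s \<Longrightarrow> 0 \<le> v \<Longrightarrow> v \<le> s \<Longrightarrow> 0 < u + v \<Longrightarrow> 0 < excess N Y (Y (int N) - u) (Y (int N) + v)"
proof -
  define y x z where "y = Y (int N)" and "x = Y (int N - 1)" and "z = Y (int N + 1)"
  define q where "q = D1 y x"
  have "q \<le> speed y" "q \<noteq> speed y"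
    using D1_le_speed[of y x] tangent_side[OF N Y max] no_side by (auto simp: q_def x_def y_def)
  then have q: "q < speed y" by simp
  have "critical Y"
    using max open_lifts_subset N by (intro critical_if_max[OF Y]) auto
  then have "D1 y z + D1 y x = 0" unfolding critical_def grad_def x_def y_def z_def by blast
  then have q': "D1 y z = - q" by (simp add: q_def)
  have "0 < D y x" "0 < D y z"
    using D_open_lifts[OF Y, of "int N"] by (simp_all add: x_def y_def z_def)
  then have pos: "D x y \<noteq> 0" "D y z \<noteq> 0" using D_sym[of x y] by simp_all
  \<comment> \<open>The projection onto the unit tangent at \<open>y\<close>. Its increments are
    bounded by chords, so replacing \<open>D a b\<close> by \<open>l b - l a\<close> decouples the
    motions of \<open>a\<close> and \<open>b\<close>.\<close>
  define l where "l t = (\<Sum>k<n. c t k * dc y k) / speed y" for t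
  have sp: "0 < speed y" by (rule speed_pos)
  have "(l has_real_derivative (\<Sum>k<n. dc y k * dc y k) / speed y) (at y)"
    unfolding l_def by (intro DERIV_cdivide DERIV_sum DERIV_cmult_right deriv_c) auto
  moreover have "(\<Sum>k<n. dc y k * dc y k) = (speed y)\<^sup>2"
    unfolding speed_def L2_set_sq by (simp add: power2_eq_square)
  moreover have "(speed y)\<^sup>2 / speed y = speed y" by (simp add: power2_eq_square)
  ultimately have dl: "(l has_real_derivative speed y) (at y)" by simp
  have lD: "l t - l s \<le> D s t" for s t
  proof -
    have "(\<Sum>k<n. (c t k - c s k) * dc y k) \<le> D t s * speed y"
      unfolding D_def speed_def by (rule L2_set_inner_le)
    moreover have "l t - l s = (\<Sum>k<n. (c t k - c s k) * dc y k) / speed y"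
      by (simp add: l_def diff_divide_distrib[symmetric] sum_subtractf left_diff_distrib)
    ultimately show ?thesis using sp D_sym[of s t] by (simp add: pos_divide_le_eq)
  qed
  have "((\<lambda>a. D x a) has_real_derivative q) (at y)"
    using has_derivative_D[of "\<lambda>_. x" 0 y "\<lambda>a. a" 1] pos(1) by (simp add: q_def)
  from DERIV_diff[OF this dl] have "((\<lambda>a. D x a - l a) has_real_derivative (q - speed y)) (at y)" .
  from DERIV_neg_dec_left[OF this] q obtain d1 where
    d1: "d1 > 0" "\<And>h. 0 < h \<Longrightarrow> h < d1 \<Longrightarrow> D x (y - h) - l (y - h) > D x y - l y" by auto
  have "((\<lambda>b. D b z) has_real_derivative - q) (at y)"
    using has_derivative_D[of "\<lambda>a. a" 1 y "\<lambda>_. z" 0] pos(2) q' by simp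
  from DERIV_add[OF this dl] have "((\<lambda>b. D b z + l b) has_real_derivative (- q + speed y)) (at y)" .
  from DERIV_pos_inc_right[OF this] q obtain d2 where
    d2: "d2 > 0" "\<And>h. 0 < h \<Longrightarrow> h < d2 \<Longrightarrow> D (y + h) z + l (y + h) > D y z + l y" by auto
  have xyz: "x < y" "y < z"
  proof -
    have "Y (int N - 1) < Y (int N - 1 + 1) \<and> Y (int N - 1 + 1) < Y (int N - 1) + 2 * pi"
      "Y (int N) < Y (int N + 1) \<and> Y (int N + 1) < Y (int N) + 2 * pi"
      using Y unfolding open_lifts_def by blast+
    then show "x < y" "y < z" by (simp_all add: x_def y_def z_def)
  qed
  define s where "s = Min {d1, d2, y - x, z - y, 2 * pi} / 2"
  have s: "0 < s" "s < d1" "s < d2" "s < y - x" "s < z - y" "s < 2 * pi"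
    using d1(1) d2(1) xyz by (auto simp: s_def min_def field_simps)
  have "0 < excess N Y (y - u) (y + v)" if "0 \<le> u" "u \<le> s" "0 \<le> v" "v \<le> s" "0 < u + v" for u v
  proof -
    have A: "D x (y - u) - l (y - u) \<ge> D x y - l y" "u > 0 \<Longrightarrow> D x (y - u) - l (y - u) > D x y - l y"
      using d1(2)[of u] that s by (cases "u = 0"; simp)+
    have B: "D (y + v) z + l (y + v) \<ge> D y z + l y" "v > 0 \<Longrightarrow> D (y + v) z + l (y + v) > D y z + l y"
      using d2(2)[of v] that s by (cases "v = 0"; simp)+
    have "excess N Y (y - u) (y + v) = D x (y - u) + D (y - u) (y + v) + D (y + v) z - D x y - D y z"
      by (simp add: excess_def x_def y_def z_def)
    moreover have "u > 0 \<or> v > 0" using that by linarith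
    ultimately show ?thesis using A B lD[of "y + v" "y - u"] by linarith
  qed
  then show ?thesis using s that[of s] by (simp add: x_def y_def z_def)
qed

lemma excess_nonneg: "0 \<le> excess N Y a (Y (int N))"
  using D_triangle[of "Y (int N - 1)" "Y (int N)" a] by (simp add: excess_def)

text \<open>The inserted vertex slides along a side at positive excess, passes the corner while
  being split from the old vertex, and continues on the next side, one shift later. After
  \<open>N\<close> corners \<open>Y\<close> has become its translate by \<open>k\<close> turns,
  whereas the enlarged polygon needs \<open>N + 1\<close> shifts for that. The discrepancy of one is
  the desired cyclic shift.\<close>

lemma vertex_loop:
  assumes N: "2 \<le> N" and Y: "Y \<in> open_lifts N k"
    and max: "\<And>\<eta>. \<eta> \<in> closed_lifts N k \<Longrightarrow> len N \<eta> \<le> len N Y"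
    and no_side: "\<And>j a. Y (int N - 1 + int j) < a \<Longrightarrow> a < Y (int N + int j) \<Longrightarrow>
        excess N ((shift ^^ j) Y) a (Y (int N + int j)) \<noteq> 0"
  shows "\<exists>\<theta>. path_component {\<xi> \<in> open_lifts (Suc N) k. len N Y < len (Suc N) \<xi>} \<theta> (shift \<theta>)"
proof -
  define G where "G = {\<xi> \<in> open_lifts (Suc N) k. len N Y < len (Suc N) \<xi>}"
  \<comment> \<open>Any point inside the side would do as a base position; the angular midpoint is a
    canonical choice that commutes with translations.\<close>
  define P where "P Z = insert_vertex N k Z ((Z (int N - 1) + Z (int N)) / 2) (Z (int N))" for Z
  have qpY: "quasi_periodic N k Y" using Y by (simp add: open_lifts_def)
  have shift_G: "shift ` G \<subseteq> G"
  proof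
    fix \<xi> assume "\<xi> \<in> shift ` G"
    then obtain \<eta> where \<eta>: "\<eta> \<in> G" "\<xi> = shift \<eta>" by blast
    then have "quasi_periodic (Suc N) k \<eta>" by (simp add: G_def open_lifts_def)
    then show "\<xi> \<in> G" using \<eta> by (simp add: G_def shift_open len_shift)
  qed
  define good where "good Z \<longleftrightarrow> Z \<in> open_lifts N k \<and> len N Z = len N Y
     \<and> (\<forall>a. Z (int N - 1) < a \<longrightarrow> a < Z (int N) \<longrightarrow> excess N Z a (Z (int N)) \<noteq> 0)" for Z
  have good: "good ((shift ^^ j) Y)" for j
    using shift_pow_open[OF Y, of j] len_shift_pow[OF qpY, of j] no_side[of j]
    by (auto simp: good_def shift_pow algebra_simps)
  have gaps: "Z (int N - 1) < Z (int N)" "Z (int N) < Z (int N - 1) + 2 * pi"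
      "Z (int N) < Z (int N + 1)" "Z (int N + 1) < Z (int N) + 2 * pi" if "good Z" for Z
  proof -
    have "Z (int N - 1) < Z (int N - 1 + 1) \<and> Z (int N - 1 + 1) < Z (int N - 1) + 2 * pi"
      "Z (int N) < Z (int N + 1) \<and> Z (int N + 1) < Z (int N) + 2 * pi"
      using that unfolding good_def open_lifts_def by blast+
    then show "Z (int N - 1) < Z (int N)" "Z (int N) < Z (int N - 1) + 2 * pi"
      "Z (int N) < Z (int N + 1)" "Z (int N + 1) < Z (int N) + 2 * pi" by simp_all
  qed
  have in_G: "insert_vertex N k Z a b \<in> G"
    if "good Z" "Z (int N - 1) < a" "a \<le> Z (int N)" "Z (int N) \<le> b" "b < Z (int N + 1)" "a < b" "b < a + 2 * pi"
      "0 < excess N Z a b" for Z a b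
  proof -
    have Z: "Z \<in> open_lifts N k" "quasi_periodic N k Z" "len N Z = len N Y"
      using that(1) by (auto simp: good_def open_lifts_def)
    have "insert_vertex N k Z a b \<in> open_lifts (Suc N) k"
      using gaps[OF that(1)] that by (intro insert_vertex_open Z N) auto
    then show ?thesis using len_insert[OF N Z(2), of a b] that(8) Z(3) by (simp add: G_def)
  qed
  have slide: "path_component G (insert_vertex N k Z a (Z (int N))) (insert_vertex N k Z a' (Z (int N)))"
    if Z: "good Z" and a: "Z (int N - 1) < a" "a < Z (int N)" and a': "Z (int N - 1) < a'" "a' < Z (int N)" for Z a a'
  proof (rule path_component_segment)
    fix t :: real assume t: "0 \<le> t" "t \<le> 1"
    let ?w = "(1 - t) * a + t * a'"
    have w: "Z (int N - 1) < ?w" "?w < Z (int N)"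
      using t a a' convex_bound_lt[of a "Z (int N)" a' "1 - t" t]
        convex_bound_lt[of "- a" "- Z (int N - 1)" "- a'" "1 - t" t] by auto
    have "excess N Z ?w (Z (int N)) \<noteq> 0" using Z w unfolding good_def by blast
    then have "0 < excess N Z ?w (Z (int N))" using excess_nonneg[of N Z ?w] by linarith
    then have "insert_vertex N k Z ?w (Z (int N)) \<in> G"
      using w gaps[OF Z] by (intro in_G[OF Z]) auto
    moreover have "(1 - t) * Z (int N) + t * Z (int N) = Z (int N)" by (simp add: algebra_simps)
    ultimately show "(\<lambda>i. (1 - t) * insert_vertex N k Z a (Z (int N)) i + t * insert_vertex N k Z a' (Z (int N)) i) \<in> G"
      by (simp only: insert_vertex_convex)
  qed
  have step: "path_component G (shift (P Z)) (P (shift Z))" if Z: "good Z" "good (shift Z)" for Z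
  proof -
    define y where "y = Z (int N)"
    have Zop: "Z \<in> open_lifts N k" using Z by (simp add: good_def)
    have Zmax: "len N \<eta> \<le> len N Z" if "\<eta> \<in> closed_lifts N k" for \<eta>
      using max[OF that] Z by (simp add: good_def)
    obtain s where s: "0 < s" "Z (int N - 1) < y - s" "y + s < Z (int N + 1)" "s < 2 * pi"
      "\<And>u v. 0 \<le> u \<Longrightarrow> u \<le> s \<Longrightarrow> 0 \<le> v \<Longrightarrow> v \<le> s \<Longrightarrow> 0 < u + v \<Longrightarrow> 0 < excess N Z (y - u) (y + v)"
      using corner[OF N Zop Zmax] Z(1) unfolding good_def y_def by metis
    have "path_component G (P Z) (insert_vertex N k Z (y - s) (Z (int N)))"
      unfolding P_def using gaps[OF Z(1)] s by (intro slide Z) (auto simp: y_def)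
    \<comment> \<open>While \<open>a\<close> moves from \<open>y - s\<close> to \<open>y\<close>,
      \<open>b\<close> moves from \<open>y\<close> to \<open>y + s\<close>. Their distance in angle
      stays \<open>s\<close>, so the excess stays positive by \<open>corner\<close>.\<close>
    moreover have "path_component G (insert_vertex N k Z (y - s) y) (insert_vertex N k Z y (y + s))"
    proof (rule path_component_segment)
      fix t :: real assume t: "0 \<le> t" "t \<le> 1"
      have ts: "0 \<le> t * s" "t * s \<le> s" "0 \<le> (1 - t) * s" "(1 - t) * s \<le> s"
        using t s(1) by (auto intro: mult_left_le_one_le)
      have sum: "(1 - t) * s + t * s = s" by (simp add: algebra_simps)
      have "(1 - t) * (y - s) + t * y = y - (1 - t) * s" "(1 - t) * y + t * (y + s) = y + t * s"
        by (simp_all add: algebra_simps)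
      moreover have "0 < excess N Z (y - (1 - t) * s) (y + t * s)"
        using ts s(1) sum by (intro s(5)) auto
      then have "insert_vertex N k Z (y - (1 - t) * s) (y + t * s) \<in> G"
        by (intro in_G Z) (use ts sum s(1-4) gaps[OF Z(1)] y_def in linarith)+
      ultimately show "(\<lambda>i. (1 - t) * insert_vertex N k Z (y - s) y i + t * insert_vertex N k Z y (y + s) i) \<in> G"
        by (simp only: insert_vertex_convex)
    qed
    ultimately have "path_component G (P Z) (insert_vertex N k Z y (y + s))"
      unfolding y_def by (rule path_component_trans)
    then have "path_component G (shift (P Z)) (shift (insert_vertex N k Z y (y + s)))"
      by (rule path_component_image[OF _ continuous_on_shift shift_G])
    \<comment> \<open>With \<open>a\<close> at the old vertex, \<open>b\<close> is the inserted
      vertex of the next side; after the shift it occupies the first place of the pair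
      again.\<close>
    moreover have "shift (insert_vertex N k Z y (y + s)) = insert_vertex N k (shift Z) (y + s) (shift Z (int N))"
    proof (rule quasi_periodic_eqI)
      show "quasi_periodic (Suc N) k (shift (insert_vertex N k Z y (y + s)))"
        by (intro quasi_periodic_shift quasi_periodic_insert)
      fix i assume i: "0 \<le> i" "i < int (Suc N)"
      have N1: "1 \<le> N" using N by simp
      have Z1: "Z (1 + int N) = Z 1 + 2 * pi * of_int k"
        using Zop unfolding open_lifts_def quasi_periodic_def by blast
      have eN: "insert_vertex N k Z y (y + s) (1 + int N) = y + s"
        using insert_vertex_eq(4)[OF N1, of k Z y "y + s"] by (simp add: add.commute)
      from i consider "i = 0" | "0 < i" "i < int N - 1" | "0 < i" "i = int N - 1" | "i = int N" using N by linarith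
      then show "shift (insert_vertex N k Z y (y + s)) i = insert_vertex N k (shift Z) (y + s) (shift Z (int N)) i"
        by cases (use N Z1 eN in \<open>simp_all add: shift_def insert_vertex_eq[OF N1] y_def add.commute\<close>)
    qed (simp_all add: quasi_periodic_insert)
    moreover have "path_component G (insert_vertex N k (shift Z) (y + s) (shift Z (int N))) (P (shift Z))"
      unfolding P_def using gaps[OF Z(2)] s by (intro slide Z) (auto simp: y_def shift_def add.commute)
    ultimately show ?thesis by (metis path_component_trans)
  qed
  have "path_component G ((shift ^^ j) (P Y)) (P ((shift ^^ j) Y))" for j
  proof (induction j)
    case 0
    have "path_component G (P Y) (P Y)"
      unfolding P_def using gaps[OF good[of 0]] good[of 0] by (intro slide) auto
    then show ?case by simp
  next
    case (Suc j)
    have "path_component G (shift ((shift ^^ j) (P Y))) (shift (P ((shift ^^ j) Y)))"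
      by (rule path_component_image[OF Suc continuous_on_shift shift_G])
    moreover have "path_component G (shift (P ((shift ^^ j) Y))) (P (shift ((shift ^^ j) Y)))"
      using step[OF good[of j]] good[of "Suc j"] by simp
    ultimately show ?case by (auto intro: path_component_trans)
  qed
  from this[of N] have "path_component G ((shift ^^ N) (P Y)) (P ((shift ^^ N) Y))" .
  \<comment> \<open>Both sides are the translate of \<open>P Y\<close> by \<open>k\<close> turns:
    \<open>Y\<close> has period \<open>N\<close>, while \<open>P Y\<close> has period
    \<open>N + 1\<close>.\<close>
  moreover have "P ((shift ^^ N) Y) = shift ((shift ^^ N) (P Y))"
  proof -
    have "(shift ^^ N) Y = translate k Y"
      using qpY by (simp add: shift_pow translate_def quasi_periodic_def)
    moreover have "P (translate k Y) = translate k (P Y)"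
      by (rule ext) (simp add: P_def translate_def insert_vertex_def extend_def add_divide_distrib)
    moreover have "(shift ^^ Suc N) (P Y) = translate k (P Y)"
      using quasi_periodic_insert unfolding shift_pow translate_def quasi_periodic_def P_def by blast
    ultimately show ?thesis by simp
  qed
  ultimately show ?thesis unfolding G_def by auto
qed

text \<open>A path is compact, so its length function attains a minimum, which is still strictly
  above \<open>b\<close>.\<close>

lemma vertex_loop_level:
  assumes "path_component {\<xi> \<in> open_lifts p k. b < len p \<xi>} \<theta> (shift \<theta>)"
  shows "\<exists>c>b. path_component {\<xi> \<in> open_lifts p k. c \<le> len p \<xi>} \<theta> (shift \<theta>)"
proof -
  obtain g where g: "path g" "path_image g \<subseteq> {\<xi> \<in> open_lifts p k. b < len p \<xi>}" "pathstart g = \<theta>" "pathfinish g = shift \<theta>"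
    using assms by (auto simp: path_component_def)
  have "compact (path_image g)" "path_image g \<noteq> {}"
    using g(1) by (simp_all add: compact_path_image)
  then obtain \<xi> where \<xi>: "\<xi> \<in> path_image g" "\<And>\<eta>. \<eta> \<in> path_image g \<Longrightarrow> len p \<xi> \<le> len p \<eta>"
    using continuous_attains_inf[of "path_image g" "len p"] continuous_on_len by blast
  have "path_component {\<eta> \<in> open_lifts p k. len p \<xi> \<le> len p \<eta>} \<theta> (shift \<theta>)"
    unfolding path_component_def using g \<xi>(2) by (intro exI[of _ g]) auto
  then show ?thesis using \<xi>(1) g(2) by blast
qed

subsection \<open>Gradient ascent and the minimax level\<close>

text \<open>One explicit Euler step of the gradient flow of the length. It commutes with cyclic
  shifts and translations, so it maps loops to loops.\<close>

definition ascend :: "real \<Rightarrow> (int \<Rightarrow> real) \<Rightarrow> int \<Rightarrow> real" where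
  "ascend \<tau> \<theta> = (\<lambda>i. \<theta> i + \<tau> * grad \<theta> i)"

lemma grad_translate: "grad (translate m \<theta>) = grad \<theta>"
  by (rule ext) (simp add: grad_def translate_def D1_periodic)

lemma ascend_translate: "ascend \<tau> (translate m \<theta>) = translate m (ascend \<tau> \<theta>)"
  by (rule ext) (simp add: ascend_def grad_translate, simp add: translate_def)

lemma ascend_shift: "ascend \<tau> (shift \<theta>) = shift (ascend \<tau> \<theta>)"
  by (rule ext) (simp add: ascend_def grad_shift, simp add: shift_def)

lemma translate_open_iff: "translate m \<theta> \<in> open_lifts N k \<longleftrightarrow> \<theta> \<in> open_lifts N k"
proof
  assume "translate m \<theta> \<in> open_lifts N k"
  from translate_open[OF this, of "- m"] show "\<theta> \<in> open_lifts N k" by (simp add: translate_def)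
qed (rule translate_open)

lemma tendsto_grad:
  assumes "\<And>i. ((\<lambda>x. \<theta> x i) \<longlongrightarrow> l i) F" "l \<in> open_lifts N k"
  shows "((\<lambda>x. grad (\<theta> x) i) \<longlongrightarrow> grad l i) F"
  unfolding grad_def using D_open_lifts[OF assms(2), of i]
  by (intro tendsto_intros assms(1)) auto

lemma eventually_open_lifts:
  assumes "\<And>i. ((\<lambda>x. \<theta> x i) \<longlongrightarrow> l i) F" "l \<in> open_lifts N k" "\<And>x. quasi_periodic N k (\<theta> x)" "0 < N"
  shows "\<forall>\<^sub>F x in F. \<theta> x \<in> open_lifts N k"
proof -
  have "\<forall>\<^sub>F x in F. \<theta> x i < \<theta> x (i + 1) \<and> \<theta> x (i + 1) < \<theta> x i + 2 * pi" for i
  proof -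
    have lim: "((\<lambda>x. \<theta> x (i + 1) - \<theta> x i) \<longlongrightarrow> l (i + 1) - l i) F"
      by (intro tendsto_intros assms)
    have "0 < l (i + 1) - l i" "l (i + 1) - l i < 2 * pi"
      using assms(2) by (auto simp: open_lifts_def algebra_simps)
    from order_tendstoD(1)[OF lim this(1)] order_tendstoD(2)[OF lim this(2)]
    show ?thesis by eventually_elim auto
  qed
  then have "\<forall>\<^sub>F x in F. \<forall>i\<in>{0..<int N}. \<theta> x i < \<theta> x (i + 1) \<and> \<theta> x (i + 1) < \<theta> x i + 2 * pi"
    by (intro eventually_ball_finite) auto
  then show ?thesis
    by eventually_elim (intro open_liftsI assms, auto)
qed

lemma continuous_on_ascend: "continuous_on (open_lifts N k) (ascend \<tau>)"
proof (rule continuous_on_coordinatewise_then_product)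
  fix i
  have "((\<lambda>\<theta>. grad \<theta> i) \<longlongrightarrow> grad l i) (at l within open_lifts N k)" if "l \<in> open_lifts N k" for l
    by (rule tendsto_grad[OF _ that]) (metis tendsto_coordinate tendsto_within_subset subset_UNIV)
  then have "continuous_on (open_lifts N k) (\<lambda>\<theta>. grad \<theta> i)"
    by (simp add: continuous_on_def)
  then show "continuous_on (open_lifts N k) (\<lambda>\<theta>. ascend \<tau> \<theta> i)"
    unfolding ascend_def by (intro continuous_intros continuous_on_coordinate)
qed

lemma ascend_quasi_periodic:
  "quasi_periodic N k \<theta> \<Longrightarrow> quasi_periodic N k (ascend \<tau> \<theta>)"
  using grad_periodic[of N k \<theta>] by (simp add: quasi_periodic_def ascend_def)

text \<open>Compactness of superlevel sets modulo full turns: a limit exists among the closed lifts,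
  and its length, being above \<open>b\<close>, keeps it off the boundary.\<close>

lemma superlevel_subseq:
  fixes \<theta> :: "nat \<Rightarrow> int \<Rightarrow> real"
  assumes boundary: "\<forall>\<xi>\<in>closed_lifts N k - open_lifts N k. len N \<xi> \<le> b"
    and "b < cs" and \<theta>: "\<And>m. \<theta> m \<in> open_lifts N k" "\<And>m. cs - \<epsilon> m \<le> len N (\<theta> m)" and \<epsilon>: "\<epsilon> \<longlonglongrightarrow> 0"
  obtains r l t where "strict_mono (r :: nat \<Rightarrow> nat)" "l \<in> open_lifts N k" "cs \<le> len N l"
    "\<And>i. (\<lambda>m. translate (t m) (\<theta> (r m)) i) \<longlonglongrightarrow> l i"
    "\<And>m. 0 \<le> translate (t m) (\<theta> (r m)) 0" "\<And>m. translate (t m) (\<theta> (r m)) 0 \<le> 2 * pi"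
proof -
  have "\<exists>t. 0 \<le> translate t (\<theta> m) 0 \<and> translate t (\<theta> m) 0 \<le> 2 * pi" for m
    using translate_normalize by blast
  then obtain t where t: "\<And>m. 0 \<le> translate (t m) (\<theta> m) 0 \<and> translate (t m) (\<theta> m) 0 \<le> 2 * pi"
    by metis
  define \<phi> where "\<phi> m = translate (t m) (\<theta> m)" for m
  have cl: "\<phi> m \<in> closed_lifts N k" for m
    unfolding \<phi>_def by (rule subsetD[OF open_lifts_subset translate_open[OF \<theta>(1)]])
  obtain r l where r: "strict_mono r" "l \<in> closed_lifts N k" "\<And>i. (\<lambda>m. \<phi> (r m) i) \<longlonglongrightarrow> l i"
    using closed_lifts_subseq[of \<phi> N k] cl t by (auto simp: \<phi>_def)
  have lim: "(\<lambda>m. len N (\<phi> (r m))) \<longlonglongrightarrow> len N l" by (rule tendsto_len) (rule r(3))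
  have "(\<lambda>m. cs - \<epsilon> (r m)) \<longlonglongrightarrow> cs - 0"
    using LIMSEQ_subseq_LIMSEQ[OF \<epsilon> r(1)] by (intro tendsto_intros) (simp add: o_def)
  from LIMSEQ_le[OF this lim] have ge: "cs \<le> len N l"
    using \<theta>(2) by (simp add: \<phi>_def len_translate)
  then have "l \<in> open_lifts N k" using bspec[OF boundary, of l] r(2) \<open>b < cs\<close> by (cases "l \<in> open_lifts N k") auto
  then show ?thesis using that[of r l "\<lambda>m. t (r m)"] r ge t by (simp add: \<phi>_def)
qed

lemma critical_if_sum_squares:
  assumes "quasi_periodic N k \<theta>" "0 < N" "(\<Sum>i<N. grad \<theta> (int i) * grad \<theta> (int i)) \<le> 0"
  shows "critical \<theta>"
proof -
  have "(\<Sum>i<N. grad \<theta> (int i) * grad \<theta> (int i)) = 0"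
    using assms(3) by (intro antisym sum_nonneg) auto
  then have z: "grad \<theta> (int i) = 0" if "i < N" for i
    using that by (simp add: sum_nonneg_eq_0_iff)
  have "grad \<theta> i = 0" for i
  proof -
    have "grad \<theta> (int (nat (i mod int N))) = 0" using assms(2) by (intro z) (simp add: nat_less_iff)
    then show ?thesis using grad_mod[OF assms(1), of i] assms(2) by simp
  qed
  then show ?thesis by (simp add: critical_def)
qed

lemma open_lifts_convex:
  assumes "\<theta> \<in> open_lifts N k" "\<xi> \<in> open_lifts N k" "0 \<le> t" "t \<le> 1"
  shows "(\<lambda>i. (1 - t) * \<theta> i + t * \<xi> i) \<in> open_lifts N k"
proof -
  have "(1 - t) * \<theta> i + t * \<xi> i < (1 - t) * \<theta> (i + 1) + t * \<xi> (i + 1)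
      \<and> (1 - t) * \<theta> (i + 1) + t * \<xi> (i + 1) < (1 - t) * \<theta> i + t * \<xi> i + 2 * pi" for i
  proof -
    define d e where "d = \<theta> (i + 1) - \<theta> i" and "e = \<xi> (i + 1) - \<xi> i"
    have "\<theta> i < \<theta> (i + 1) \<and> \<theta> (i + 1) < \<theta> i + 2 * pi" "\<xi> i < \<xi> (i + 1) \<and> \<xi> (i + 1) < \<xi> i + 2 * pi"
      using assms(1,2) unfolding open_lifts_def by blast+
    then have de: "0 < d" "d < 2 * pi" "0 < e" "e < 2 * pi" by (auto simp: d_def e_def)
    have "(1 - t) * d + t * e < 2 * pi" using de assms(3,4) by (intro convex_bound_lt) auto
    moreover have "(1 - t) * (- d) + t * (- e) < 0" using de assms(3,4) by (intro convex_bound_lt) auto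
    ultimately show ?thesis by (simp add: d_def e_def algebra_simps)
  qed
  moreover have "quasi_periodic N k (\<lambda>i. (1 - t) * \<theta> i + t * \<xi> i)"
    using assms(1,2) by (simp add: open_lifts_def quasi_periodic_def algebra_simps)
  ultimately show ?thesis by (simp add: open_lifts_def)
qed

lemma ascend_MVT:
  assumes \<theta>: "\<theta> \<in> open_lifts N k" "ascend \<tau> \<theta> \<in> open_lifts N k" and \<tau>: "0 < \<tau>"
  shows "\<exists>x. 0 < x \<and> x < \<tau> \<and>
    len N (ascend \<tau> \<theta>) - len N \<theta> = \<tau> * (\<Sum>i<N. grad \<theta> (int i) * grad (\<lambda>i. \<theta> i + x * grad \<theta> i) (int i))"
proof -
  have qp: "quasi_periodic N k \<theta>" using \<theta>(1) by (simp add: open_lifts_def)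
  have op: "(\<lambda>i. \<theta> i + x * grad \<theta> i) \<in> open_lifts N k" if "0 \<le> x" "x \<le> \<tau>" for x
  proof -
    have "(\<lambda>i. (1 - x / \<tau>) * \<theta> i + x / \<tau> * ascend \<tau> \<theta> i) \<in> open_lifts N k"
      using that \<tau> by (intro open_lifts_convex \<theta>) auto
    moreover have "(1 - x / \<tau>) * \<theta> i + x / \<tau> * ascend \<tau> \<theta> i = \<theta> i + x * grad \<theta> i" for i
      using \<tau> by (simp add: ascend_def field_simps)
    ultimately show ?thesis by simp
  qed
  have "\<exists>x>0. x < \<tau> \<and> len N (\<lambda>i. \<theta> i + \<tau> * grad \<theta> i) - len N (\<lambda>i. \<theta> i + 0 * grad \<theta> i)
      = (\<tau> - 0) * (\<Sum>i<N. grad \<theta> (int i) * grad (\<lambda>i. \<theta> i + x * grad \<theta> i) (int i))"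
  proof (rule MVT2[OF \<tau>])
    fix x assume x: "0 \<le> x" "x \<le> \<tau>"
    show "((\<lambda>x. len N (\<lambda>i. \<theta> i + x * grad \<theta> i)) has_real_derivative
        (\<Sum>i<N. grad \<theta> (int i) * grad (\<lambda>i. \<theta> i + x * grad \<theta> i) (int i))) (at x)"
      using D_open_lifts(1)[OF op[OF x]]
      by (intro has_derivative_len[where a = "grad \<theta>", OF qp grad_periodic[OF qp]]) (simp add: less_imp_neq[symmetric])
  qed
  then show ?thesis by (simp add: ascend_def)
qed

text \<open>If no step size worked, there would be counterexamples with step sizes tending to 0 and
  a limit \<open>l\<close> of them. The mean value theorem along the steps, divided by the step
  size, shows that the squared gradient at \<open>l\<close> is at most 0, so \<open>l\<close> is
  critical; and its length is exactly \<open>cs\<close>, which was excluded.\<close>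

lemma ascend_gain:
  assumes N: "0 < N"
    and boundary: "\<forall>\<xi>\<in>closed_lifts N k - open_lifts N k. len N \<xi> \<le> b"
    and cs: "b < cs" and none: "\<And>\<theta>. \<theta> \<in> open_lifts N k \<Longrightarrow> critical \<theta> \<Longrightarrow> len N \<theta> \<noteq> cs"
  shows "\<exists>\<tau>>0. \<forall>\<theta>\<in>open_lifts N k. cs \<le> len N \<theta> \<longrightarrow>
     ascend \<tau> \<theta> \<in> open_lifts N k \<and> cs < len N (ascend \<tau> \<theta>)"
proof (rule ccontr)
  assume contra: "\<not> ?thesis"
  have "\<exists>\<theta>\<in>open_lifts N k. cs \<le> len N \<theta> \<and>
      (ascend (1 / Suc m) \<theta> \<in> open_lifts N k \<longrightarrow> len N (ascend (1 / Suc m) \<theta>) \<le> cs)" for m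
  proof -
    have "0 < 1 / real (Suc m)" by simp
    then show ?thesis using contra by (meson not_less)
  qed
  then obtain \<theta> where \<theta>: "\<And>m. \<theta> m \<in> open_lifts N k" "\<And>m. cs \<le> len N (\<theta> m)"
    "\<And>m. ascend (1 / Suc m) (\<theta> m) \<in> open_lifts N k \<Longrightarrow> len N (ascend (1 / Suc m) (\<theta> m)) \<le> cs"
    by metis
  have \<theta>': "\<And>m. cs - 0 \<le> len N (\<theta> m)" using \<theta>(2) by simp
  obtain r l t where r: "strict_mono r" "l \<in> open_lifts N k" "cs \<le> len N l"
    "\<And>i. (\<lambda>m. translate (t m) (\<theta> (r m)) i) \<longlonglongrightarrow> l i"
    "\<And>m. 0 \<le> translate (t m) (\<theta> (r m)) 0" "\<And>m. translate (t m) (\<theta> (r m)) 0 \<le> 2 * pi"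
    by (rule superlevel_subseq[where \<theta> = \<theta>, OF boundary cs \<theta>(1) \<theta>' tendsto_const]) blast
  define \<phi> where "\<phi> m = translate (t m) (\<theta> (r m))" for m
  define \<tau> where "\<tau> m = 1 / real (Suc (r m))" for m
  have \<tau>: "0 < \<tau> m" for m by (simp add: \<tau>_def)
  have "(\<lambda>m. 1 / real (Suc m)) \<longlonglongrightarrow> 0" by (rule LIMSEQ_Suc[OF lim_1_over_n])
  from LIMSEQ_subseq_LIMSEQ[OF this r(1)] have \<tau>0: "\<tau> \<longlonglongrightarrow> 0" by (simp add: o_def \<tau>_def[abs_def])
  have \<phi>: "\<phi> m \<in> open_lifts N k" "cs \<le> len N (\<phi> m)"
    "ascend (\<tau> m) (\<phi> m) \<in> open_lifts N k \<Longrightarrow> len N (ascend (\<tau> m) (\<phi> m)) \<le> cs" for m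
    using \<theta>[of "r m"] by (simp_all add: \<phi>_def \<tau>_def ascend_translate translate_open_iff len_translate)
  have lim: "(\<lambda>m. \<phi> m i) \<longlonglongrightarrow> l i" for i using r(4) by (simp add: \<phi>_def)
  note limg = tendsto_grad[OF lim r(2)]
  have limstep: "(\<lambda>m. \<phi> m i + x m * grad (\<phi> m) i) \<longlonglongrightarrow> l i" if "x \<longlonglongrightarrow> 0" for x i
    using tendsto_add[OF lim[of i] tendsto_mult[OF that limg[of i]]] by simp
  have qp: "quasi_periodic N k (ascend (\<tau> m) (\<phi> m))" for m
    using \<phi>(1)[of m] by (intro ascend_quasi_periodic) (simp add: open_lifts_def)
  have lima: "(\<lambda>m. ascend (\<tau> m) (\<phi> m) i) \<longlonglongrightarrow> l i" for i
    unfolding ascend_def by (rule limstep[OF \<tau>0])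
  have ev: "\<forall>\<^sub>F m in sequentially. ascend (\<tau> m) (\<phi> m) \<in> open_lifts N k"
    by (rule eventually_open_lifts[OF lima r(2) qp N])
  \<comment> \<open>Where the ascended sequence is not an open lift, the implication is vacuous and
    any intermediate \<open>x\<close> serves; by \<open>ev\<close> this concerns only finitely many
    \<open>m\<close>.\<close>
  have "\<exists>x. 0 < x \<and> x < \<tau> m \<and> (ascend (\<tau> m) (\<phi> m) \<in> open_lifts N k \<longrightarrow>
      len N (ascend (\<tau> m) (\<phi> m)) - len N (\<phi> m)
      = \<tau> m * (\<Sum>i<N. grad (\<phi> m) (int i) * grad (\<lambda>i. \<phi> m i + x * grad (\<phi> m) i) (int i)))" for m
  proof (cases "ascend (\<tau> m) (\<phi> m) \<in> open_lifts N k")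
    case True
    then show ?thesis using ascend_MVT[OF \<phi>(1) True \<tau>] by auto
  next
    case False
    then show ?thesis using \<tau>[of m] by (intro exI[of _ "\<tau> m / 2"]) auto
  qed
  from choice[OF allI[OF this]] obtain x where x_all: "\<forall>m. 0 < x m \<and> x m < \<tau> m \<and> (ascend (\<tau> m) (\<phi> m) \<in> open_lifts N k \<longrightarrow>
      len N (ascend (\<tau> m) (\<phi> m)) - len N (\<phi> m)
      = \<tau> m * (\<Sum>i<N. grad (\<phi> m) (int i) * grad (\<lambda>i. \<phi> m i + x m * grad (\<phi> m) i) (int i)))" ..
  then have x: "\<And>m. 0 < x m" "\<And>m. x m < \<tau> m"
    "\<And>m. ascend (\<tau> m) (\<phi> m) \<in> open_lifts N k \<Longrightarrow> len N (ascend (\<tau> m) (\<phi> m)) - len N (\<phi> m)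
      = \<tau> m * (\<Sum>i<N. grad (\<phi> m) (int i) * grad (\<lambda>i. \<phi> m i + x m * grad (\<phi> m) i) (int i))"
    by blast+
  have x0: "x \<longlonglongrightarrow> 0"
  proof (rule tendsto_sandwich[OF _ _ tendsto_const \<tau>0])
    show "\<forall>\<^sub>F m in sequentially. 0 \<le> x m" "\<forall>\<^sub>F m in sequentially. x m \<le> \<tau> m"
      using x(1,2) less_imp_le by (intro always_eventually allI; blast)+
  qed
  have lim_sum: "(\<lambda>m. \<Sum>i<N. grad (\<phi> m) (int i) * grad (\<lambda>i. \<phi> m i + x m * grad (\<phi> m) i) (int i))
      \<longlonglongrightarrow> (\<Sum>i<N. grad l (int i) * grad l (int i))"
    by (intro tendsto_intros limg tendsto_grad[OF limstep[OF x0] r(2)])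
  have ev_sum: "\<forall>\<^sub>F m in sequentially.
      (\<Sum>i<N. grad (\<phi> m) (int i) * grad (\<lambda>i. \<phi> m i + x m * grad (\<phi> m) i) (int i)) \<le> 0"
    using ev
  proof eventually_elim
    case (elim m)
    \<comment> \<open>The lengths before and after the step lie on different sides of
      \<open>cs\<close>, so the step gains nothing.\<close>
    have "\<tau> m * (\<Sum>i<N. grad (\<phi> m) (int i) * grad (\<lambda>i. \<phi> m i + x m * grad (\<phi> m) i) (int i)) \<le> 0"
      using x(3)[OF elim] \<phi>(2)[of m] \<phi>(3)[OF elim] by linarith
    then show ?case using \<tau>[of m] by (simp add: mult_le_0_iff)
  qed
  have "(\<Sum>i<N. grad l (int i) * grad l (int i)) \<le> 0"
    by (rule tendsto_upperbound[OF lim_sum ev_sum trivial_limit_sequentially])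
  then have "critical l"
    using r(2) N by (intro critical_if_sum_squares) (auto simp: open_lifts_def)
  moreover have "len N l \<le> cs"
  proof (rule tendsto_upperbound[OF tendsto_len[OF lima]])
    show "\<forall>\<^sub>F m in sequentially. len N (ascend (\<tau> m) (\<phi> m)) \<le> cs"
      using ev by eventually_elim (rule \<phi>(3))
  qed simp
  ultimately show False using none[OF r(2)] r(3) by simp
qed

text \<open>With the step size now fixed, a second passage to a limit turns the strict gain at level
  \<open>cs\<close> into a margin that also covers levels slightly below \<open>cs\<close>.\<close>

lemma ascend_gain_uniform:
  assumes N: "0 < N"
    and boundary: "\<forall>\<xi>\<in>closed_lifts N k - open_lifts N k. len N \<xi> \<le> b"
    and cs: "b < cs" and none: "\<And>\<theta>. \<theta> \<in> open_lifts N k \<Longrightarrow> critical \<theta> \<Longrightarrow> len N \<theta> \<noteq> cs"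
  obtains \<tau> \<delta> where "0 < \<delta>" "\<And>\<theta>. \<theta> \<in> open_lifts N k \<Longrightarrow> cs - \<delta> \<le> len N \<theta> \<Longrightarrow>
     ascend \<tau> \<theta> \<in> open_lifts N k \<and> cs + \<delta> \<le> len N (ascend \<tau> \<theta>)"
proof -
  obtain \<tau> where \<tau>: "0 < \<tau>" "\<And>\<theta>. \<theta> \<in> open_lifts N k \<Longrightarrow> cs \<le> len N \<theta> \<Longrightarrow>
     ascend \<tau> \<theta> \<in> open_lifts N k \<and> cs < len N (ascend \<tau> \<theta>)"
    using ascend_gain[OF assms] by blast
  have "\<exists>m. \<forall>\<theta>\<in>open_lifts N k. cs - 1 / real (Suc m) \<le> len N \<theta> \<longrightarrow>
     ascend \<tau> \<theta> \<in> open_lifts N k \<and> cs + 1 / real (Suc m) \<le> len N (ascend \<tau> \<theta>)"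
  proof (rule ccontr)
    assume "\<not> ?thesis"
    then have "\<forall>m. \<exists>\<theta>. \<theta> \<in> open_lifts N k \<and> cs - 1 / real (Suc m) \<le> len N \<theta> \<and>
      (ascend \<tau> \<theta> \<in> open_lifts N k \<longrightarrow> len N (ascend \<tau> \<theta>) \<le> cs + 1 / real (Suc m))"
      by (meson linear)
    then obtain \<theta> where \<theta>: "\<And>m. \<theta> m \<in> open_lifts N k" "\<And>m. cs - 1 / real (Suc m) \<le> len N (\<theta> m)"
      "\<And>m. ascend \<tau> (\<theta> m) \<in> open_lifts N k \<Longrightarrow> len N (ascend \<tau> (\<theta> m)) \<le> cs + 1 / real (Suc m)"
      by metis
    have eps: "(\<lambda>m. 1 / real (Suc m)) \<longlonglongrightarrow> 0" by (rule LIMSEQ_Suc[OF lim_1_over_n])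
    obtain r l t where r: "strict_mono r" "l \<in> open_lifts N k" "cs \<le> len N l"
    "\<And>i. (\<lambda>m. translate (t m) (\<theta> (r m)) i) \<longlonglongrightarrow> l i"
    "\<And>m. 0 \<le> translate (t m) (\<theta> (r m)) 0" "\<And>m. translate (t m) (\<theta> (r m)) 0 \<le> 2 * pi"
      by (rule superlevel_subseq[where \<theta> = \<theta>, OF boundary cs \<theta>(1,2) eps]) blast
    define \<phi> where "\<phi> m = translate (t m) (\<theta> (r m))" for m
    have \<phi>: "\<phi> m \<in> open_lifts N k" for m
      using \<theta>(1)[of "r m"] by (simp add: \<phi>_def translate_open)
    have \<phi>3: "ascend \<tau> (\<phi> m) \<in> open_lifts N k \<Longrightarrow> len N (ascend \<tau> (\<phi> m)) \<le> cs + 1 / real (Suc (r m))" for m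
      using \<theta>(3)[of "r m"] by (simp add: \<phi>_def ascend_translate translate_open_iff len_translate)
    have lim: "(\<lambda>m. \<phi> m i) \<longlonglongrightarrow> l i" for i using r(4) by (simp add: \<phi>_def)
    have lima: "(\<lambda>m. ascend \<tau> (\<phi> m) i) \<longlonglongrightarrow> ascend \<tau> l i" for i
      unfolding ascend_def by (intro tendsto_intros lim tendsto_grad[OF lim r(2)])
    have al: "ascend \<tau> l \<in> open_lifts N k" "cs < len N (ascend \<tau> l)" using \<tau>(2)[OF r(2,3)] by auto
    have ev: "\<forall>\<^sub>F m in sequentially. ascend \<tau> (\<phi> m) \<in> open_lifts N k"
      using \<phi> by (intro eventually_open_lifts[OF lima al(1)] ascend_quasi_periodic N) (simp add: open_lifts_def)
    have "(\<lambda>m. cs + 1 / real (Suc (r m))) \<longlonglongrightarrow> cs + 0"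
      using LIMSEQ_subseq_LIMSEQ[OF eps r(1)] by (intro tendsto_intros) (simp add: o_def)
    moreover have "(\<lambda>m. len N (ascend \<tau> (\<phi> m))) \<longlonglongrightarrow> len N (ascend \<tau> l)" by (rule tendsto_len[OF lima])
    moreover have "\<forall>\<^sub>F m in sequentially. len N (ascend \<tau> (\<phi> m)) \<le> cs + 1 / real (Suc (r m))"
      using ev by eventually_elim (rule \<phi>3)
    ultimately have "len N (ascend \<tau> l) \<le> cs + 0"
      by (intro tendsto_le[OF trivial_limit_sequentially])
    then show False using al(2) by simp
  qed
  then obtain m where m: "\<And>\<theta>. \<theta> \<in> open_lifts N k \<Longrightarrow> cs - 1 / real (Suc m) \<le> len N \<theta> \<Longrightarrow>
     ascend \<tau> \<theta> \<in> open_lifts N k \<and> cs + 1 / real (Suc m) \<le> len N (ascend \<tau> \<theta>)"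
    by blast
  show ?thesis by (rule that[of "1 / real (Suc m)" \<tau>]) (use m in auto)
qed

text \<open>In the quotient by cyclic shifts the path closes up to a loop, and \<open>v\<close> is a
  lower bound for the lengths along it.\<close>

definition loop_level :: "nat \<Rightarrow> int \<Rightarrow> real \<Rightarrow> bool" where
  "loop_level N k v \<longleftrightarrow> (\<exists>\<theta>. path_component {\<xi> \<in> open_lifts N k. v \<le> len N \<xi>} \<theta> (shift \<theta>))"

text \<open>If the supremum \<open>cs\<close> were not a critical value, one ascent step would lift
  a loop at a level above \<open>cs - \<delta>\<close> to the level \<open>cs + \<delta>\<close>.
  The loop remains one because \<open>ascend\<close> commutes with \<open>shift\<close>.\<close>

lemma minimax_critical:
  assumes N: "0 < N"
    and boundary: "\<forall>\<xi>\<in>closed_lifts N k - open_lifts N k. len N \<xi> \<le> b"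
    and c0: "b < c0" "loop_level N k c0" and M: "\<And>\<xi>. \<xi> \<in> open_lifts N k \<Longrightarrow> len N \<xi> \<le> M"
  obtains \<theta> where "\<theta> \<in> open_lifts N k" "critical \<theta>" "len N \<theta> = Sup (Collect (loop_level N k))"
proof -
  let ?L = "Collect (loop_level N k)"
  define cs where "cs = Sup ?L"
  have le_M: "v \<le> M" if "loop_level N k v" for v
  proof -
    obtain \<theta> where "path_component {\<xi> \<in> open_lifts N k. v \<le> len N \<xi>} \<theta> (shift \<theta>)"
      using \<open>loop_level N k v\<close> unfolding loop_level_def by blast
    from path_component_mem(1)[OF this] M show ?thesis by force
  qed
  then have bdd: "bdd_above ?L" by (auto simp: bdd_above_def)
  have up: "v \<le> cs" if "loop_level N k v" for v
    unfolding cs_def using that bdd by (intro cSup_upper) auto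
  have cs: "b < cs" using up[OF c0(2)] c0(1) by simp
  have "\<exists>\<theta>\<in>open_lifts N k. critical \<theta> \<and> len N \<theta> = cs"
  proof (rule ccontr)
    assume "\<not> ?thesis"
    then have none: "\<And>\<theta>. \<theta> \<in> open_lifts N k \<Longrightarrow> critical \<theta> \<Longrightarrow> len N \<theta> \<noteq> cs" by blast
    obtain \<tau> \<delta> where \<delta>: "0 < \<delta>" "\<And>\<theta>. \<theta> \<in> open_lifts N k \<Longrightarrow> cs - \<delta> \<le> len N \<theta> \<Longrightarrow>
       ascend \<tau> \<theta> \<in> open_lifts N k \<and> cs + \<delta> \<le> len N (ascend \<tau> \<theta>)"
      using ascend_gain_uniform[OF N boundary cs none] by blast
    have "?L \<noteq> {}" using c0(2) by auto
    then obtain v where v: "loop_level N k v" "cs - \<delta> < v"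
      using less_cSup_iff[of ?L "cs - \<delta>"] bdd \<delta>(1) by (auto simp: cs_def)
    then obtain \<theta> where p: "path_component {\<xi> \<in> open_lifts N k. v \<le> len N \<xi>} \<theta> (shift \<theta>)"
      unfolding loop_level_def by blast
    have "path_component {\<xi> \<in> open_lifts N k. cs + \<delta> \<le> len N \<xi>} (ascend \<tau> \<theta>) (ascend \<tau> (shift \<theta>))"
    proof (rule path_component_image[OF p])
      show "continuous_on {\<xi> \<in> open_lifts N k. v \<le> len N \<xi>} (ascend \<tau>)"
        by (rule continuous_on_subset[OF continuous_on_ascend]) auto
      show "ascend \<tau> ` {\<xi> \<in> open_lifts N k. v \<le> len N \<xi>} \<subseteq> {\<xi> \<in> open_lifts N k. cs + \<delta> \<le> len N \<xi>}"
        using \<delta>(2) v(2) by force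
    qed
    then have "loop_level N k (cs + \<delta>)" unfolding loop_level_def ascend_shift by blast
    then show False using up \<delta>(1) by fastforce
  qed
  then show ?thesis using that by (auto simp: cs_def)
qed

end

section \<open>Two different critical lengths in one class\<close>

lemma cis_eq_cis_iff: "cis x = cis y \<longleftrightarrow> (\<exists>m::int. x = y + 2 * pi * m)"
  by (simp add: complex_eq_iff sin_cos_eq_iff[symmetric] conj_commute)

lemma infinite_cis_greaterThanLessThan:
  assumes "a < b" shows "infinite (cis ` {a<..<b})"
proof -
  \<comment> \<open>Shortened to less than a full turn, where \<open>cis\<close> is
    injective.\<close>
  define b' where "b' = min b (a + pi)"
  have ab: "a < b'" "b' \<le> b" "b' < a + 2 * pi" using assms pi_gt_zero by (simp_all add: b'_def min_def)
  have "inj_on cis {a<..<b'}"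
  proof (rule inj_onI)
    fix x y assume xy: "x \<in> {a<..<b'}" "y \<in> {a<..<b'}" "cis x = cis y"
    then obtain m :: int where m: "x = y + 2 * pi * m" by (auto simp: cis_eq_cis_iff)
    have "\<bar>2 * pi * m\<bar> < 2 * pi * 1" using xy ab m by auto
    then have "m = 0" by (simp add: abs_mult)
    then show "x = y" using m by simp
  qed
  moreover have "infinite {a<..<b'}" using ab by simp
  ultimately have "infinite (cis ` {a<..<b'})" by (simp add: finite_image_iff)
  moreover have "cis ` {a<..<b'} \<subseteq> cis ` {a<..<b}" using ab by auto
  ultimately show ?thesis using finite_subset by blast
qed

context closed_curve
begin

lemma loop_level_translate:
  assumes "path_component {\<xi> \<in> open_lifts N k. v \<le> len N \<xi>} \<theta> (shift \<theta>)"
  shows "path_component {\<xi> \<in> open_lifts N k. v \<le> len N \<xi>} (translate m \<theta>) (shift (translate m \<theta>))"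
proof -
  have "path_component {\<xi> \<in> open_lifts N k. v \<le> len N \<xi>} (translate m \<theta>) (translate m (shift \<theta>))"
  proof (rule path_component_image[OF assms])
    show "continuous_on {\<xi> \<in> open_lifts N k. v \<le> len N \<xi>} (translate m)"
      unfolding translate_def
      by (intro continuous_on_coordinatewise_then_product continuous_intros continuous_on_coordinate)
  qed (auto simp: translate_open len_translate)
  then show ?thesis by (simp add: shift_def translate_def)
qed

text \<open>A loop moves the first vertex over an interval; if there were loops arbitrarily close to the
  maximal level, every point of such an interval would be a vertex of a maximal polygon.\<close>

lemma loops_below_max:
  assumes N: "0 < N"
    and boundary: "\<forall>\<xi>\<in>closed_lifts N k - open_lifts N k. len N \<xi> \<le> b"
    and M: "b < M" "\<And>\<xi>. \<xi> \<in> open_lifts N k \<Longrightarrow> len N \<xi> \<le> M"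
    and Z: "finite Z" "\<forall>\<theta>\<in>open_lifts N k. critical \<theta> \<longrightarrow> (\<forall>i. cis (\<theta> i) \<in> Z)"
  shows "\<exists>\<epsilon>>0. \<forall>v. loop_level N k v \<longrightarrow> v \<le> M - \<epsilon>"
proof (rule ccontr)
  assume "\<not> ?thesis"
  then have "\<forall>m. \<exists>v. loop_level N k v \<and> M - 1 / real (Suc m) < v"
    by (meson not_le of_nat_0_less_iff zero_less_Suc zero_less_divide_1_iff)
  then obtain v where v: "\<And>m. loop_level N k (v m)" "\<And>m. M - 1 / real (Suc m) < v m" by metis
  have "\<exists>\<theta>. path_component {\<xi> \<in> open_lifts N k. v m \<le> len N \<xi>} \<theta> (shift \<theta>)
      \<and> 0 \<le> \<theta> 0 \<and> \<theta> 0 \<le> 2 * pi" for m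
  proof -
    obtain \<eta> where \<eta>: "path_component {\<xi> \<in> open_lifts N k. v m \<le> len N \<xi>} \<eta> (shift \<eta>)"
      using v(1)[of m] unfolding loop_level_def by blast
    obtain t where "0 \<le> translate t \<eta> 0" "translate t \<eta> 0 \<le> 2 * pi" by (rule translate_normalize)
    then show ?thesis using loop_level_translate[OF \<eta>, of t] by blast
  qed
  from choice[OF allI[OF this]] obtain \<theta> where "\<forall>m. path_component {\<xi> \<in> open_lifts N k. v m \<le> len N \<xi>} (\<theta> m) (shift (\<theta> m))
      \<and> 0 \<le> \<theta> m 0 \<and> \<theta> m 0 \<le> 2 * pi" ..
  then have \<theta>: "\<And>m. path_component {\<xi> \<in> open_lifts N k. v m \<le> len N \<xi>} (\<theta> m) (shift (\<theta> m))"
    "\<And>m. 0 \<le> \<theta> m 0" "\<And>m. \<theta> m 0 \<le> 2 * pi" by blast+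
  have op: "\<theta> m \<in> open_lifts N k" "v m \<le> len N (\<theta> m)" for m
    using path_component_mem(1)[OF \<theta>(1)[of m]] by auto
  have eps: "(\<lambda>m. 1 / real (Suc m)) \<longlonglongrightarrow> 0" by (rule LIMSEQ_Suc[OF lim_1_over_n])
  have cl: "\<theta> m \<in> closed_lifts N k" for m using op(1) open_lifts_subset by blast
  obtain r l where r: "strict_mono r" "l \<in> closed_lifts N k" "\<And>i. (\<lambda>m. \<theta> (r m) i) \<longlonglongrightarrow> l i"
    using closed_lifts_subseq[of \<theta> N k, OF cl \<theta>(2,3)] by blast
  have eps_r: "(\<lambda>m. M - 1 / real (Suc (r m))) \<longlonglongrightarrow> M - 0"
    using LIMSEQ_subseq_LIMSEQ[OF eps r(1)] by (intro tendsto_intros) (simp add: o_def)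
  have "M - 0 \<le> len N l"
    by (rule LIMSEQ_le[OF eps_r tendsto_len[OF r(3)]]) (meson le_less_trans less_imp_le op(2) v(2) less_le_trans)
  then have "l \<in> open_lifts N k" using boundary r(2) M(1) by force
  then have l01: "l 0 < l 1" unfolding open_lifts_def by (metis (no_types, lifting) add_0 mem_Collect_eq)
  \<comment> \<open>Along a loop the first angle runs from \<open>\<theta> (r m) 0\<close> to
    \<open>\<theta> (r m) 1\<close>, and these tend to \<open>l 0 < l 1\<close>. So all late loops
    pass over any \<open>\<zeta>\<close> strictly in between, in particular over one whose point
    lies outside the finite set \<open>Z\<close>.\<close>
  have "\<not> cis ` {l 0<..<l 1} \<subseteq> Z"
    using infinite_cis_greaterThanLessThan[OF l01] Z(1) finite_subset by blast
  then have "\<exists>\<zeta>\<in>{l 0<..<l 1}. cis \<zeta> \<notin> Z" by blast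
  then obtain \<zeta> where \<zeta>: "l 0 < \<zeta>" "\<zeta> < l 1" "cis \<zeta> \<notin> Z" by (auto simp only: greaterThanLessThan_iff)
  have "\<forall>\<^sub>F m in sequentially. \<theta> (r m) 0 < \<zeta>" "\<forall>\<^sub>F m in sequentially. \<zeta> < \<theta> (r m) 1"
    using order_tendstoD(2)[OF r(3)[of 0] \<zeta>(1)] order_tendstoD(1)[OF r(3)[of 1] \<zeta>(2)] by auto
  then have "\<forall>\<^sub>F m in sequentially. \<theta> (r m) 0 < \<zeta> \<and> \<zeta> < \<theta> (r m) 1" by eventually_elim simp
  then obtain m0 where m0: "\<And>m. m0 \<le> m \<Longrightarrow> \<theta> (r m) 0 < \<zeta> \<and> \<zeta> < \<theta> (r m) 1"
    by (auto simp: eventually_sequentially)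
  have "\<exists>\<xi>. \<xi> \<in> open_lifts N k \<and> M - 1 / real (Suc (r (m + m0))) \<le> len N \<xi> \<and> \<xi> 0 = \<zeta>" for m
  proof -
    let ?m = "r (m + m0)"
    obtain g where g: "path g" "path_image g \<subseteq> {\<xi> \<in> open_lifts N k. v ?m \<le> len N \<xi>}"
      "pathstart g = \<theta> ?m" "pathfinish g = shift (\<theta> ?m)"
      using \<theta>(1)[of ?m] unfolding path_component_def by blast
    have "continuous_on {0..1} (\<lambda>t. g t 0)"
      using g(1) unfolding path_def by (rule continuous_on_product_then_coordinatewise)
    moreover have "g 0 0 \<le> \<zeta>" "\<zeta> \<le> g 1 0"
      using g(3,4) m0[of "m + m0"] by (auto simp: pathstart_def pathfinish_def shift_def)
    ultimately obtain t where t: "0 \<le> t" "t \<le> 1" "g t 0 = \<zeta>"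
      using IVT'[of "\<lambda>t. g t 0" 0 \<zeta> 1] by auto
    then have "g t \<in> path_image g" by (auto simp: path_image_def)
    then have "g t \<in> {\<xi> \<in> open_lifts N k. v ?m \<le> len N \<xi>}" using g(2) by blast
    then show ?thesis using t(3) v(2)[of ?m] by (intro exI[of _ "g t"]) auto
  qed
  then obtain \<xi> where \<xi>: "\<And>m. \<xi> m \<in> open_lifts N k"
    "\<And>m. M - 1 / real (Suc (r (m + m0))) \<le> len N (\<xi> m)" "\<And>m. \<xi> m 0 = \<zeta>" by metis
  have eps': "(\<lambda>m. 1 / real (Suc (r (m + m0)))) \<longlonglongrightarrow> 0"
    using LIMSEQ_ignore_initial_segment[OF LIMSEQ_subseq_LIMSEQ[OF eps r(1)], of m0] by (simp add: o_def)
  obtain r' l' t where l': "strict_mono r'" "l' \<in> open_lifts N k" "M \<le> len N l'"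
    "\<And>i. (\<lambda>m. translate (t m) (\<xi> (r' m)) i) \<longlonglongrightarrow> l' i"
    "\<And>m. 0 \<le> translate (t m) (\<xi> (r' m)) 0" "\<And>m. translate (t m) (\<xi> (r' m)) 0 \<le> 2 * pi"
    by (rule superlevel_subseq[where \<theta> = \<xi>, OF boundary M(1) \<xi>(1,2) eps']) blast
  \<comment> \<open>The normalizing turns do not move the first vertex on the curve, so the limit, a
    polygon of maximal length, still has a vertex at \<open>cis \<zeta>\<close>.\<close>
  have "(\<lambda>m. cis (translate (t m) (\<xi> (r' m)) 0)) \<longlonglongrightarrow> cis (l' 0)"
    using l'(4)[of 0] by (intro tendsto_intros)
  moreover have "cis (translate (t m) (\<xi> (r' m)) 0) = cis \<zeta>" for m
    by (simp add: translate_def \<xi>(3) cis_mult[symmetric] cis_multiple_2pi)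
  ultimately have "cis (l' 0) = cis \<zeta>" by (simp add: LIMSEQ_const_iff)
  moreover have "critical l'"
    by (rule critical_if_max[OF l'(2) _ N]) (use M(2) l'(3) in force)
  ultimately show False using bspec[OF Z(2) l'(2)] \<zeta>(3) by metis
qed

text \<open>A longest polygon \<open>M\<close> is one critical point. If the curve touches a side of
  \<open>Y\<close> at an interior parameter, inserting that point gives another one, of the length
  of \<open>Y\<close>. Otherwise a vertex loop lies strictly above \<open>Y\<close>, and the minimax
  level over such loops is critical and strictly below the maximum.\<close>

lemma two_critical_levels:
  assumes N: "2 \<le> N" and k: "1 \<le> k" "k \<le> int N" and dom: "dominating N k Y"
    and Z: "finite Z" "\<forall>\<theta>\<in>open_lifts (Suc N) k. critical \<theta> \<longrightarrow> (\<forall>i. cis (\<theta> i) \<in> Z)"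
  shows "\<exists>\<theta>\<in>open_lifts (Suc N) k. \<exists>\<xi>\<in>open_lifts (Suc N) k.
      critical \<theta> \<and> critical \<xi> \<and> len (Suc N) \<theta> \<noteq> len (Suc N) \<xi>"
proof -
  have Y: "Y \<in> open_lifts N k" and max: "\<And>\<eta>. \<eta> \<in> closed_lifts N k \<Longrightarrow> len N \<eta> \<le> len N Y"
    using dom by (auto simp: dominating_def)
  have qpY: "quasi_periodic N k Y" using Y by (simp add: open_lifts_def)
  have boundary: "\<forall>\<xi>\<in>closed_lifts (Suc N) k - open_lifts (Suc N) k. len (Suc N) \<xi> \<le> len N Y"
  proof
    fix \<xi> assume \<xi>: "\<xi> \<in> closed_lifts (Suc N) k - open_lifts (Suc N) k"
    then have "\<exists>e\<in>{0, 1}. \<exists>\<eta>\<in>closed_lifts N (k - e). len N \<eta> = len (Suc N) \<xi>"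
      using N by (intro boundary_delete) auto
    then obtain e \<eta> where "e \<in> {0, 1}" "\<eta> \<in> closed_lifts N (k - e)" "len N \<eta> = len (Suc N) \<xi>"
      by blast
    moreover from this(1,2) have "\<eta> \<in> closed_lifts N k \<union> closed_lifts N (k - 1)" by auto
    ultimately show "len (Suc N) \<xi> \<le> len N Y" using dom unfolding dominating_def by metis
  qed
  obtain M where M: "M \<in> open_lifts (Suc N) k" "\<And>\<xi>. \<xi> \<in> closed_lifts (Suc N) k \<Longrightarrow> len (Suc N) \<xi> \<le> len (Suc N) M"
    using len_max_interior[of "Suc N" k] N k by auto
  have Mop: "len (Suc N) \<xi> \<le> len (Suc N) M" if "\<xi> \<in> open_lifts (Suc N) k" for \<xi>
    using M(2) that open_lifts_subset by blast
  have crit_max: "critical \<xi>" if "\<xi> \<in> open_lifts (Suc N) k" "len (Suc N) M \<le> len (Suc N) \<xi>" for \<xi>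
    by (rule critical_if_max[OF that(1)]) (use that(2) Mop in force)+
  have critM: "critical M" by (rule crit_max[OF M(1)]) simp
  show ?thesis
  proof (cases "\<exists>j a. Y (int N - 1 + int j) < a \<and> a < Y (int N + int j) \<and>
        excess N ((shift ^^ j) Y) a (Y (int N + int j)) = 0")
    case True
    then obtain j a where ja: "Y (int N - 1 + int j) < a" "a < Y (int N + int j)"
      "excess N ((shift ^^ j) Y) a (Y (int N + int j)) = 0" by blast
    define W where "W = (shift ^^ j) Y"
    have W: "W \<in> open_lifts N k" "len N W = len N Y" "W (int N - 1) < a" "a < W (int N)" "excess N W a (W (int N)) = 0"
      using ja shift_pow_open[OF Y] len_shift_pow[OF qpY] by (simp_all add: W_def shift_pow algebra_simps)
    have Wmax: "\<And>\<eta>. \<eta> \<in> closed_lifts N k \<Longrightarrow> len N \<eta> \<le> len N W" using max W(2) by simp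
    let ?\<theta> = "insert_vertex N k W a (W (int N))"
    note \<theta> = insert_on_side_critical[OF N W(1) Wmax W(3-5)]
    have "len (Suc N) ?\<theta> \<noteq> len (Suc N) M"
    proof
      assume eq: "len (Suc N) ?\<theta> = len (Suc N) M"
      have W2: "W (int N - 1) < W (int N - 1 + 1) \<and> W (int N - 1 + 1) < W (int N - 1) + 2 * pi"
        "W (int N) < W (int N + 1) \<and> W (int N + 1) < W (int N) + 2 * pi"
        using W(1) unfolding open_lifts_def by blast+
      \<comment> \<open>Insertion never shortens, so if \<open>Y\<close> were already as long as
        \<open>M\<close>, every point inserted on this side would give a longest, hence critical,
        polygon.\<close>
      have "cis x \<in> Z" if "W (int N - 1) < x" "x < W (int N)" for x
      proof -
        have op: "insert_vertex N k W x (W (int N)) \<in> open_lifts (Suc N) k"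
          using that W2 by (intro insert_vertex_open W N) auto
        have "len (Suc N) (insert_vertex N k W x (W (int N))) = len N W + excess N W x (W (int N))"
          using len_insert[OF N, of k W x "W (int N)"] W(1) by (simp add: open_lifts_def)
        then have "len (Suc N) M \<le> len (Suc N) (insert_vertex N k W x (W (int N)))"
          using excess_nonneg[of N W x] eq \<theta>(2) by simp
        from crit_max[OF op this] have "cis (insert_vertex N k W x (W (int N)) (int N)) \<in> Z"
          using bspec[OF Z(2) op] by blast
        then show ?thesis
          using insert_vertex_eq(3)[of N k W x "W (int N)"] N by simp
      qed
      then have "cis ` {W (int N - 1)<..<W (int N)} \<subseteq> Z" by auto
      then show False
        using infinite_cis_greaterThanLessThan[of "W (int N - 1)" "W (int N)"] W2 finite_subset[OF _ Z(1)] by auto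
    qed
    then show ?thesis using \<theta>(1,3) M(1) critM by blast
  next
    case False
    then obtain \<theta> where "path_component {\<xi> \<in> open_lifts (Suc N) k. len N Y < len (Suc N) \<xi>} \<theta> (shift \<theta>)"
      using vertex_loop[OF N Y max] by blast
    from vertex_loop_level[OF this] obtain v where v: "len N Y < v" "loop_level (Suc N) k v"
      unfolding loop_level_def by blast
    obtain \<xi> where \<xi>: "\<xi> \<in> open_lifts (Suc N) k" "critical \<xi>"
      "len (Suc N) \<xi> = Sup (Collect (loop_level (Suc N) k))"
      using minimax_critical[OF _ boundary v Mop] by blast
    have vM: "v \<le> len (Suc N) M"
    proof -
      obtain \<theta> where "path_component {\<xi> \<in> open_lifts (Suc N) k. v \<le> len (Suc N) \<xi>} \<theta> (shift \<theta>)"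
        using v(2) unfolding loop_level_def by blast
      from path_component_mem(1)[OF this] Mop show ?thesis by force
    qed
    have "len N Y < len (Suc N) M" using v(1) vM by simp
    then obtain \<epsilon> where \<epsilon>: "\<epsilon> > 0" "\<And>v. loop_level (Suc N) k v \<Longrightarrow> v \<le> len (Suc N) M - \<epsilon>"
      using loops_below_max[where N = "Suc N" and k = k and b = "len N Y" and M = "len (Suc N) M" and Z = Z,
          OF _ boundary _ Mop Z] by blast
    have "Sup (Collect (loop_level (Suc N) k)) \<le> len (Suc N) M - \<epsilon>"
      using v(2) \<epsilon>(2) by (intro cSup_least) auto
    then have "len (Suc N) \<xi> \<noteq> len (Suc N) M" using \<xi>(3) \<epsilon>(1) by simp
    then show ?thesis using \<xi>(1,2) M(1) critM by blast
  qed
qed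

end

subsection \<open>Trajectories as critical lifts\<close>

definition points :: "nat \<Rightarrow> (int \<Rightarrow> real) \<Rightarrow> complex list" where
  "points p \<theta> = map (\<lambda>i. cis (\<theta> (int i))) [0..<p]"

lemma length_points [simp]: "length (points p \<theta>) = p"
  by (simp add: points_def)

lemma nth_points [simp]: "i < p \<Longrightarrow> points p \<theta> ! i = cis (\<theta> (int i))"
  by (simp add: points_def)

lemma cis_add_2pi_int: "cis (x + 2 * pi * of_int m) = cis x"
  unfolding cis_eq_cis_iff by blast

lemma cis_quasi_periodic_mod:
  assumes "quasi_periodic p k \<theta>" shows "cis (\<theta> (i mod int p)) = cis (\<theta> i)"
proof -
  have "\<theta> i = \<theta> (i mod int p) + 2 * pi * of_int (k * (i div int p))"
    using quasi_periodic_mod[OF assms, of i] by simp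
  then show ?thesis by (simp only: cis_add_2pi_int)
qed

lemma next_index_less: "0 < p \<Longrightarrow> next_index p i < p"
  by (simp add: next_index_def)

lemma prev_index_less: "0 < p \<Longrightarrow> prev_index p i < p"
  by (simp add: prev_index_def)

lemma points_next:
  assumes "quasi_periodic p k \<theta>" "0 < p"
  shows "points p \<theta> ! next_index p i = cis (\<theta> (int i + 1))"
  using cis_quasi_periodic_mod[OF assms(1), of "int i + 1"] next_index_less[OF assms(2), of i]
  by (simp add: next_index_def zmod_int add.commute)

lemma points_prev:
  assumes "quasi_periodic p k \<theta>" "0 < p"
  shows "points p \<theta> ! prev_index p i = cis (\<theta> (int i - 1))"
proof -
  have "\<theta> (int i - 1 + int p) = \<theta> (int i - 1) + 2 * pi * of_int k"
    using assms(1) unfolding quasi_periodic_def by blast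
  then have "cis (\<theta> (int i - 1 + int p)) = cis (\<theta> (int i - 1))" by (simp only: cis_add_2pi_int)
  moreover have "int (i + p - 1) = int i - 1 + int p" using assms(2) by simp
  then have "int (prev_index p i) = (int i - 1 + int p) mod int p" by (simp only: prev_index_def zmod_int)
  ultimately show ?thesis
    using cis_quasi_periodic_mod[OF assms(1), of "int i - 1 + int p"] prev_index_less[OF assms(2), of i]
    by (simp only: nth_points)
qed

lemma cis_neq_if_between: "x < y \<Longrightarrow> y < x + 2 * pi \<Longrightarrow> cis x \<noteq> cis y"
proof
  assume xy: "x < y" "y < x + 2 * pi" "cis x = cis y"
  then obtain m :: int where m: "y = x + 2 * pi * m" by (metis cis_eq_cis_iff)
  have "0 < 2 * pi * m" "2 * pi * m < 2 * pi * 1" using xy m by auto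
  then have "0 < m" "m < 1" by (simp_all add: zero_less_mult_iff)
  then show False by simp
qed

lemma points_admissible:
  assumes "\<theta> \<in> open_lifts p k" "0 < p" shows "points p \<theta> \<in> admissible_tuples p"
proof -
  have qp: "quasi_periodic p k \<theta>" using assms by (simp add: open_lifts_def)
  have "cis (\<theta> (int i)) \<noteq> cis (\<theta> (int i + 1))" for i
    using assms(1) by (intro cis_neq_if_between) (auto simp: open_lifts_def)
  moreover have "set (points p \<theta>) \<subseteq> sphere 0 1" by (auto simp: points_def)
  ultimately show ?thesis
    by (simp add: admissible_tuples_def points_next[OF qp assms(2)])
qed

text \<open>The arguments of the quotients of consecutive vertices are the steps; accumulating them
  from the argument of the first vertex gives the angles.\<close>

lemma admissible_lift:
  assumes xs: "xs \<in> admissible_tuples p" and p: "0 < p"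
  obtains k \<theta> where "\<theta> \<in> open_lifts p k" "points p \<theta> = xs"
proof -
  have len: "length xs = p" and neq: "\<And>i. i < p \<Longrightarrow> xs ! i \<noteq> xs ! next_index p i"
    using xs by (auto simp: admissible_tuples_def)
  have norm: "norm (xs ! i) = 1" if "i < p" for i
  proof -
    have "xs ! i \<in> sphere 0 1" using xs nth_mem[of i xs] that len unfolding admissible_tuples_def by blast
    then show ?thesis by simp
  qed
  \<comment> \<open>\<open>Arg2pi\<close> takes values in [0, 2 pi), and 0 is excluded because
    consecutive vertices differ.\<close>
  define \<alpha> where "\<alpha> i = Arg2pi (xs ! next_index p i / xs ! i)" for i
  have \<alpha>: "cis (\<alpha> i) = xs ! next_index p i / xs ! i" "0 < \<alpha> i" "\<alpha> i < 2 * pi" if "i < p" for i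
  proof -
    have "norm (xs ! next_index p i / xs ! i) = 1"
      using norm[OF that] norm[OF next_index_less[OF p]] by (simp add: norm_divide)
    then show c: "cis (\<alpha> i) = xs ! next_index p i / xs ! i"
      by (simp add: \<alpha>_def cis_conv_exp complex_norm_eq_1_exp)
    show "\<alpha> i < 2 * pi" by (simp add: \<alpha>_def Arg2pi)
    have "\<alpha> i \<noteq> 0"
    proof
      assume "\<alpha> i = 0"
      then have "xs ! next_index p i / xs ! i = 1" using c by simp
      then show False using neq[OF that] norm[OF that] by (simp add: divide_eq_1_iff)
    qed
    then show "0 < \<alpha> i" by (simp add: \<alpha>_def Arg2pi less_le)
  qed
  define g where "g i = Arg2pi (xs ! 0) + (\<Sum>j<nat i. \<alpha> j)" for i
  have g: "cis (g (int i)) = xs ! (i mod p)" if "i \<le> p" for i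
    using that
  proof (induction i)
    case 0
    show ?case using norm[OF p] complex_norm_eq_1_exp[of "xs ! 0"] by (simp add: g_def cis_conv_exp)
  next
    case (Suc i)
    then have i: "i < p" by simp
    have "nat (int (Suc i)) = Suc i" by (rule nat_int)
    then have "g (int (Suc i)) = g (int i) + \<alpha> i" unfolding g_def by simp
    then have "cis (g (int (Suc i))) = cis (g (int i)) * cis (\<alpha> i)" by (simp add: cis_mult)
    also have "\<dots> = xs ! i * (xs ! next_index p i / xs ! i)" using Suc i \<alpha>(1)[OF i] by simp
    also have "\<dots> = xs ! next_index p i" using norm[OF i] by (cases "xs ! i = 0") auto
    finally show ?case by (simp add: next_index_def)
  qed
  \<comment> \<open>Once round the list the angles close up modulo full turns, and the number of
    turns is the winding number.\<close>
  have "cis (g (int p)) = cis (g 0)" using g[of p] g[of 0] by simp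
  then obtain k :: int where k: "g (int p) = g 0 + 2 * pi * k" by (auto simp: cis_eq_cis_iff)
  define \<theta> where "\<theta> = extend p k g"
  have qp: "quasi_periodic p k \<theta>" unfolding \<theta>_def by (rule quasi_periodic_extend[OF p])
  have "\<theta> (0 + int p) = \<theta> 0 + 2 * pi * of_int k" using qp unfolding quasi_periodic_def by blast
  then have \<theta>p: "\<theta> (int p) = g (int p)" using k p by (simp add: \<theta>_def extend_eq)
  have \<theta>: "\<theta> i = g i" if "0 \<le> i" "i \<le> int p" for i
    using that \<theta>p by (cases "i = int p") (auto simp: \<theta>_def extend_eq)
  have "\<theta> \<in> open_lifts p k"
  proof (rule open_liftsI[OF qp p])
    fix i assume i: "0 \<le> i" "i < int p"
    then have "nat (i + 1) = Suc (nat i)" by simp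
    then have "g (i + 1) = g i + \<alpha> (nat i)" by (simp add: g_def)
    then show "\<theta> i < \<theta> (i + 1) \<and> \<theta> (i + 1) < \<theta> i + 2 * pi"
      using \<theta>[of i] \<theta>[of "i + 1"] i \<alpha>(2,3)[of "nat i"] by (simp add: nat_less_iff)
  qed
  moreover have "points p \<theta> = xs"
    using g \<theta> len by (intro nth_equalityI) auto
  ultimately show ?thesis using that by blast
qed

lemma open_lifts_winding:
  assumes "\<theta> \<in> open_lifts p k" "0 < p" shows "1 \<le> k" "k < int p"
proof -
  have S: "(\<Sum>i<p. \<theta> (int i + 1) - \<theta> (int i)) = 2 * pi * of_int k"
  proof -
    have "\<theta> (0 + int p) = \<theta> 0 + 2 * pi * of_int k"
      using assms(1) unfolding open_lifts_def quasi_periodic_def by blast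
    then show ?thesis by (simp add: sum_telescope_int)
  qed
  have d: "0 < \<theta> (i + 1) - \<theta> i" "\<theta> (i + 1) - \<theta> i < 2 * pi" for i
    using assms(1) by (auto simp: open_lifts_def algebra_simps)
  have "0 < (\<Sum>i<p. \<theta> (int i + 1) - \<theta> (int i))"
    using assms(2) d(1) by (intro sum_pos) auto
  then have "0 < 2 * pi * real_of_int k" using S by simp
  then have "0 < k" by (simp add: zero_less_mult_iff)
  then show "1 \<le> k" by simp
  have "(\<Sum>i<p. \<theta> (int i + 1) - \<theta> (int i)) < (\<Sum>i<p. 2 * pi)"
    using assms(2) d(2) by (intro sum_strict_mono) auto
  then have "2 * pi * real_of_int k < 2 * pi * real p" using S by (simp add: mult.commute)
  then have "real_of_int k < real p" by (simp add: mult_less_cancel_left_pos)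
  then show "k < int p" by linarith
qed

text \<open>The points determine every step modulo \<open>2 * pi\<close>, and a step strictly
  between 0 and \<open>2 * pi\<close> is then determined; the steps add up to the winding
  number.\<close>

lemma points_eq_imp_winding_eq:
  assumes \<theta>: "\<theta> \<in> open_lifts p k" and \<xi>: "\<xi> \<in> open_lifts p l" and p: "0 < p"
    and eq: "points p \<theta> = points p \<xi>"
  shows "k = l"
proof -
  have qp: "quasi_periodic p k \<theta>" "quasi_periodic p l \<xi>" using \<theta> \<xi> by (auto simp: open_lifts_def)
  have cis: "cis (\<theta> i) = cis (\<xi> i)" for i
  proof -
    have lt: "nat (i mod int p) < p" "int (nat (i mod int p)) = i mod int p" using p by (auto simp: nat_less_iff)
    have "cis (\<theta> (i mod int p)) = cis (\<xi> (i mod int p))"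
      using arg_cong[OF eq, of "\<lambda>xs. xs ! nat (i mod int p)"] lt by simp
    then show ?thesis by (simp add: cis_quasi_periodic_mod[OF qp(1)] cis_quasi_periodic_mod[OF qp(2)])
  qed
  have "\<theta> (i + 1) - \<theta> i = \<xi> (i + 1) - \<xi> i" for i
  proof -
    have b: "\<theta> i < \<theta> (i + 1) \<and> \<theta> (i + 1) < \<theta> i + 2 * pi" "\<xi> i < \<xi> (i + 1) \<and> \<xi> (i + 1) < \<xi> i + 2 * pi"
      using \<theta> \<xi> unfolding open_lifts_def by blast+
    obtain m m' :: int where m: "\<theta> i = \<xi> i + 2 * pi * m" "\<theta> (i + 1) = \<xi> (i + 1) + 2 * pi * m'"
      using cis[of i] cis[of "i + 1"] unfolding cis_eq_cis_iff by blast
    have "\<bar>2 * pi * real_of_int (m' - m)\<bar> < 2 * pi * 1"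
      using b m by (simp add: algebra_simps abs_less_iff)
    then have "m' = m" by (simp add: abs_mult) 
    then show ?thesis using m by simp
  qed
  then have "(\<Sum>i<p. \<theta> (int i + 1) - \<theta> (int i)) = (\<Sum>i<p. \<xi> (int i + 1) - \<xi> (int i))" by simp
  moreover have "\<theta> (0 + int p) = \<theta> 0 + 2 * pi * of_int k" "\<xi> (0 + int p) = \<xi> 0 + 2 * pi * of_int l"
    using qp unfolding quasi_periodic_def by blast+
  ultimately show ?thesis by (simp add: sum_telescope_int)
qed

lemma rotate1_points:
  assumes "quasi_periodic p k \<theta>" "0 < p" shows "rotate1 (points p \<theta>) = points p (shift \<theta>)"
proof (rule nth_equalityI)
  fix i assume "i < length (rotate1 (points p \<theta>))"
  then have i: "i < p" by simp
  have "rotate1 (points p \<theta>) ! i = points p \<theta> ! next_index p i"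
    using i by (simp add: nth_rotate1 next_index_def)
  then show "rotate1 (points p \<theta>) ! i = points p (shift \<theta>) ! i"
    using points_next[OF assms] i by (simp add: shift_def)
qed simp

text \<open>The reversed list starts with vertex p - 1, which is vertex -1 of the lift, whereas
  \<open>reverse\<close> starts with vertex 0. The additional \<open>shift\<close> accounts for
  this.\<close>

lemma rev_points:
  assumes "quasi_periodic p k \<theta>" shows "rev (points p \<theta>) = points p (shift (reverse \<theta>))"
proof (rule nth_equalityI)
  fix i assume "i < length (rev (points p \<theta>))"
  then have i: "i < p" by simp
  then have e: "int (p - Suc i) = (- int i - 1) + int p" by auto
  have "\<theta> (int (p - Suc i)) = \<theta> (- int i - 1) + 2 * pi * of_int k"
    using assms unfolding e quasi_periodic_def by blast
  then have "rev (points p \<theta>) ! i = cis (\<theta> (- int i - 1))"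
    using i by (simp add: rev_nth cis_add_2pi_int)
  also have "\<dots> = cis (\<theta> (- int i - 1) + 2 * pi * of_int (int i + 1))"
    by (simp only: cis_add_2pi_int)
  finally show "rev (points p \<theta>) ! i = points p (shift (reverse \<theta>)) ! i"
    using i by (simp add: shift_def reverse_def)
qed simp

text \<open>Supplies the two invariants that separate orbits: the length, and the winding number up
  to exchanging \<open>k\<close> and \<open>int p - k\<close>.\<close>

lemma (in closed_curve) orbit_points:
  assumes "ys \<in> dihedral_orbit (points p \<theta>)" "\<theta> \<in> open_lifts p k" "0 < p"
  shows "\<exists>l\<in>{k, int p - k}. \<exists>\<xi>\<in>open_lifts p l. ys = points p \<xi> \<and> len p \<xi> = len p \<theta>"
  using assms(1)
proof induction
  case base
  then show ?case using assms by blast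
next
  case (rotation ys)
  then obtain l \<xi> where l: "l \<in> {k, int p - k}" "\<xi> \<in> open_lifts p l" "ys = points p \<xi>" "len p \<xi> = len p \<theta>" by blast
  have qp: "quasi_periodic p l \<xi>" using l(2) by (simp add: open_lifts_def)
  have "rotate1 ys = points p (shift \<xi>)" using rotate1_points[OF qp assms(3)] l(3) by simp
  then show ?case using l shift_open[OF l(2)] len_shift[OF qp] by force
next
  case (reflection ys)
  then obtain l \<xi> where l: "l \<in> {k, int p - k}" "\<xi> \<in> open_lifts p l" "ys = points p \<xi>" "len p \<xi> = len p \<theta>" by blast
  have qp: "quasi_periodic p l \<xi>" using l(2) by (simp add: open_lifts_def)
  have "rev ys = points p (shift (reverse \<xi>))" using rev_points[OF qp] l(3) by simp
  moreover have "shift (reverse \<xi>) \<in> open_lifts p (int p - l)" by (intro shift_open reverse_open l)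
  moreover have "len p (shift (reverse \<xi>)) = len p \<theta>"
    using len_shift[OF quasi_periodic_reverse[OF qp]] len_reverse[OF qp] l(4) by simp
  moreover have "int p - l \<in> {k, int p - k}" using l(1) by auto
  ultimately show ?case by blast
qed

lemma finite_dihedral_orbit: "finite (dihedral_orbit xs)"
proof -
  have "ys \<in> {ys. set ys \<subseteq> set xs \<and> length ys = length xs}" if "ys \<in> dihedral_orbit xs" for ys
    using that by induction auto
  then show ?thesis
    using finite_lists_length_eq[of "set xs" "length xs"] finite_subset[of "dihedral_orbit xs"] by blast
qed

lemma smooth_embedding_closed_curve:
  assumes "smooth_embedding n e"
  shows "closed_curve n (\<lambda>t. e (cis t)) (\<lambda>t. velocity e (cis t))"
proof
  have smooth: "smooth_real (\<lambda>t. e (cis t) k)" if "k < n" for k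
    using assms that by (simp add: smooth_embedding_def)
  have vel: "velocity e (cis t) k = deriv (\<lambda>t. e (cis t) k) t" if "k < n" for k t
  proof -
    have "((\<lambda>t. e (cis t) k) has_real_derivative deriv (\<lambda>t. e (cis t) k) t) (at t)"
      using smooth[OF that] unfolding smooth_real_def
      by (metis DERIV_deriv_iff_field_differentiable funpow_0)
    then have "((\<lambda>s. e (cis (t + s)) k) has_real_derivative deriv (\<lambda>t. e (cis t) k) t) (at 0)"
      using DERIV_shift[of "\<lambda>t. e (cis t) k" _ 0 t] by (simp add: add.commute)
    then show ?thesis by (simp add: velocity_def cis_mult DERIV_imp_deriv)
  qed
  show "((\<lambda>t. e (cis t) k) has_real_derivative velocity e (cis t) k) (at t)" if "k < n" for k t
    using smooth[OF that] unfolding smooth_real_def vel[OF that]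
    by (metis DERIV_deriv_iff_field_differentiable funpow_0)
  show "continuous_on UNIV (\<lambda>t. velocity e (cis t) k)" if "k < n" for k
  proof -
    have "(deriv ^^ 1) (\<lambda>t. e (cis t) k) field_differentiable at t" for t
      using smooth[OF that] unfolding smooth_real_def by blast
    then show ?thesis
      by (auto simp: vel[OF that] continuous_on_eq_continuous_at field_differentiable_imp_continuous_at)
  qed
  show "e (cis (t + 2 * pi)) k = e (cis t) k" for t k
    using cis_add_2pi_int[of t 1] by simp
  show "\<exists>k<n. velocity e (cis t) k \<noteq> 0" for t
    using assms by (simp add: smooth_embedding_def)
  fix s t assume eq: "\<And>k. k < n \<Longrightarrow> e (cis s) k = e (cis t) k"
  have emb: "embedding_map (top_of_set (sphere 0 1)) (Euclidean_space n) e"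
    using assms by (simp add: smooth_embedding_def)
  then have hom: "homeomorphic_map (top_of_set (sphere 0 1)) (subtopology (Euclidean_space n) (e ` sphere 0 1)) e"
    by (simp add: embedding_map_def)
  then have inj: "inj_on e (sphere 0 1)"
    using homeomorphic_imp_injective_map by fastforce
  \<comment> \<open>Points of \<open>Euclidean_space n\<close> vanish at all indices from
    \<open>n\<close> on, so agreement in the first \<open>n\<close> coordinates is equality and
    injectivity of \<open>e\<close> applies.\<close>
  have "e z \<in> topspace (Euclidean_space n)" if "z \<in> sphere 0 1" for z
    using homeomorphic_imp_surjective_map[OF hom] that by (auto simp: topspace_subtopology)
  then have "e (cis t) k = 0" if "n \<le> k" for k t using that by (simp add: topspace_Euclidean_space)
  then have "e (cis s) k = e (cis t) k" for k using eq by (cases "k < n") auto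
  then have "cis s = cis t" by (intro inj_onD[OF inj]) auto
  then obtain m :: int where "t = s + 2 * pi * m" by (metis cis_eq_cis_iff)
  then show "\<exists>m::int. t - s = 2 * pi * m" by auto
qed

locale embedded_circle =
  fixes n :: nat and e :: "complex \<Rightarrow> nat \<Rightarrow> real"
  assumes emb: "smooth_embedding n e"
begin

sublocale closed_curve n "\<lambda>t. e (cis t)" "\<lambda>t. velocity e (cis t)"
  using emb by (rule smooth_embedding_closed_curve)

lemma length_function_points:
  assumes "quasi_periodic p k \<theta>" "0 < p"
  shows "length_function n e (points p \<theta>) = len p \<theta>"
  unfolding length_function_def len_def D_def norm_n_def
  by (simp add: points_next[OF assms])

text \<open>Paired with the velocity, the two unit vectors of the reflection law are the two terms
  of \<open>grad\<close>, and the tangent space is the line spanned by the velocity.\<close>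

lemma points_trajectory_iff:
  assumes \<theta>: "\<theta> \<in> open_lifts p k" and p: "0 < p"
  shows "points p \<theta> \<in> billiard_trajectories p n e \<longleftrightarrow> critical \<theta>"
proof -
  have qp: "quasi_periodic p k \<theta>" using \<theta> by (simp add: open_lifts_def)
  have inner: "inner_n n (\<lambda>k. unit_diff n (e (points p \<theta> ! i)) (e (points p \<theta> ! next_index p i)) k
        + unit_diff n (e (points p \<theta> ! i)) (e (points p \<theta> ! prev_index p i)) k)
        (\<lambda>k. r * velocity e (points p \<theta> ! i) k) = r * grad \<theta> (int i)" if "i < p" for i r
    unfolding grad_def D1_def D_def inner_n_def unit_diff_def norm_n_def
      points_next[OF qp p] points_prev[OF qp p] nth_points[OF that]
    by (simp add: sum_distrib_left sum_divide_distrib sum.distrib[symmetric] algebra_simps)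
  have "points p \<theta> \<in> billiard_trajectories p n e \<longleftrightarrow> (\<forall>i<p. \<forall>r. r * grad \<theta> (int i) = 0)"
  proof -
    have "(\<forall>v\<in>tangent_space e x. inner_n n w v = 0) \<longleftrightarrow> (\<forall>r. inner_n n w (\<lambda>k. r * velocity e x k) = 0)" for x w
      unfolding tangent_space_def by auto
    then show ?thesis
      using points_admissible[OF \<theta> p] inner unfolding billiard_trajectories_def by simp
  qed
  also have "\<dots> \<longleftrightarrow> (\<forall>i<p. grad \<theta> (int i) = 0)"
    by (metis mult_1 mult_zero_right)
  also have "\<dots> \<longleftrightarrow> critical \<theta>"
  proof
    assume z: "\<forall>i<p. grad \<theta> (int i) = 0"
    show "critical \<theta>"
      unfolding critical_def
    proof
      fix i
      have "nat (i mod int p) < p" using p by (simp add: nat_less_iff)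
      then have "grad \<theta> (int (nat (i mod int p))) = 0" using z by blast
      then show "grad \<theta> i = 0" using grad_mod[OF qp, of i] p by simp
    qed
  qed (simp add: critical_def)
  finally show ?thesis .
qed

text \<open>With infinitely many orbits \<open>ecard\<close> is infinite. Otherwise, writing p = 2 h
  + 1, each k in {1..h} yields two critical lifts. The orbit of one of them determines k through the
  winding number, up to exchanging k and p - k, and then tells the two apart by length.\<close>

lemma trajectory_count_ge:
  assumes p: "odd p" "3 \<le> p"
  shows "enat (p - 1) \<le> trajectory_count p n e"
proof (cases "finite (dihedral_orbit ` billiard_trajectories p n e)")
  case True
  let ?B = "billiard_trajectories p n e" let ?A = "dihedral_orbit ` ?B"
  have "?B \<subseteq> \<Union> ?A" using dihedral_orbit.base by blast
  moreover have "finite (\<Union> ?A)" using True finite_dihedral_orbit by blast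
  ultimately have finB: "finite ?B" by (rule finite_subset)
  \<comment> \<open>Finitely many orbits, each finite, have only finitely many vertices altogether;
    this is the finite set required by \<open>two_critical_levels\<close>.\<close>
  define Z where "Z = (\<Union>xs\<in>?B. set xs)"
  have finZ: "finite Z" unfolding Z_def using finB by simp
  have Z: "cis (\<theta> i) \<in> Z" if \<theta>: "\<theta> \<in> open_lifts p k" "critical \<theta>" for \<theta> k i
  proof -
    have qp: "quasi_periodic p k \<theta>" using \<theta> by (simp add: open_lifts_def)
    have "points p \<theta> \<in> ?B" using points_trajectory_iff[OF \<theta>(1)] \<theta>(2) p by simp
    moreover have "nat (i mod int p) < p" "int (nat (i mod int p)) = i mod int p" using p by (auto simp: nat_less_iff)
    then have "points p \<theta> ! nat (i mod int p) = cis (\<theta> i)"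
      using cis_quasi_periodic_mod[OF qp, of i] by simp
    then have "cis (\<theta> i) \<in> set (points p \<theta>)"
      using \<open>nat (i mod int p) < p\<close> by (metis length_points nth_mem)
    ultimately show ?thesis unfolding Z_def by blast
  qed
  define h where "h = (p - 1) div 2"
  have h: "p = 2 * h + 1" "1 \<le> h" using p by (auto simp: h_def elim!: oddE)
  have ex: "\<exists>l \<theta> \<xi>. l \<in> {int k, int p - int k} \<and> \<theta> \<in> open_lifts p l \<and> \<xi> \<in> open_lifts p l
     \<and> critical \<theta> \<and> critical \<xi> \<and> len p \<theta> \<noteq> len p \<xi>" if k: "k \<in> {1..h}" for k
  proof -
    \<comment> \<open>The auxiliary polygons have N = p - 1 = 2 h vertices, so that
      \<open>N + 1 - k\<close> is p - k.\<close>
    have "\<exists>k'\<in>{int k, int (2 * h) + 1 - int k}. \<exists>Y. dominating (2 * h) k' Y"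
      using k by (intro ex_dominating) auto
    then obtain l Y where l: "l \<in> {int k, int (2 * h) + 1 - int k}" "dominating (2 * h) l Y" by blast
    have "1 \<le> l" "l \<le> int (2 * h)" using l(1) k by auto
    then have "\<exists>\<theta>\<in>open_lifts (Suc (2 * h)) l. \<exists>\<xi>\<in>open_lifts (Suc (2 * h)) l.
      critical \<theta> \<and> critical \<xi> \<and> len (Suc (2 * h)) \<theta> \<noteq> len (Suc (2 * h)) \<xi>"
      using l(2) h Z finZ by (intro two_critical_levels[where Z = Z]) auto
    moreover have pS: "Suc (2 * h) = p" "int (2 * h) + 1 - int k = int p - int k" using h by auto
    ultimately obtain \<theta> \<xi> where "\<theta> \<in> open_lifts p l" "\<xi> \<in> open_lifts p l" "critical \<theta>" "critical \<xi>"
      "len p \<theta> \<noteq> len p \<xi>" by auto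
    then show ?thesis using l(1) unfolding pS(2) by blast
  qed
  define P where "P k x = (fst x \<in> {int k, int p - int k} \<and> fst (snd x) \<in> open_lifts p (fst x)
     \<and> snd (snd x) \<in> open_lifts p (fst x) \<and> critical (fst (snd x)) \<and> critical (snd (snd x))
     \<and> len p (fst (snd x)) \<noteq> len p (snd (snd x)))" for k x
  define F where "F k = (SOME x. P k x)" for k
  define K where "K k = fst (F k)" for k
  define G where "G k b = (if b then fst (snd (F k)) else snd (snd (F k)))" for k and b :: bool
  have F: "P k (F k)" if k: "k \<in> {1..h}" for k
  proof -
    obtain l \<theta> \<xi> where "l \<in> {int k, int p - int k} \<and> \<theta> \<in> open_lifts p l \<and> \<xi> \<in> open_lifts p l
     \<and> critical \<theta> \<and> critical \<xi> \<and> len p \<theta> \<noteq> len p \<xi>" using ex[OF k] by blast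
    then have "P k (l, \<theta>, \<xi>)" by (simp add: P_def)
    then show ?thesis unfolding F_def by (rule someI[of "P k"])
  qed
  have G: "K k \<in> {int k, int p - int k}" "G k b \<in> open_lifts p (K k)" "critical (G k b)"
    "len p (G k True) \<noteq> len p (G k False)" if k: "k \<in> {1..h}" for k b
    using F[OF k] by (simp_all add: P_def K_def G_def)
  define \<Phi> where "\<Phi> = (\<lambda>(k, b). dihedral_orbit (points p (G k b)))"
  have "inj_on \<Phi> ({1..h} \<times> UNIV)"
  proof (rule inj_onI, clarsimp simp del: One_nat_def)
    fix k b k' b' assume k: "1 \<le> k" "k \<le> h" "1 \<le> k'" "k' \<le> h" and eq: "\<Phi> (k, b) = \<Phi> (k', b')"
    have kk: "k \<in> {1..h}" "k' \<in> {1..h}" using k by auto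
    have "points p (G k b) \<in> dihedral_orbit (points p (G k' b'))"
      using eq dihedral_orbit.base[of "points p (G k b)"] by (simp add: \<Phi>_def)
    from orbit_points[OF this G(2)[OF kk(2)]] p obtain l \<xi> where
      l: "l \<in> {K k', int p - K k'}" "\<xi> \<in> open_lifts p l" "points p (G k b) = points p \<xi>" "len p \<xi> = len p (G k' b')"
      by auto
    have "K k = l" using points_eq_imp_winding_eq[OF G(2)[OF kk(1)] l(2) _ l(3)] p by simp
    then have "K k \<in> {int k', int p - int k'}" using l(1) G(1)[OF kk(2)] by auto
    then have "k = k'" using G(1)[OF kk(1)] k h by auto
    moreover have "len p (G k b) = len p \<xi>"
      using length_function_points[of p "K k" "G k b"] length_function_points[of p l \<xi>] G(2)[OF kk(1)] l(2,3) p
      by (simp add: open_lifts_def)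
    ultimately have "len p (G k b) = len p (G k b')" using l(4) by simp
    then have "b = b'" using G(4)[OF kk(1)] by (cases b; cases b') auto
    then show "k = k' \<and> b = b'" using \<open>k = k'\<close> by simp
  qed
  then have "card (\<Phi> ` ({1..h} \<times> UNIV)) = card ({1..h} \<times> (UNIV :: bool set))" by (rule card_image)
  also have "\<dots> = p - 1" using h by (simp add: card_cartesian_product)
  finally have "p - 1 = card (\<Phi> ` ({1..h} \<times> UNIV))" ..
  also have "\<dots> \<le> card ?A"
  proof (rule card_mono[OF True])
    have "points p (G k b) \<in> ?B" if "k \<in> {1..h}" for k b
      using points_trajectory_iff[OF G(2)[OF that]] G(3)[OF that] p by simp
    then show "\<Phi> ` ({1..h} \<times> UNIV) \<subseteq> ?A" by (auto simp: \<Phi>_def)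
  qed
  finally show ?thesis using True by (simp add: trajectory_count_def ecard_def)
qed (simp add: trajectory_count_def ecard_def)

end

subsection \<open>The Hessian\<close>

definition residue_indicator :: "nat \<Rightarrow> nat \<Rightarrow> int \<Rightarrow> real" where
  "residue_indicator p j i = (if i mod int p = int j then 1 else 0)"

lemma residue_indicator_periodic: "residue_indicator p j (i + int p) = residue_indicator p j i"
  by (simp add: residue_indicator_def)

lemma sum_residue_indicator:
  assumes "0 < p"
  shows "(\<Sum>j<p. f j * residue_indicator p j i) = f (nat (i mod int p))"
proof -
  have "(\<Sum>j<p. f j * residue_indicator p j i) = (\<Sum>j<p. if j = nat (i mod int p) then f j else 0)"
  proof (rule sum.cong)
    fix j assume "j \<in> {..<p}"
    have "i mod int p = int j \<longleftrightarrow> j = nat (i mod int p)" using assms by auto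
    then show "f j * residue_indicator p j i = (if j = nat (i mod int p) then f j else 0)"
      by (simp add: residue_indicator_def)
  qed simp
  also have "\<dots> = f (nat (i mod int p))" using assms by (simp add: nat_less_iff)
  finally show ?thesis .
qed

locale closed_curve_C2 = closed_curve +
  fixes ddc :: "real \<Rightarrow> nat \<Rightarrow> real"
  assumes deriv_dc: "k < n \<Longrightarrow> ((\<lambda>t. dc t k) has_real_derivative ddc t k) (at t)"
begin

text \<open>The coefficients are quantified before the direction: what matters later is that the
  derivative is linear in \<open>(a, b)\<close>, not the values of \<open>P\<close> and
  \<open>Q\<close>.\<close>

lemma has_derivative_D1:
  assumes "D s t \<noteq> 0"
  shows "\<exists>P Q. \<forall>a b. ((\<lambda>x. D1 (s + x * a) (t + x * b)) has_real_derivative a * P + b * Q) (at 0)"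
proof -
  define I where "I = (\<Sum>k<n. (c s k - c t k) * dc s k)"
  define P1 where "P1 = (\<Sum>k<n. (c s k - c t k) * ddc s k + dc s k * dc s k)"
  define Q1 where "Q1 = (\<Sum>k<n. - dc t k * dc s k)"
  define P where "P = (P1 * D s t - I * D1 s t) / (D s t)\<^sup>2"
  define Q where "Q = (Q1 * D s t - I * D1 t s) / (D s t)\<^sup>2"
  have "((\<lambda>x. D1 (s + x * a) (t + x * b)) has_real_derivative a * P + b * Q) (at 0)" for a b
  proof -
    have s: "((\<lambda>x. s + x * a) has_real_derivative a) (at 0)" and t: "((\<lambda>x. t + x * b) has_real_derivative b) (at 0)"
      by (auto intro!: derivative_eq_intros)
    have cs: "((\<lambda>x. c (s + x * a) k) has_real_derivative dc s k * a) (at 0)" if "k < n" for k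
      using DERIV_chain2[OF deriv_c[OF that, of "s + 0 * a"] s] by simp
    have ct: "((\<lambda>x. c (t + x * b) k) has_real_derivative dc t k * b) (at 0)" if "k < n" for k
      using DERIV_chain2[OF deriv_c[OF that, of "t + 0 * b"] t] by simp
    have ds: "((\<lambda>x. dc (s + x * a) k) has_real_derivative ddc s k * a) (at 0)" if "k < n" for k
      using DERIV_chain2[OF deriv_dc[OF that, of "s + 0 * a"] s] by simp
    have "((\<lambda>x. \<Sum>k<n. (c (s + x * a) k - c (t + x * b) k) * dc (s + x * a) k) has_real_derivative
        (\<Sum>k<n. (c (s + 0 * a) k - c (t + 0 * b) k) * (ddc s k * a) + (dc s k * a - dc t k * b) * dc (s + 0 * a) k)) (at 0)"
      by (intro DERIV_sum DERIV_mult' DERIV_diff cs ct ds) auto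
    moreover have "(\<Sum>k<n. (c (s + 0 * a) k - c (t + 0 * b) k) * (ddc s k * a) + (dc s k * a - dc t k * b) * dc (s + 0 * a) k)
        = a * P1 + b * Q1"
      by (simp add: P1_def Q1_def sum_distrib_left sum.distrib[symmetric] algebra_simps)
    ultimately have num: "((\<lambda>x. \<Sum>k<n. (c (s + x * a) k - c (t + x * b) k) * dc (s + x * a) k) has_real_derivative
        a * P1 + b * Q1) (at 0)" by simp
    have den: "((\<lambda>x. D (s + x * a) (t + x * b)) has_real_derivative a * D1 s t + b * D1 t s) (at 0)"
      using has_derivative_D[OF s t] assms by simp
    have "((\<lambda>x. D1 (s + x * a) (t + x * b)) has_real_derivative
       ((a * P1 + b * Q1) * D (s + 0 * a) (t + 0 * b) - (\<Sum>k<n. (c (s + 0 * a) k - c (t + 0 * b) k) * dc (s + 0 * a) k) * (a * D1 s t + b * D1 t s))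
        / (D (s + 0 * a) (t + 0 * b) * D (s + 0 * a) (t + 0 * b))) (at 0)"
      unfolding D1_def[of "s + _ * a"] by (rule DERIV_divide[OF num den]) (use assms in simp)
    moreover have "((a * P1 + b * Q1) * d - I * (a * x + b * y)) / (d * d)
        = a * ((P1 * d - I * x) / d\<^sup>2) + b * ((Q1 * d - I * y) / d\<^sup>2)" for d x y :: real
      by (simp add: power2_eq_square add_divide_distrib diff_divide_distrib algebra_simps)
    ultimately show ?thesis by (simp add: P_def Q_def I_def)
  qed
  then show ?thesis by blast
qed

definition grad_deriv :: "(int \<Rightarrow> real) \<Rightarrow> int \<Rightarrow> (int \<Rightarrow> real) \<Rightarrow> real" where
  "grad_deriv \<theta> j v = deriv (\<lambda>x. grad (\<lambda>i. \<theta> i + x * v i) j) 0"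

lemma grad_deriv:
  assumes \<theta>: "\<theta> \<in> open_lifts p k"
  shows "((\<lambda>x. grad (\<lambda>i. \<theta> i + x * v i) j) has_real_derivative grad_deriv \<theta> j v) (at 0)"
    and "\<exists>A B C. \<forall>v. grad_deriv \<theta> j v = v (j - 1) * A + v j * B + v (j + 1) * C"
proof -
  have nz: "D (\<theta> j) (\<theta> (j + 1)) \<noteq> 0" "D (\<theta> j) (\<theta> (j - 1)) \<noteq> 0"
    using D_open_lifts[OF \<theta>, of j] by auto
  obtain P Q where PQ: "\<And>a b. ((\<lambda>x. D1 (\<theta> j + x * a) (\<theta> (j + 1) + x * b)) has_real_derivative a * P + b * Q) (at 0)"
    using has_derivative_D1[OF nz(1)] by blast
  obtain P' Q' where PQ': "\<And>a b. ((\<lambda>x. D1 (\<theta> j + x * a) (\<theta> (j - 1) + x * b)) has_real_derivative a * P' + b * Q') (at 0)"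
    using has_derivative_D1[OF nz(2)] by blast
  have d: "((\<lambda>x. grad (\<lambda>i. \<theta> i + x * v i) j) has_real_derivative
      (v j * P + v (j + 1) * Q) + (v j * P' + v (j - 1) * Q')) (at 0)" for v
    unfolding grad_def by (intro DERIV_add PQ PQ')
  then have e: "grad_deriv \<theta> j v = (v j * P + v (j + 1) * Q) + (v j * P' + v (j - 1) * Q')" for v
    unfolding grad_deriv_def by (rule DERIV_imp_deriv)
  show "((\<lambda>x. grad (\<lambda>i. \<theta> i + x * v i) j) has_real_derivative grad_deriv \<theta> j v) (at 0)"
    using d e by simp
  show "\<exists>A B C. \<forall>v. grad_deriv \<theta> j v = v (j - 1) * A + v j * B + v (j + 1) * C"
    by (intro exI[of _ Q'] exI[of _ "P + P'"] exI[of _ Q]) (simp add: e algebra_simps)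
qed

text \<open>A component of the gradient depends linearly on the variations of three neighbouring
  vertices, so coordinate directions combine to an arbitrary periodic one.\<close>

lemma grad_deriv_sum:
  assumes \<theta>: "\<theta> \<in> open_lifts p k" and p: "0 < p"
  shows "(\<Sum>i<p. f i * grad_deriv \<theta> j (residue_indicator p i)) = grad_deriv \<theta> j (\<lambda>l. f (nat (l mod int p)))"
proof -
  obtain A B C where ABC: "\<And>v. grad_deriv \<theta> j v = v (j - 1) * A + v j * B + v (j + 1) * C"
    using grad_deriv(2)[OF \<theta>] by blast
  have "(\<Sum>i<p. f i * grad_deriv \<theta> j (residue_indicator p i))
      = (\<Sum>i<p. f i * residue_indicator p i (j - 1)) * A + (\<Sum>i<p. f i * residue_indicator p i j) * B
        + (\<Sum>i<p. f i * residue_indicator p i (j + 1)) * C"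
    by (simp add: ABC sum.distrib sum_distrib_left sum_distrib_right algebra_simps)
  then show ?thesis by (simp only: sum_residue_indicator[OF p] ABC)
qed

end

locale embedded_circle_C2 = embedded_circle +
  fixes ddc :: "real \<Rightarrow> nat \<Rightarrow> real"
  assumes deriv_velocity: "k < n \<Longrightarrow> ((\<lambda>t. velocity e (cis t) k) has_real_derivative ddc t k) (at t)"
begin

sublocale closed_curve_C2 n "\<lambda>t. e (cis t)" "\<lambda>t. velocity e (cis t)" ddc
  by unfold_locales (rule deriv_velocity)

lemma local_length_points:
  assumes \<theta>: "\<theta> \<in> open_lifts p k" and p: "0 < p"
  shows "local_length n e (points p \<theta>) s = len p (\<lambda>i. \<theta> i + s (nat (i mod int p)))"
proof -
  let ?\<xi> = "\<lambda>i. \<theta> i + s (nat (i mod int p))"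
  have qp: "quasi_periodic p k ?\<xi>" using \<theta> by (simp add: open_lifts_def quasi_periodic_def)
  have "map (\<lambda>i. points p \<theta> ! i * cis (s i)) [0..<length (points p \<theta>)] = points p ?\<xi>"
    by (rule nth_equalityI) (simp_all add: cis_mult)
  then show ?thesis using length_function_points[OF qp p] by (simp add: local_length_def)
qed

lemma partial_deriv_local_length:
  assumes \<theta>: "\<theta> \<in> open_lifts p k" and p: "0 < p" and j: "j < p"
    and s: "(\<lambda>i. \<theta> i + s (nat (i mod int p))) \<in> open_lifts p k"
  shows "partial_deriv j (local_length n e (points p \<theta>)) s = grad (\<lambda>i. \<theta> i + s (nat (i mod int p))) (int j)"
proof -
  define \<xi> where "\<xi> = (\<lambda>i. \<theta> i + s (nat (i mod int p)))"
  let ?a = "residue_indicator p j"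
  have qp: "quasi_periodic p k \<xi>" using s by (simp add: \<xi>_def open_lifts_def)
  have "((\<lambda>x. len p (\<lambda>i. \<xi> i + x * ?a i)) has_real_derivative
     (\<Sum>i<p. ?a (int i) * grad (\<lambda>i. \<xi> i + 0 * ?a i) (int i))) (at 0)"
    using D_open_lifts(1)[of \<xi> p k] s
    by (intro has_derivative_len[where a = ?a, OF qp residue_indicator_periodic]) (simp add: \<xi>_def less_imp_neq[symmetric])
  moreover have "(\<Sum>i<p. ?a (int i) * grad (\<lambda>i. \<xi> i + 0 * ?a i) (int i)) = (\<Sum>i<p. if i = j then grad \<xi> (int i) else 0)"
    by (intro sum.cong) (auto simp: residue_indicator_def)
  ultimately have "((\<lambda>x. len p (\<lambda>i. \<xi> i + x * ?a i)) has_real_derivative grad \<xi> (int j)) (at (s j - s j))"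
    using j by simp
  then have d: "((\<lambda>u. len p (\<lambda>i. \<xi> i + (u - s j) * ?a i)) has_real_derivative grad \<xi> (int j) * 1) (at (s j))"
    by (rule DERIV_chain2) (auto intro!: derivative_eq_intros)
  have "local_length n e (points p \<theta>) (s(j := u)) = len p (\<lambda>i. \<xi> i + (u - s j) * ?a i)" for u
  proof -
    have "\<theta> i + (s(j := u)) (nat (i mod int p)) = \<xi> i + (u - s j) * ?a i" for i
    proof -
      have "i mod int p = int j \<longleftrightarrow> nat (i mod int p) = j" using p by auto
      then show ?thesis by (auto simp: \<xi>_def residue_indicator_def)
    qed
    then show ?thesis by (simp only: local_length_points[OF \<theta> p])
  qed
  then show ?thesis
    using d by (simp add: partial_deriv_def \<xi>_def DERIV_imp_deriv)
qed

lemma critical_at_origin_imp_critical: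
  assumes \<theta>: "\<theta> \<in> open_lifts p k" and p: "0 < p"
    and crit: "critical_at_origin p (local_length n e (points p \<theta>))"
  shows "critical \<theta>"
proof (rule critical_if_sum_squares[OF _ p])
  show "quasi_periodic p k \<theta>" using \<theta> by (simp add: open_lifts_def)
  have "grad \<theta> (int j) = 0" if "j < p" for j
    using crit that partial_deriv_local_length[OF \<theta> p that, of "\<lambda>_. 0"] \<theta>
    by (simp add: critical_at_origin_def)
  then show "(\<Sum>i<p. grad \<theta> (int i) * grad \<theta> (int i)) \<le> 0" by simp
qed

lemma hessian_local_length:
  assumes \<theta>: "\<theta> \<in> open_lifts p k" and p: "0 < p" and ij: "i < p" "j < p"
  shows "hessian_at_origin (local_length n e (points p \<theta>)) i j = grad_deriv \<theta> (int j) (residue_indicator p i)"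
proof -
  let ?F = "local_length n e (points p \<theta>)"
  let ?g = "\<lambda>u. grad (\<lambda>l. \<theta> l + u * residue_indicator p i l) (int j)"
  obtain \<epsilon> where \<epsilon>: "\<epsilon> > 0" "\<And>x. \<bar>x\<bar> < \<epsilon> \<Longrightarrow> (\<lambda>l. \<theta> l + x * residue_indicator p i l) \<in> open_lifts p k"
    using open_lifts_line[where a = "residue_indicator p i", OF \<theta> residue_indicator_periodic p] by blast
  \<comment> \<open>The formula for the first derivative requires an open lift and so holds for
    small \<open>u\<close> only; equality near 0 is enough to differentiate once more.\<close>
  have "partial_deriv j ?F ((\<lambda>_. 0)(i := u)) = ?g u" if "\<bar>u\<bar> < \<epsilon>" for u
  proof -
    have eq: "\<theta> l + ((\<lambda>_. 0)(i := u)) (nat (l mod int p)) = \<theta> l + u * residue_indicator p i l" for l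
    proof -
      have "l mod int p = int i \<longleftrightarrow> nat (l mod int p) = i" using p by auto
      then show ?thesis by (auto simp: residue_indicator_def)
    qed
    show ?thesis
      using partial_deriv_local_length[OF \<theta> p ij(2), of "(\<lambda>_. 0)(i := u)"] \<epsilon>(2)[OF that] unfolding eq by blast
  qed
  then have "\<forall>\<^sub>F u in nhds 0. partial_deriv j ?F ((\<lambda>_. 0)(i := u)) = ?g u"
    using \<epsilon>(1) by (auto simp: eventually_nhds_metric dist_real_def)
  then have "deriv (\<lambda>u. partial_deriv j ?F ((\<lambda>_. 0)(i := u))) 0 = deriv ?g 0"
    by (rule deriv_cong_ev) simp
  then show ?thesis by (simp add: hessian_at_origin_def partial_deriv_def[of i] grad_deriv_def)
qed

text \<open>A criterion adapted to an almost rotation invariant function. Let v be in the kernel of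
  the Hessian. Pairing with the direction of simultaneous translation gives \<open>h\<close> times
  the sum of v, so v has mean zero; there the quadratic form is negative unless v vanishes.\<close>

lemma nondegenerate_if:
  assumes \<theta>: "\<theta> \<in> open_lifts p k" and p: "0 < p"
    and rot: "\<And>j. j < p \<Longrightarrow> grad_deriv \<theta> (int j) (\<lambda>_. 1) = h" "h \<noteq> 0"
    and neg: "\<And>v. (\<And>i. v (i + int p) = v i) \<Longrightarrow> (\<Sum>j<p. v (int j)) = 0 \<Longrightarrow>
       0 \<le> (\<Sum>j<p. v (int j) * grad_deriv \<theta> (int j) v) \<Longrightarrow> v = (\<lambda>_. 0)"
  shows "nondegenerate p (hessian_at_origin (local_length n e (points p \<theta>)))"
  unfolding nondegenerate_def
proof (intro allI impI)
  fix v :: "nat \<Rightarrow> real" and j0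
  let ?H = "hessian_at_origin (local_length n e (points p \<theta>))"
  assume z: "\<forall>i<p. (\<Sum>j<p. ?H i j * v j) = 0" and j0: "j0 < p"
  define w where "w l = v (nat (l mod int p))" for l
  \<comment> \<open>Summing the rows with weights f gives the derivative of the gradient in the
    direction f, paired with v. It is used for the constant f = 1 and for f = v.\<close>
  have H: "(\<Sum>i<p. f i * (\<Sum>j<p. ?H i j * v j)) = (\<Sum>j<p. v j * grad_deriv \<theta> (int j) (\<lambda>l. f (nat (l mod int p))))" for f
  proof -
    have "(\<Sum>i<p. f i * (\<Sum>j<p. ?H i j * v j)) = (\<Sum>i<p. \<Sum>j<p. v j * (f i * grad_deriv \<theta> (int j) (residue_indicator p i)))"
      by (simp add: sum_distrib_left hessian_local_length[OF \<theta> p] algebra_simps)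
    also have "\<dots> = (\<Sum>j<p. \<Sum>i<p. v j * (f i * grad_deriv \<theta> (int j) (residue_indicator p i)))"
      by (rule sum.swap)
    also have "\<dots> = (\<Sum>j<p. v j * grad_deriv \<theta> (int j) (\<lambda>l. f (nat (l mod int p))))"
      by (simp only: sum_distrib_left[symmetric] grad_deriv_sum[OF \<theta> p])
    finally show ?thesis .
  qed
  have "(\<Sum>j<p. v j * grad_deriv \<theta> (int j) (\<lambda>l. 1)) = 0"
    using H[of "\<lambda>_. 1"] z by simp
  then have "h * (\<Sum>j<p. v j) = 0"
    using rot(1) by (simp add: sum_distrib_left mult.commute)
  then have "(\<Sum>j<p. v j) = 0" using rot(2) by simp
  moreover have "(\<Sum>j<p. v j * grad_deriv \<theta> (int j) w) = 0"
    using H[of v] z unfolding w_def[abs_def] by simp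
  moreover have wv: "w (int j) = v j" if "j < p" for j using that by (simp add: w_def)
  ultimately have "w = (\<lambda>_. 0)"
    by (intro neg) (simp_all add: w_def)
  then show "v j0 = 0" using wv[OF j0] by simp
qed

end

subsection \<open>A wavy circle\<close>

lemma cis_minus_cis: "cis s - cis t = 2 * \<i> * of_real (sin ((s - t) / 2)) * cis ((s + t) / 2)"
proof -
  define x y where "x = (s + t) / 2" and "y = (s - t) / 2"
  have st: "s = x + y" "t = x - y" by (simp_all add: x_def y_def field_simps)
  show ?thesis
    unfolding x_def[symmetric] y_def[symmetric] unfolding st
    by (simp add: complex_eq_iff cos_add sin_add cos_diff sin_diff)
qed

lemma norm_cis_minus_cis: "norm (cis s - cis t) = 2 * \<bar>sin ((s - t) / 2)\<bar>"
  by (simp add: cis_minus_cis norm_mult)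

lemma norm_cis_minus_cis_le: "norm (cis s - cis t) \<le> \<bar>s - t\<bar>"
  using abs_sin_x_le_abs_x[of "(s - t) / 2"] by (simp add: norm_cis_minus_cis)

lemma norm_sgn_diff_le:
  fixes u v :: complex
  assumes "u \<noteq> 0" "v \<noteq> 0"
  shows "norm (sgn u - sgn v) \<le> 2 * norm (u - v) / norm u"
proof -
  have "sgn u - sgn v = (u - v) / of_real (norm u) + sgn v * of_real ((norm v - norm u) / norm u)"
    using assms by (simp add: sgn_eq field_simps)
  also have "norm \<dots> \<le> norm (u - v) / norm u + 1 * (\<bar>norm v - norm u\<bar> / norm u)"
    by (rule norm_triangle_le, rule add_mono)
      (use assms in \<open>simp_all only: norm_divide norm_mult norm_sgn norm_of_real abs_divide abs_norm_cancel if_False order_refl\<close>)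
  also have "\<dots> \<le> norm (u - v) / norm u + norm (u - v) / norm u"
  proof -
    have "\<bar>norm v - norm u\<bar> \<le> norm (u - v)" using norm_triangle_ineq3[of v u] by (simp add: norm_minus_commute)
    then have "\<bar>norm v - norm u\<bar> / norm u \<le> norm (u - v) / norm u" by (rule divide_right_mono) simp
    then show ?thesis by simp
  qed
  finally show ?thesis by simp
qed

text \<open>The phases make this family closed under differentiation: a derivative shifts both
  phases by \<open>pi / 2\<close> and multiplies \<open>B\<close> by \<open>m\<close>. Induction on
  the order then goes through.\<close>

lemma smooth_real_cos_sum: "smooth_real (\<lambda>t. A * cos (t + \<alpha>) + B * cos (m * t + \<beta>))"
  unfolding smooth_real_def
proof (intro allI)
  fix j :: nat and t :: real
  show "(deriv ^^ j) (\<lambda>t. A * cos (t + \<alpha>) + B * cos (m * t + \<beta>)) field_differentiable at t"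
  proof (induction j arbitrary: A B \<alpha> \<beta>)
    case 0
    have "((\<lambda>t. A * cos (t + \<alpha>) + B * cos (m * t + \<beta>)) has_real_derivative
        - A * sin (t + \<alpha>) - B * m * sin (m * t + \<beta>)) (at t)"
      by (auto intro!: derivative_eq_intros simp: algebra_simps)
    then show ?case by (auto simp: field_differentiable_def)
  next
    case (Suc j)
    have "deriv (\<lambda>t. A * cos (t + \<alpha>) + B * cos (m * t + \<beta>))
        = (\<lambda>t. A * cos (t + (\<alpha> + pi / 2)) + (B * m) * cos (m * t + (\<beta> + pi / 2)))"
    proof
      fix t
      have "((\<lambda>t. A * cos (t + \<alpha>) + B * cos (m * t + \<beta>)) has_real_derivative
          A * cos (t + (\<alpha> + pi / 2)) + (B * m) * cos (m * t + (\<beta> + pi / 2))) (at t)"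
        by (auto intro!: derivative_eq_intros simp: add.assoc[symmetric] cos_add[of _ "pi / 2"])
      then show "deriv (\<lambda>t. A * cos (t + \<alpha>) + B * cos (m * t + \<beta>)) t
          = A * cos (t + (\<alpha> + pi / 2)) + (B * m) * cos (m * t + (\<beta> + pi / 2))"
        by (rule DERIV_imp_deriv)
    qed
    then show ?case using Suc[of A "\<alpha> + pi / 2" "B * m" "\<beta> + pi / 2"] by (simp only: funpow_Suc_right o_def)
  qed
qed

text \<open>The exponent is 1 modulo p, so the map commutes with rotation by p-th roots of
  unity.\<close>

definition wavy_map :: "nat \<Rightarrow> real \<Rightarrow> complex \<Rightarrow> complex" where
  "wavy_map p \<epsilon> z = z + of_real \<epsilon> * z ^ Suc p"

definition wavy :: "nat \<Rightarrow> real \<Rightarrow> complex \<Rightarrow> nat \<Rightarrow> real" where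
  "wavy p \<epsilon> z k = (if k = 0 then Re (wavy_map p \<epsilon> z) else if k = 1 then Im (wavy_map p \<epsilon> z) else 0)"

text \<open>The divided difference of \<open>wavy_map\<close>, written as a polynomial so that it
  makes sense for z = w too. It compares a chord of the wavy curve with the corresponding chord of
  the round circle.\<close>

definition quotient :: "nat \<Rightarrow> real \<Rightarrow> complex \<Rightarrow> complex \<Rightarrow> complex" where
  "quotient p \<epsilon> z w = 1 + of_real \<epsilon> * (\<Sum>i<Suc p. z ^ i * w ^ (p - i))"

lemma wavy_map_diff: "wavy_map p \<epsilon> z - wavy_map p \<epsilon> w = (z - w) * quotient p \<epsilon> z w"
proof -
  have "wavy_map p \<epsilon> z - wavy_map p \<epsilon> w = (z - w) + of_real \<epsilon> * (z ^ Suc p - w ^ Suc p)"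
    by (simp add: wavy_map_def algebra_simps)
  also have "z ^ Suc p - w ^ Suc p = (z - w) * (\<Sum>i<Suc p. z ^ i * w ^ (p - i))"
    by (rule diff_power_eq_sum)
  finally show ?thesis by (simp only: quotient_def) (simp only: ring_distribs mult_1_right mult.left_commute)
qed

lemma wavy_map_rotate: "\<omega> ^ p = 1 \<Longrightarrow> wavy_map p \<epsilon> (\<omega> * z) = \<omega> * wavy_map p \<epsilon> z"
  by (simp add: wavy_map_def power_mult_distrib algebra_simps)

lemma quotient_rotate:
  assumes "\<omega> ^ p = 1" shows "quotient p \<epsilon> (\<omega> * z) (\<omega> * w) = quotient p \<epsilon> z w"
proof -
  have "(\<omega> * z) ^ i * (\<omega> * w) ^ (p - i) = z ^ i * w ^ (p - i)" if "i < Suc p" for i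
  proof -
    have "(\<omega> * z) ^ i * (\<omega> * w) ^ (p - i) = (\<omega> ^ i * \<omega> ^ (p - i)) * (z ^ i * w ^ (p - i))"
      by (simp add: power_mult_distrib)
    also have "\<omega> ^ i * \<omega> ^ (p - i) = 1" using that assms by (simp add: power_add[symmetric])
    finally show ?thesis by simp
  qed
  then have "(\<Sum>i<Suc p. (\<omega> * z) ^ i * (\<omega> * w) ^ (p - i)) = (\<Sum>i<Suc p. z ^ i * w ^ (p - i))"
    by (intro sum.cong) auto
  then show ?thesis by (simp only: quotient_def)
qed

text \<open>The bound on \<open>\<epsilon>\<close> keeps \<open>quotient\<close> and the factor
  \<open>h\<close> of the velocity within 1/4 of 1 on the circle. Both are then nonzero, which gives
  injectivity and immersion.\<close>

locale wavy_circle =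
  fixes p :: nat and \<epsilon> :: real
  assumes p: "3 \<le> p" and \<epsilon>: "0 < \<epsilon>" "4 * \<epsilon> * real (Suc p) \<le> 1"
begin

abbreviation N :: real where "N \<equiv> real (Suc p)"
abbreviation Q :: "complex \<Rightarrow> complex \<Rightarrow> complex" where "Q \<equiv> quotient p \<epsilon>"
abbreviation g :: "complex \<Rightarrow> complex" where "g \<equiv> wavy_map p \<epsilon>"

lemma Q_near_1: "norm z = 1 \<Longrightarrow> norm w = 1 \<Longrightarrow> norm (Q z w - 1) \<le> \<epsilon> * N"
proof -
  assume "norm z = 1" "norm w = 1"
  then have "norm (\<Sum>i<Suc p. z ^ i * w ^ (p - i)) \<le> (\<Sum>i<Suc p. 1)"
    by (intro sum_norm_le) (simp add: norm_mult norm_power)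
  then show ?thesis using \<epsilon>(1) by (simp add: quotient_def norm_mult del: sum.lessThan_Suc)
qed

lemma norm_Q: "norm z = 1 \<Longrightarrow> norm w = 1 \<Longrightarrow> 1 / 2 \<le> norm (Q z w)"
  using Q_near_1[of z w] \<epsilon>(2) norm_triangle_ineq2[of 1 "1 - Q z w"] by (simp add: norm_minus_commute)

lemma Q_nonzero: "norm z = 1 \<Longrightarrow> norm w = 1 \<Longrightarrow> Q z w \<noteq> 0"
  using norm_Q[of z w] by auto

lemma Q_lipschitz:
  assumes "norm z = 1" "norm w = 1" "norm z' = 1" "norm w' = 1"
  shows "norm (Q z w - Q z' w') \<le> \<epsilon> * N\<^sup>2 * (norm (z - z') + norm (w - w'))"
proof -
  have "norm (z ^ i * w ^ (p - i) - z' ^ i * w' ^ (p - i)) \<le> N * (norm (z - z') + norm (w - w'))" if "i < Suc p" for i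
  proof -
    have "z ^ i * w ^ (p - i) - z' ^ i * w' ^ (p - i) = (z ^ i - z' ^ i) * w ^ (p - i) + z' ^ i * (w ^ (p - i) - w' ^ (p - i))"
      by (simp add: algebra_simps)
    also have "norm \<dots> \<le> norm (z ^ i - z' ^ i) + norm (w ^ (p - i) - w' ^ (p - i))"
      by (rule norm_triangle_le) (simp add: norm_mult norm_power assms)
    also have "\<dots> \<le> real i * norm (z - z') + real (p - i) * norm (w - w')"
      using assms by (intro add_mono norm_power_diff) auto
    also have "\<dots> \<le> N * norm (z - z') + N * norm (w - w')"
      using that by (intro add_mono mult_right_mono) auto
    finally show ?thesis by (simp add: algebra_simps)
  qed
  then have "norm (\<Sum>i<Suc p. z ^ i * w ^ (p - i) - z' ^ i * w' ^ (p - i)) \<le> (\<Sum>i<Suc p. N * (norm (z - z') + norm (w - w')))"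
    by (intro sum_norm_le) auto
  then have "\<epsilon> * norm (\<Sum>i<Suc p. z ^ i * w ^ (p - i) - z' ^ i * w' ^ (p - i)) \<le> \<epsilon> * (N * (N * (norm (z - z') + norm (w - w'))))"
    using \<epsilon>(1) by (intro mult_left_mono) auto
  moreover have "Q z w - Q z' w' = of_real \<epsilon> * (\<Sum>i<Suc p. z ^ i * w ^ (p - i) - z' ^ i * w' ^ (p - i))"
    unfolding quotient_def sum_subtractf by (simp only: algebra_simps add_diff_add diff_self add_0)
  ultimately show ?thesis
    using \<epsilon>(1) by (simp only: norm_mult norm_of_real abs_of_pos power2_eq_square mult.assoc)
qed

lemma g_cis: "g (cis t) = cis t + of_real \<epsilon> * cis (N * t)"
  by (simp only: wavy_map_def Complex.DeMoivre)

lemma Re_g: "Re (g (cis t)) = cos t + \<epsilon> * cos (N * t)"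
  and Im_g: "Im (g (cis t)) = sin t + \<epsilon> * sin (N * t)"
  unfolding g_cis by simp_all

definition dc :: "real \<Rightarrow> nat \<Rightarrow> real" where
  "dc t k = (if k = 0 then - sin t - \<epsilon> * N * sin (N * t) else cos t + \<epsilon> * N * cos (N * t))"

definition ddc :: "real \<Rightarrow> nat \<Rightarrow> real" where
  "ddc t k = (if k = 0 then - cos t - \<epsilon> * N\<^sup>2 * cos (N * t) else - sin t - \<epsilon> * N\<^sup>2 * sin (N * t))"

lemma deriv_wavy: "k < 2 \<Longrightarrow> ((\<lambda>t. wavy p \<epsilon> (cis t) k) has_real_derivative dc t k) (at t)"
  unfolding wavy_def dc_def Re_g Im_g
  by (cases "k = 0") (auto intro!: derivative_eq_intros simp del: of_nat_Suc)

lemma velocity_wavy: "k < 2 \<Longrightarrow> velocity (wavy p \<epsilon>) (cis t) k = dc t k"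
proof -
  assume k: "k < 2"
  have "((\<lambda>s. wavy p \<epsilon> (cis (t + s)) k) has_real_derivative dc t k) (at 0)"
    using DERIV_shift[of "\<lambda>t. wavy p \<epsilon> (cis t) k" "dc t k" 0 t] deriv_wavy[OF k, of t] by (simp add: add.commute)
  then show ?thesis by (simp add: velocity_def cis_mult DERIV_imp_deriv)
qed

lemma deriv_dc_wavy: "k < 2 \<Longrightarrow> ((\<lambda>t. dc t k) has_real_derivative ddc t k) (at t)"
  unfolding dc_def ddc_def
  by (cases "k = 0") (auto intro!: derivative_eq_intros simp: power2_eq_square simp del: of_nat_Suc)

text \<open>The velocity of the wavy curve divided by that of the round circle.\<close>

definition h :: "real \<Rightarrow> complex" where
  "h t = 1 + of_real (\<epsilon> * N) * cis (real p * t)"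

lemma dc_complex: "Complex (dc t 0) (dc t 1) = \<i> * cis t * h t"
proof -
  have "N * t = t + real p * t" by (simp add: algebra_simps)
  then have c: "cis (N * t) = cis t * cis (real p * t)" by (simp only: cis_mult)
  have "\<i> * cis t * h t = \<i> * (cis t + of_real (\<epsilon> * N) * cis (N * t))"
    unfolding c h_def by (simp add: algebra_simps)
  then show ?thesis by (simp add: complex_eq_iff dc_def del: of_nat_Suc)
qed

lemma norm_h: "norm (h t - 1) \<le> \<epsilon> * N" "norm (h t) \<le> 2" "h t \<noteq> 0"
proof -
  show 1: "norm (h t - 1) \<le> \<epsilon> * N"
    unfolding h_def using \<epsilon>(1) by (simp add: norm_mult del: of_nat_Suc)
  show "norm (h t) \<le> 2" using 1 \<epsilon>(2) norm_triangle_ineq[of 1 "h t - 1"] by simp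
  have "1 \<le> norm (h t) + norm (h t - 1)" using norm_triangle_ineq4[of "h t" "h t - 1"] by simp
  then show "h t \<noteq> 0" using 1 \<epsilon>(2) by auto
qed

lemma smooth_embedding_wavy: "smooth_embedding 2 (wavy p \<epsilon>)"
  unfolding smooth_embedding_def
proof (intro conjI ballI allI impI)
  fix k :: nat assume k: "k < 2"
  show "smooth_real (\<lambda>t. wavy p \<epsilon> (cis t) k)"
  proof (cases "k = 0")
    case True
    then have "(\<lambda>t. wavy p \<epsilon> (cis t) k) = (\<lambda>t. 1 * cos (t + 0) + \<epsilon> * cos (N * t + 0))"
      by (simp add: wavy_def Re_g del: of_nat_Suc)
    then show ?thesis by (simp only: smooth_real_cos_sum)
  next
    case False
    have "(\<lambda>t. wavy p \<epsilon> (cis t) k) = (\<lambda>t. 1 * cos (t + - (pi / 2)) + \<epsilon> * cos (N * t + - (pi / 2)))"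
      using False k by (simp add: wavy_def Im_g cos_diff del: of_nat_Suc)
    then show ?thesis by (simp only: smooth_real_cos_sum)
  qed
next
  fix z :: complex assume "z \<in> sphere 0 1"
  then have "z = cis (Arg2pi z)" using complex_norm_eq_1_exp[of z] by (simp add: cis_conv_exp)
  then obtain t where t: "z = cis t" by blast
  have "Complex (dc t 0) (dc t 1) \<noteq> 0" unfolding dc_complex using norm_h(3) by simp
  then have "dc t 0 \<noteq> 0 \<or> dc t 1 \<noteq> 0" by (auto simp: complex_eq_iff)
  then show "\<exists>k<2. velocity (wavy p \<epsilon>) z k \<noteq> 0"
  proof
    assume "dc t 0 \<noteq> 0"
    then show ?thesis unfolding t using velocity_wavy[of 0 t] by (intro exI[of _ 0]) simp
  next
    assume "dc t 1 \<noteq> 0"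
    then show ?thesis unfolding t using velocity_wavy[of 1 t] by (intro exI[of _ 1]) simp
  qed
next
  show "embedding_map (top_of_set (sphere 0 1)) (Euclidean_space 2) (wavy p \<epsilon>)"
  proof (rule continuous_imp_embedding_map)
    have "wavy p \<epsilon> = (\<lambda>z k. if k < 2 then (if k = 0 then Re (g z) else Im (g z)) else 0)"
      by (auto simp: wavy_def fun_eq_iff)
    moreover have "continuous_map (top_of_set (sphere 0 1)) euclideanreal (\<lambda>z. if k = 0 then Re (g z) else Im (g z))" for k :: nat
      unfolding wavy_map_def by (cases "k = 0") (auto intro!: continuous_intros)
    ultimately show "continuous_map (top_of_set (sphere 0 1)) (Euclidean_space 2) (wavy p \<epsilon>)"
      by (simp only: continuous_map_componentwise_Euclidean_space) simp
    show "compact_space (top_of_set (sphere 0 (1::real) :: complex set))"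
      by (simp add: compact_space_subtopology)
    show "Hausdorff_space (Euclidean_space 2)" by (rule Hausdorff_Euclidean_space)
    show "inj_on (wavy p \<epsilon>) (topspace (top_of_set (sphere 0 1)))"
    proof (rule inj_onI)
      fix z w assume zw: "z \<in> topspace (top_of_set (sphere 0 1))" "w \<in> topspace (top_of_set (sphere 0 1))" "wavy p \<epsilon> z = wavy p \<epsilon> w"
      from fun_cong[OF zw(3), of 0] fun_cong[OF zw(3), of 1] have "g z = g w"
        by (simp add: wavy_def complex_eq_iff)
      then have "(z - w) * Q z w = 0" using wavy_map_diff[of p \<epsilon> z w] by simp
      then show "z = w" using Q_nonzero[of z w] zw by auto
    qed
  qed
qed

sublocale embedded_circle_C2 2 "wavy p \<epsilon>" ddc
proof unfold_locales
  show "smooth_embedding 2 (wavy p \<epsilon>)" by (rule smooth_embedding_wavy)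
  show "((\<lambda>t. velocity (wavy p \<epsilon>) (cis t) k) has_real_derivative ddc t k) (at t)" if "k < 2" for k t
    unfolding velocity_wavy[OF that] by (rule deriv_dc_wavy[OF that])
qed

lemma lessThan_2_nat: "{..<2::nat} = {0, 1}"
  by auto

lemma D_wavy: "D s t = norm (g (cis s) - g (cis t))"
  by (simp add: D_def L2_set_def wavy_def cmod_def lessThan_2_nat)

text \<open>The factor by which the pairing of chord direction and velocity differs from the round
  circle, where it is 1.\<close>

definition H :: "real \<Rightarrow> real \<Rightarrow> complex" where
  "H s t = cnj (sgn (Q (cis s) (cis t))) * h s"

lemma D1_wavy:
  "D1 s t = Re (cnj (g (cis s) - g (cis t)) * (\<i> * cis s * h s)) / norm (g (cis s) - g (cis t))"
proof -
  have "(\<Sum>k<2. (wavy p \<epsilon> (cis s) k - wavy p \<epsilon> (cis t) k) * velocity (wavy p \<epsilon>) (cis s) k)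
      = Re (cnj (g (cis s) - g (cis t)) * Complex (dc s 0) (dc s 1))"
    by (simp add: velocity_wavy lessThan_2_nat wavy_def algebra_simps)
  then show ?thesis by (simp only: D1_def D_wavy dc_complex)
qed

text \<open>For \<open>H s t = 1\<close> this is the round circle, where the chord has length 2 |sin
  ((s - t) / 2)|. The half angle arises because the chord points in the direction of the mean angle
  (s + t) / 2, up to a quarter turn, and the velocity in that of s.\<close>

lemma D1_H:
  assumes "sin ((s - t) / 2) \<noteq> 0"
  shows "D1 s t = sgn (sin ((s - t) / 2)) * Re (cis ((s - t) / 2) * H s t)"
proof -
  define S where "S = sin ((s - t) / 2)"
  define u where "u = Q (cis s) (cis t)"
  have u: "norm u \<noteq> 0" using Q_nonzero by (simp add: u_def)
  have gd: "g (cis s) - g (cis t) = 2 * \<i> * of_real S * cis ((s + t) / 2) * u"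
    by (simp only: wavy_map_diff cis_minus_cis S_def u_def)
  have "cis s = cis ((s + t) / 2) * cis ((s - t) / 2)" by (simp add: cis_mult field_simps)
  then have "cnj (cis ((s + t) / 2)) * cis s = cis ((s - t) / 2)"
    by (simp add: cis_cnj cis_mult mult.assoc[symmetric])
  then have "cnj (g (cis s) - g (cis t)) * (\<i> * cis s * h s) = of_real (2 * S) * (cis ((s - t) / 2) * (cnj u * h s))"
    unfolding gd by (simp add: algebra_simps)
  moreover have "norm (g (cis s) - g (cis t)) = 2 * \<bar>S\<bar> * norm u"
    unfolding gd by (simp add: norm_mult)
  moreover have "Re (of_real (2 * S) * x) = 2 * S * Re x" for x by simp
  ultimately have "D1 s t = 2 * S * Re (cis ((s - t) / 2) * (cnj u * h s)) / (2 * \<bar>S\<bar> * norm u)"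
    unfolding D1_wavy by (simp only:)
  also have "\<dots> = sgn S * (Re (cis ((s - t) / 2) * (cnj u * h s)) / norm u)"
  proof -
    have "2 * S * x / (2 * \<bar>S\<bar> * m) = sgn S * (x / m)" for x m :: real
      using assms by (cases "0 < S") (simp_all add: S_def[symmetric] sgn_if abs_if)
    then show ?thesis by blast
  qed
  also have "Re (cis ((s - t) / 2) * (cnj u * h s)) / norm u = Re (cis ((s - t) / 2) * H s t)"
    unfolding H_def u_def[symmetric] by (simp add: sgn_eq Re_divide_of_real[symmetric] del: Re_divide_of_real)
  finally show ?thesis by (simp add: S_def)
qed

text \<open>\<open>D1\<close> without its sign factor, hence regular across the diagonal. On an open
  lift the signs are known, so \<open>grad\<close> is a difference of two such values.\<close>

definition T :: "real \<Rightarrow> real \<Rightarrow> real" where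
  "T s t = Re (cis ((s - t) / 2) * H s t)"

lemma grad_T:
  assumes "\<theta> \<in> open_lifts m k"
  shows "grad \<theta> i = T (\<theta> i) (\<theta> (i - 1)) - T (\<theta> i) (\<theta> (i + 1))"
proof -
  have "\<theta> (i - 1) < \<theta> (i - 1 + 1) \<and> \<theta> (i - 1 + 1) < \<theta> (i - 1) + 2 * pi" "\<theta> i < \<theta> (i + 1) \<and> \<theta> (i + 1) < \<theta> i + 2 * pi"
    using assms unfolding open_lifts_def by blast+
  then have "0 < sin ((\<theta> i - \<theta> (i - 1)) / 2)" "0 < sin ((\<theta> (i + 1) - \<theta> i) / 2)"
    by (auto intro!: sin_gt_zero)
  moreover have "sin ((\<theta> i - \<theta> (i + 1)) / 2) = - sin ((\<theta> (i + 1) - \<theta> i) / 2)"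
    by (metis minus_diff_eq minus_divide_left sin_minus)
  ultimately show ?thesis unfolding grad_def T_def by (simp add: D1_H)
qed

text \<open>The constant 9 is 4 * 2 + 1. The Lipschitz constant of the normalized quotient carries
  the factor 4, as \<open>sgn\<close> costs 2 / |Q| and |Q| is at least 1/2; it is multiplied by the
  bound 2 for |h|, and the variation of \<open>h\<close> adds 1.\<close>

definition kappa :: real where "kappa = 9 * \<epsilon> * N\<^sup>2"

lemma norm_H: "norm (H s t - 1) \<le> kappa"
proof -
  let ?u = "Q (cis s) (cis t)"
  have "norm (sgn 1 - sgn ?u) \<le> 2 * norm (1 - ?u) / norm (1 :: complex)"
    by (rule norm_sgn_diff_le) (use Q_nonzero in auto)
  then have su: "norm (sgn ?u - 1) \<le> 2 * (\<epsilon> * N)"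
    using Q_near_1[of "cis s" "cis t"] by (simp add: norm_minus_commute sgn_one del: of_nat_Suc)
  have "H s t - 1 = cnj (sgn ?u - 1) * h s + (h s - 1)" by (simp add: H_def algebra_simps)
  also have "norm \<dots> \<le> norm (sgn ?u - 1) * norm (h s) + norm (h s - 1)"
    by (rule norm_triangle_le) (simp add: norm_mult complex_mod_cnj del: complex_cnj_diff)
  also have "\<dots> \<le> (2 * (\<epsilon> * N)) * 2 + \<epsilon> * N"
    using \<epsilon>(1) by (intro add_mono mult_mono su norm_h) auto
  also have "\<dots> \<le> 9 * \<epsilon> * N * N"
    using \<epsilon>(1) mult_mono[of 1 N "\<epsilon> * N" "\<epsilon> * N"] by (simp add: algebra_simps)
  finally show ?thesis by (simp add: kappa_def power2_eq_square mult.assoc)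
qed

lemma H_lipschitz: "norm (H s t - H s' t') \<le> kappa * (\<bar>s - s'\<bar> + \<bar>t - t'\<bar>)"
proof -
  let ?u = "Q (cis s) (cis t)" and ?v = "Q (cis s') (cis t')"
  let ?d = "\<bar>s - s'\<bar> + \<bar>t - t'\<bar>"
  have e: "0 \<le> \<epsilon> * N\<^sup>2" using \<epsilon>(1) by simp
  have "norm (?u - ?v) \<le> \<epsilon> * N\<^sup>2 * (norm (cis s - cis s') + norm (cis t - cis t'))"
    by (rule Q_lipschitz) auto
  also have "\<dots> \<le> \<epsilon> * N\<^sup>2 * ?d" using e by (intro mult_left_mono add_mono norm_cis_minus_cis_le) auto
  finally have uv: "norm (?u - ?v) \<le> \<epsilon> * N\<^sup>2 * ?d" .
  have "norm (sgn ?u - sgn ?v) \<le> 2 * norm (?u - ?v) / norm ?u"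
    by (rule norm_sgn_diff_le) (use Q_nonzero in auto)
  also have "\<dots> \<le> 2 * norm (?u - ?v) / (1 / 2)"
    by (rule divide_left_mono) (use norm_Q[of "cis s" "cis t"] in auto)
  finally have su: "norm (sgn ?u - sgn ?v) \<le> 4 * (\<epsilon> * N\<^sup>2 * ?d)" using uv by simp
  have "h s - h s' = of_real (\<epsilon> * N) * (cis (real p * s) - cis (real p * s'))" by (simp add: h_def algebra_simps)
  then have "norm (h s - h s') = \<epsilon> * N * norm (cis (real p * s) - cis (real p * s'))"
    using \<epsilon>(1) by (simp add: norm_mult del: of_nat_Suc)
  also have "\<dots> \<le> \<epsilon> * N * \<bar>real p * s - real p * s'\<bar>"
    using \<epsilon>(1) by (intro mult_left_mono norm_cis_minus_cis_le) auto
  also have "\<dots> = \<epsilon> * N * (real p * \<bar>s - s'\<bar>)" by (simp add: right_diff_distrib[symmetric] abs_mult)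
  also have "\<dots> \<le> \<epsilon> * N * (N * ?d)" using \<epsilon>(1) by (intro mult_left_mono mult_mono) auto
  finally have sh: "norm (h s - h s') \<le> \<epsilon> * N\<^sup>2 * ?d" by (simp add: power2_eq_square mult.assoc)
  have "H s t - H s' t' = cnj (sgn ?u - sgn ?v) * h s + cnj (sgn ?v) * (h s - h s')"
    by (simp add: H_def algebra_simps)
  also have "norm \<dots> \<le> norm (sgn ?u - sgn ?v) * norm (h s) + 1 * norm (h s - h s')"
    by (rule norm_triangle_le, rule add_mono) (use Q_nonzero in \<open>simp_all add: norm_mult complex_mod_cnj norm_sgn del: complex_cnj_diff\<close>)
  also have "\<dots> \<le> (4 * (\<epsilon> * N\<^sup>2 * ?d)) * 2 + 1 * (\<epsilon> * N\<^sup>2 * ?d)"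
    using e by (intro add_mono mult_mono su norm_h sh) auto
  finally show ?thesis by (simp add: kappa_def algebra_simps)
qed

definition R :: "real \<Rightarrow> real \<Rightarrow> real" where
  "R s t = Re (cis ((s - t) / 2) * (H s t - 1))"

lemma T_R: "T s t = cos ((s - t) / 2) + R s t"
  by (simp add: T_def R_def algebra_simps)

lemma kappa_nonneg: "0 \<le> kappa" using \<epsilon>(1) by (simp add: kappa_def)

lemma R_bound: "\<bar>R s t\<bar> \<le> kappa"
proof -
  have "\<bar>R s t\<bar> \<le> norm (cis ((s - t) / 2) * (H s t - 1))" unfolding R_def by (rule abs_Re_le_cmod)
  then show ?thesis using norm_H[of s t] by (simp add: norm_mult)
qed

lemma R_lipschitz: "\<bar>R s t - R s' t'\<bar> \<le> 2 * kappa * (\<bar>s - s'\<bar> + \<bar>t - t'\<bar>)"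
proof -
  let ?c = "cis ((s - t) / 2)" and ?c' = "cis ((s' - t') / 2)" let ?d = "\<bar>s - s'\<bar> + \<bar>t - t'\<bar>"
  have "R s t - R s' t' = Re (?c * (H s t - H s' t') + (?c - ?c') * (H s' t' - 1))"
    by (simp add: R_def algebra_simps)
  also have "\<bar>\<dots>\<bar> \<le> norm (?c * (H s t - H s' t') + (?c - ?c') * (H s' t' - 1))" by (rule abs_Re_le_cmod)
  also have "\<dots> \<le> norm (H s t - H s' t') + norm (?c - ?c') * norm (H s' t' - 1)"
    by (rule norm_triangle_le) (simp add: norm_mult)
  also have "\<dots> \<le> kappa * ?d + ?d * kappa"
  proof (intro add_mono mult_mono H_lipschitz norm_H)
    have "norm (?c - ?c') \<le> \<bar>(s - t) / 2 - (s' - t') / 2\<bar>" by (rule norm_cis_minus_cis_le)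
    also have "(s - t) / 2 - (s' - t') / 2 = ((s - s') - (t - t')) / 2" by (simp add: field_simps)
    also have "\<bar>\<dots>\<bar> \<le> ?d" 
    proof -
      have "x / 2 \<le> a + b" if "x \<le> a + b" "0 \<le> a" "0 \<le> b" for x a b :: real using that by simp
      from this[OF abs_triangle_ineq4[of "s - s'" "t - t'"]] show ?thesis by simp
    qed
    finally show "norm (?c - ?c') \<le> ?d" .
  qed auto
  finally show ?thesis by (simp add: algebra_simps)
qed

lemma T_rotate:
  assumes "cis (real p * \<alpha>) = 1" shows "T (s + \<alpha>) (t + \<alpha>) = T s t"
proof -
  have "cis \<alpha> ^ p = 1" using assms by (simp only: Complex.DeMoivre)
  then have "Q (cis (s + \<alpha>)) (cis (t + \<alpha>)) = Q (cis s) (cis t)"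
    using quotient_rotate[of "cis \<alpha>" p \<epsilon> "cis s" "cis t"] by (simp add: cis_mult add.commute)
  moreover have "cis (real p * (s + \<alpha>)) = cis (real p * s)"
    using assms by (simp add: distrib_left cis_mult[symmetric])
  ultimately show ?thesis by (simp add: T_def H_def h_def)
qed

end

subsection \<open>Critical polygons of a slightly wavy circle\<close>

lemma diff_le_sum_steps:
  fixes a :: "int \<Rightarrow> real"
  assumes "i < p" "j < p"
  shows "\<bar>a (int j) - a (int i)\<bar> \<le> (\<Sum>l<p. \<bar>a (int l + 1) - a (int l)\<bar>)"
proof -
  have *: "\<bar>a (int j) - a (int i)\<bar> \<le> (\<Sum>l<p. \<bar>a (int l + 1) - a (int l)\<bar>)" if "i \<le> j" "j < p" for i j
  proof -
    have "\<bar>a (int j) - a (int i)\<bar> \<le> (\<Sum>l\<in>{i..<j}. \<bar>a (int l + 1) - a (int l)\<bar>)"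
      using that(1)
    proof (induction j rule: dec_induct)
      case (step m)
      have "\<bar>a (int (Suc m)) - a (int i)\<bar> \<le> \<bar>a (int m) - a (int i)\<bar> + \<bar>a (int m + 1) - a (int m)\<bar>"
        by (simp add: add.commute)
      then show ?case using step by simp
    qed simp
    also have "\<dots> \<le> (\<Sum>l<p. \<bar>a (int l + 1) - a (int l)\<bar>)"
      using that(2) by (intro sum_mono2) auto
    finally show ?thesis .
  qed
  show ?thesis
    using *[of i j] *[of j i] assms by (cases "i \<le> j") (auto simp: abs_minus_commute)
qed

text \<open>A discrete Poincare inequality: with mean zero, p times a value is the sum of its
  differences from all values.\<close>

lemma mean_zero_le_sum_steps:
  fixes a :: "int \<Rightarrow> real"
  assumes per: "\<And>i. a (i + int p) = a i" and p: "0 < p" and zero: "(\<Sum>i<p. a (int i)) = 0"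
  shows "\<bar>a i\<bar> \<le> (\<Sum>l<p. \<bar>a (int l + 1) - a (int l)\<bar>)"
proof -
  let ?A = "\<Sum>l<p. \<bar>a (int l + 1) - a (int l)\<bar>"
  have nat: "\<bar>a (int m)\<bar> \<le> ?A" if m: "m < p" for m
  proof -
    have "real p * a (int m) = (\<Sum>j<p. a (int m) - a (int j))"
      using zero by (simp add: sum_subtractf)
    also have "\<bar>\<dots>\<bar> \<le> (\<Sum>j<p. ?A)"
      using diff_le_sum_steps[OF _ m, of _ a] by (intro order_trans[OF sum_abs] sum_mono) simp
    finally have "real p * \<bar>a (int m)\<bar> \<le> real p * ?A" by (simp add: abs_mult)
    then show ?thesis using p by simp
  qed
  have "quasi_periodic p 0 a" using per by (simp add: quasi_periodic_def)
  then have "a i = a (i mod int p)" using quasi_periodic_mod[of p 0 a i] by simp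
  also have "\<dots> = a (int (nat (i mod int p)))" using p by simp
  finally show ?thesis using nat[of "nat (i mod int p)"] p by (simp add: nat_less_iff)
qed

text \<open>By the mean value theorem the slope is -sin z for some z between x and y. The cosine is
  monotone on [0, pi], so |cos z| is at most \<open>q\<close> as well, which bounds sin z from
  below.\<close>

lemma cos_monotone_bound:
  assumes x: "0 \<le> x" "x \<le> pi" "\<bar>cos x\<bar> \<le> q" and y: "0 \<le> y" "y \<le> pi" "\<bar>cos y\<bar> \<le> q"
  shows "(y - x) * (cos y - cos x) \<le> - sqrt (1 - q\<^sup>2) * (y - x)\<^sup>2"
proof -
  have *: "(y - x) * (cos y - cos x) \<le> - sqrt (1 - q\<^sup>2) * (y - x)\<^sup>2"
    if "x < y" "0 \<le> x" "y \<le> pi" "\<bar>cos x\<bar> \<le> q" "\<bar>cos y\<bar> \<le> q" for x y :: real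
  proof -
    have "\<exists>z>x. z < y \<and> cos y - cos x = (y - x) * (- sin z)"
      by (rule MVT2[OF that(1)]) (auto intro!: derivative_eq_intros)
    then obtain z where z: "x < z" "z < y" "cos y - cos x = (y - x) * (- sin z)" by blast
    have "cos y \<le> cos z" "cos z \<le> cos x"
      using that z by (auto intro!: cos_monotone_0_pi_le)
    then have "\<bar>cos z\<bar> \<le> q" using that by linarith
    then have "(cos z)\<^sup>2 \<le> q\<^sup>2" by (metis abs_ge_zero power2_abs power_mono)
    then have "1 - q\<^sup>2 \<le> (sin z)\<^sup>2" by (simp add: sin_squared_eq)
    moreover have "0 \<le> sin z" using z that by (intro sin_ge_zero) auto
    ultimately have "sqrt (1 - q\<^sup>2) \<le> sin z" by (metis real_le_rsqrt real_sqrt_le_iff real_sqrt_unique)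
    then have "sqrt (1 - q\<^sup>2) * (y - x)\<^sup>2 \<le> sin z * (y - x)\<^sup>2" by (rule mult_right_mono) simp
    then show ?thesis unfolding z(3) by (simp add: power2_eq_square algebra_simps)
  qed
  consider "x < y" | "y < x" | "x = y" by linarith
  then show ?thesis
  proof cases
    case 2
    have "(y - x) * (cos y - cos x) = (x - y) * (cos x - cos y)" by (simp add: algebra_simps)
    then show ?thesis using *[OF 2] x y by (simp add: power2_commute)
  qed (use * x y in auto)
qed

definition regular :: "nat \<Rightarrow> int \<Rightarrow> real \<Rightarrow> int \<Rightarrow> real" where
  "regular p k t i = t + 2 * pi * of_int k * of_int i / real p"

lemma regular_open:
  assumes "0 < k" "k < int p" shows "regular p k t \<in> open_lifts p k"
proof -
  have p: "0 < real p" using assms by simp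
  have "regular p k t (i + 1) = regular p k t i + 2 * pi * (of_int k / real p)" for i
    by (simp add: regular_def distrib_left add_divide_distrib)
  moreover have "0 < of_int k / real p" "of_int k / real p < 1" using assms p by (simp_all add: divide_less_eq_1)
  moreover have "2 * pi * (of_int k / real p) < 2 * pi * 1" using calculation(3) by (intro mult_strict_left_mono) auto
  ultimately show ?thesis
    using p by (simp add: open_lifts_def quasi_periodic_def) (simp add: regular_def field_simps)
qed

text \<open>The first bound keeps the cosines of the half-steps of a critical polygon below the
  midpoint of cos (pi / p) and 1, called \<open>q\<close> below. The second makes the perturbation
  in \<open>grad_monotone\<close> cost at most half of what the round circle provides.\<close>

locale slightly_wavy_circle = wavy_circle +
  assumes small: "4 * kappa * real p \<le> 1 - cos (pi / real p)"
    "32 * kappa * (real p)\<^sup>2 \<le> sqrt (1 - ((1 + cos (pi / real p)) / 2)\<^sup>2)"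
begin

definition q :: real where "q = (1 + cos (pi / real p)) / 2"

lemma cos_less_q: "cos (pi / real p) < q" and q_less_1: "q < 1"
  and q_pos: "0 < q"
proof -
  have p3: "0 < pi / real p" "pi / real p < pi / 2" using p by (auto simp: field_simps)
  then have "cos (pi / real p) < cos 0" by (intro cos_monotone_0_pi) (use p3 pi_gt_zero in linarith)+
  then show "cos (pi / real p) < q" "q < 1" by (auto simp: q_def)
  have "0 < cos (pi / real p)" using p3 by (intro cos_gt_zero) auto
  then show "0 < q" by (simp add: q_def)
qed

lemma slope_pos: "0 < sqrt (1 - q\<^sup>2)"
  using q_less_1 q_pos by (simp add: power_less_one_iff)

lemma cos_winding_le:
  assumes "0 < k" "k < int p" shows "\<bar>cos (pi * of_int k / real p)\<bar> \<le> cos (pi / real p)"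
proof -
  have p0: "0 < real p" using p by simp
  have k: "1 \<le> real_of_int k" "real_of_int k \<le> real p - 1" using assms by linarith+
  have a: "pi / real p \<le> pi * of_int k / real p" using k p0 by (simp add: divide_right_mono)
  have b: "pi * of_int k / real p \<le> pi - pi / real p"
  proof -
    have "pi * of_int k / real p \<le> pi * (real p - 1) / real p" using k p0 by (intro divide_right_mono mult_left_mono) auto
    also have "\<dots> = pi - pi / real p" using p0 by (simp add: field_simps)
    finally show ?thesis .
  qed
  have c: "0 \<le> pi / real p" using p0 by simp
  have "cos (pi * of_int k / real p) \<le> cos (pi / real p)"
    by (intro cos_monotone_0_pi_le) (use a b c in linarith)+
  moreover have "cos (pi - pi / real p) \<le> cos (pi * of_int k / real p)"
    by (intro cos_monotone_0_pi_le) (use a b c in linarith)+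
  ultimately show ?thesis by (simp add: abs_le_iff cos_diff)
qed

text \<open>The half-steps stay uniformly away from 0 and \<open>pi\<close>, where the cosine has
  slope 0 and monotonicity of the gradient would be lost.\<close>

definition balanced :: "(int \<Rightarrow> real) \<Rightarrow> bool" where
  "balanced \<theta> \<longleftrightarrow> (\<forall>i. \<bar>cos ((\<theta> (i + 1) - \<theta> i) / 2)\<bar> \<le> q)"

lemma grad_R:
  assumes "\<theta> \<in> open_lifts p k"
  shows "grad \<theta> i = cos ((\<theta> i - \<theta> (i - 1)) / 2) - cos ((\<theta> (i + 1) - \<theta> i) / 2)
     + (R (\<theta> i) (\<theta> (i - 1)) - R (\<theta> i) (\<theta> (i + 1)))"
proof -
  have "cos ((\<theta> i - \<theta> (i + 1)) / 2) = cos ((\<theta> (i + 1) - \<theta> i) / 2)"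
    by (metis cos_minus minus_diff_eq minus_divide_left)
  then show ?thesis by (simp add: grad_T[OF assms] T_R)
qed

text \<open>At a critical polygon the cosines of consecutive half-steps differ by at most 2
  \<open>kappa\<close>, so any two of them differ by at most 2 \<open>kappa\<close> p. Some step is
  at most the mean and some step at least the mean, so all cosines are close to that of the mean
  half-step pi k / p.\<close>

lemma critical_balanced:
  assumes \<theta>: "\<theta> \<in> open_lifts p k" and crit: "critical \<theta>"
  shows "balanced \<theta>"
proof -
  have p0: "0 < p" using p by simp
  have k: "0 < k" "k < int p" using open_lifts_winding[OF \<theta> p0] by auto
  have qp: "quasi_periodic p k \<theta>" using \<theta> by (simp add: open_lifts_def)
  define d where "d i = \<theta> (i + 1) - \<theta> i" for i
  have d: "0 < d i" "d i < 2 * pi" for i using \<theta> by (auto simp: d_def open_lifts_def algebra_simps)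
  define E where "E i = cos (d i / 2)" for i
  have step: "\<bar>E (i + 1) - E i\<bar> \<le> 2 * kappa" for i
  proof -
    have "grad \<theta> (i + 1) = 0" using crit by (simp add: critical_def)
    then have "E (i + 1) - E i = R (\<theta> (i + 1)) (\<theta> i) - R (\<theta> (i + 1)) (\<theta> (i + 1 + 1))"
      unfolding grad_R[OF \<theta>] E_def d_def by simp
    then show ?thesis using R_bound[of "\<theta> (i + 1)" "\<theta> i"] R_bound[of "\<theta> (i + 1)" "\<theta> (i + 1 + 1)"] by linarith
  qed
  have close: "\<bar>E (int j) - E (int i)\<bar> \<le> 2 * kappa * real p" if "i < p" "j < p" for i j
  proof -
    have "\<bar>E (int j) - E (int i)\<bar> \<le> (\<Sum>l<p. \<bar>E (int l + 1) - E (int l)\<bar>)" by (rule diff_le_sum_steps[OF that])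
    also have "\<dots> \<le> (\<Sum>l<p. 2 * kappa)" by (intro sum_mono step)
    finally show ?thesis by (simp add: algebra_simps)
  qed
  have total: "(\<Sum>i<p. d (int i)) = 2 * pi * of_int k"
  proof -
    have "\<theta> (0 + int p) = \<theta> 0 + 2 * pi * of_int k" using qp unfolding quasi_periodic_def by blast
    then show ?thesis by (simp add: d_def sum_telescope_int)
  qed
  define m where "m = 2 * pi * of_int k / real p"
  have msum: "(\<Sum>i<p. m) = 2 * pi * of_int k" using p0 by (simp add: m_def)
  have m0: "0 \<le> m / 2" "m / 2 \<le> pi" using k p0 by (simp_all add: m_def field_simps)
  have "\<exists>i<p. d (int i) \<le> m"
  proof (rule ccontr)
    assume "\<not> ?thesis"
    then have "(\<Sum>i<p. m) < (\<Sum>i<p. d (int i))" using p0 by (intro sum_strict_mono) auto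
    then show False using total msum by simp
  qed
  then obtain i where i: "i < p" "d (int i) \<le> m" by blast
  have "\<exists>i<p. m \<le> d (int i)"
  proof (rule ccontr)
    assume "\<not> ?thesis"
    then have "(\<Sum>i<p. d (int i)) < (\<Sum>i<p. m)" using p0 by (intro sum_strict_mono) auto
    then show False using total msum by simp
  qed
  then obtain j where j: "j < p" "m \<le> d (int j)" by blast
  have Ei: "cos (m / 2) \<le> E (int i)"
    unfolding E_def by (intro cos_monotone_0_pi_le) (use i d[of "int i"] m0 in linarith)+
  have Ej: "E (int j) \<le> cos (m / 2)"
    unfolding E_def by (intro cos_monotone_0_pi_le) (use j d[of "int j"] m0 in linarith)+
  have mk: "\<bar>cos (m / 2)\<bar> \<le> cos (pi / real p)" using cos_winding_le[OF k] by (simp add: m_def)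
  have "\<bar>E (int l)\<bar> \<le> q" if "l < p" for l
  proof -
    have *: "\<bar>x\<bar> \<le> (1 + y) / 2" if "\<bar>x - a\<bar> \<le> 2 * w" "\<bar>x - b\<bar> \<le> 2 * w" "t \<le> a" "b \<le> t" "\<bar>t\<bar> \<le> y" "4 * w \<le> 1 - y"
      for x a b t w y :: real
    proof -
      have "2 * x \<le> 1 + y" "- (2 * x) \<le> 1 + y" using that by linarith+
      then show ?thesis by (simp add: abs_le_iff)
    qed
    show ?thesis
      unfolding q_def
      by (rule *[where w = "kappa * real p", OF _ _ Ei Ej mk])
        (use close[OF i(1) that] close[OF j(1) that] small(1) in \<open>simp_all add: mult.assoc\<close>)
  qed
  moreover have "E l = E (int (nat (l mod int p)))" for l
    using quasi_periodic_diff[OF qp, of l] p0 by (simp add: E_def d_def)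
  moreover have "nat (l mod int p) < p" for l using p0 by (simp add: nat_less_iff)
  ultimately have "\<bar>E l\<bar> \<le> q" for l by metis
  then show ?thesis by (simp add: balanced_def E_def d_def)
qed

text \<open>On the round circle summation by parts pairs the differences of \<open>a\<close> with
  the differences of the cosines, and \<open>cos_monotone_bound\<close> yields -(slope / 2) S, where
  S is the sum of the squared differences of \<open>a\<close>. As \<open>a\<close> has mean zero, it
  is bounded by the sum A of its absolute differences, with A^2 at most p S. So the perturbation
  costs at most 8 \<open>kappa\<close> p A^2, hence at most (slope / 4) S.\<close>

lemma grad_monotone:
  assumes \<theta>: "\<theta> \<in> open_lifts p k" "balanced \<theta>" and \<xi>: "\<xi> \<in> open_lifts p k" "balanced \<xi>"
    and zero: "(\<Sum>i<p. \<xi> (int i) - \<theta> (int i)) = 0"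
  shows "(\<Sum>i<p. (\<xi> (int i) - \<theta> (int i)) * (grad \<xi> (int i) - grad \<theta> (int i)))
     \<le> - (sqrt (1 - q\<^sup>2) / 4) * (\<Sum>i<p. ((\<xi> (int i + 1) - \<theta> (int i + 1)) - (\<xi> (int i) - \<theta> (int i)))\<^sup>2)"
proof -
  have p0: "0 < p" using p by simp
  define a where "a i = \<xi> i - \<theta> i" for i
  have qp: "quasi_periodic p k \<theta>" "quasi_periodic p k \<xi>" using \<theta> \<xi> by (auto simp: open_lifts_def)
  then have per: "a (i + int p) = a i" for i by (simp add: a_def quasi_periodic_def)
  define S where "S = (\<Sum>i<p. (a (int i + 1) - a (int i))\<^sup>2)"
  define A where "A = (\<Sum>i<p. \<bar>a (int i + 1) - a (int i)\<bar>)"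
  have aA: "\<bar>a i\<bar> \<le> A" for i
    unfolding A_def using zero by (intro mean_zero_le_sum_steps per p0) (simp add: a_def)
  have A2: "A\<^sup>2 \<le> S * real p"
    using sum_squared_le_sum_of_squares[of "\<lambda>i. \<bar>a (int i + 1) - a (int i)\<bar>" "{..<p}"] by (simp add: A_def S_def)
  have A0: "0 \<le> A" by (simp add: A_def sum_nonneg)
  define E where "E i = cos ((\<xi> (i + 1) - \<xi> i) / 2) - cos ((\<theta> (i + 1) - \<theta> i) / 2)" for i
  have Eper: "E (i + int p) = E i" for i
    using quasi_periodic_diff[OF qp(1), of "i + int p"] quasi_periodic_diff[OF qp(1), of i]
      quasi_periodic_diff[OF qp(2), of "i + int p"] quasi_periodic_diff[OF qp(2), of i] by (simp add: E_def)
  \<comment> \<open>The difference of the perturbation terms. Each of its two halves is bounded by 2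
    \<open>kappa\<close> times the displacement of two vertices, hence by 4 \<open>kappa\<close>
    A.\<close>
  define r where "r i = (R (\<xi> i) (\<xi> (i - 1)) - R (\<xi> i) (\<xi> (i + 1))) - (R (\<theta> i) (\<theta> (i - 1)) - R (\<theta> i) (\<theta> (i + 1)))" for i
  have r: "\<bar>r i\<bar> \<le> 8 * kappa * A" for i
  proof -
    have "\<bar>R (\<xi> i) (\<xi> (i - 1)) - R (\<theta> i) (\<theta> (i - 1))\<bar> \<le> 2 * kappa * (\<bar>a i\<bar> + \<bar>a (i - 1)\<bar>)"
      "\<bar>R (\<xi> i) (\<xi> (i + 1)) - R (\<theta> i) (\<theta> (i + 1))\<bar> \<le> 2 * kappa * (\<bar>a i\<bar> + \<bar>a (i + 1)\<bar>)"
      unfolding a_def by (rule R_lipschitz)+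
    moreover have bound: "2 * kappa * (\<bar>a i\<bar> + \<bar>a j\<bar>) \<le> 2 * kappa * (A + A)" for j
      using kappa_nonneg aA[of i] aA[of j] by (intro mult_left_mono) auto
    ultimately have "\<bar>R (\<xi> i) (\<xi> (i - 1)) - R (\<theta> i) (\<theta> (i - 1))\<bar> \<le> 2 * kappa * (A + A)"
      "\<bar>R (\<xi> i) (\<xi> (i + 1)) - R (\<theta> i) (\<theta> (i + 1))\<bar> \<le> 2 * kappa * (A + A)"
      by (meson order_trans)+
    moreover have "r i = (R (\<xi> i) (\<xi> (i - 1)) - R (\<theta> i) (\<theta> (i - 1))) - (R (\<xi> i) (\<xi> (i + 1)) - R (\<theta> i) (\<theta> (i + 1)))"
      by (simp add: r_def)
    moreover have "\<bar>x - y\<bar> \<le> 8 * kappa * A" if "\<bar>x\<bar> \<le> 2 * kappa * (A + A)" "\<bar>y\<bar> \<le> 2 * kappa * (A + A)" for x y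
      using order_trans[OF abs_triangle_ineq4 add_mono[OF that]] by (simp add: algebra_simps)
    ultimately show ?thesis by simp
  qed
  have grad: "grad \<xi> i - grad \<theta> i = E (i - 1) - E i + r i" for i
    unfolding grad_R[OF \<theta>(1)] grad_R[OF \<xi>(1)] by (simp add: E_def r_def)
  have "(\<Sum>i<p. a (int i) * (grad \<xi> (int i) - grad \<theta> (int i)))
      = (\<Sum>i<p. a (int i) * E (int i - 1)) - (\<Sum>i<p. a (int i) * E (int i)) + (\<Sum>i<p. a (int i) * r (int i))"
    by (simp add: grad sum.distrib sum_subtractf algebra_simps)
  also have "(\<Sum>i<p. a (int i) * E (int i - 1)) = (\<Sum>i<p. a (int i + 1) * E (int i))"
    using sum_shift_periodic[of "\<lambda>i. a i * E (i - 1)" p] per Eper[of "_ - 1"] by (simp add: algebra_simps)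
  also have "(\<Sum>i<p. a (int i + 1) * E (int i)) - (\<Sum>i<p. a (int i) * E (int i))
      = (\<Sum>i<p. (a (int i + 1) - a (int i)) * E (int i))"
    by (simp add: sum_subtractf left_diff_distrib)
  also have "\<dots> \<le> (\<Sum>i<p. - (sqrt (1 - q\<^sup>2) / 2) * (a (int i + 1) - a (int i))\<^sup>2)"
  proof (rule sum_mono)
    fix i
    let ?x = "(\<theta> (int i + 1) - \<theta> (int i)) / 2" and ?y = "(\<xi> (int i + 1) - \<xi> (int i)) / 2"
    have xy: "0 \<le> ?x" "?x \<le> pi" "0 \<le> ?y" "?y \<le> pi"
    proof -
      have "\<theta> (int i) < \<theta> (int i + 1) \<and> \<theta> (int i + 1) < \<theta> (int i) + 2 * pi"
        "\<xi> (int i) < \<xi> (int i + 1) \<and> \<xi> (int i + 1) < \<xi> (int i) + 2 * pi"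
        using \<theta>(1) \<xi>(1) unfolding open_lifts_def by blast+
      then show "0 \<le> ?x" "?x \<le> pi" "0 \<le> ?y" "?y \<le> pi" by simp_all
    qed
    have "(?y - ?x) * (cos ?y - cos ?x) \<le> - sqrt (1 - q\<^sup>2) * (?y - ?x)\<^sup>2"
      using \<theta>(2) \<xi>(2) xy by (intro cos_monotone_bound) (auto simp: balanced_def)
    moreover have "?y - ?x = (a (int i + 1) - a (int i)) / 2" by (simp add: a_def field_simps)
    ultimately have "(a (int i + 1) - a (int i)) / 2 * E (int i) \<le> - sqrt (1 - q\<^sup>2) * ((a (int i + 1) - a (int i)) / 2)\<^sup>2"
      by (simp only: E_def)
    \<comment> \<open>The cosines are taken at half-steps, so one factor 1/2 remains when the
      inequality is rewritten in terms of full steps.\<close>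
    moreover have "x * e \<le> - (s / 2) * x\<^sup>2" if "x / 2 * e \<le> - s * (x / 2)\<^sup>2" for x e s :: real
      using that by (simp add: power2_eq_square)
    ultimately show "(a (int i + 1) - a (int i)) * E (int i) \<le> - (sqrt (1 - q\<^sup>2) / 2) * (a (int i + 1) - a (int i))\<^sup>2"
      by blast
  qed
  also have "\<dots> = - (sqrt (1 - q\<^sup>2) / 2) * S" by (simp only: S_def sum_distrib_left)
  also have "(\<Sum>i<p. a (int i) * r (int i)) \<le> (\<Sum>i<p. A * (8 * kappa * A))"
  proof (rule sum_mono)
    fix i
    have "a (int i) * r (int i) \<le> \<bar>a (int i)\<bar> * \<bar>r (int i)\<bar>" by (metis abs_ge_self abs_mult)
    also have "\<dots> \<le> A * (8 * kappa * A)" using aA r A0 by (intro mult_mono) auto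
    finally show "a (int i) * r (int i) \<le> A * (8 * kappa * A)" .
  qed
  also have "(\<Sum>i<p. A * (8 * kappa * A)) = 8 * kappa * real p * A\<^sup>2" by (simp add: power2_eq_square)
  also have "\<dots> \<le> 8 * kappa * real p * (S * real p)"
    using A2 kappa_nonneg by (intro mult_left_mono) auto
  also have "\<dots> = (32 * kappa * (real p)\<^sup>2) / 4 * S" by (simp add: power2_eq_square)
  also have "\<dots> \<le> sqrt (1 - q\<^sup>2) / 4 * S"
    using small(2) unfolding q_def[symmetric] by (intro mult_right_mono) (auto simp: S_def sum_nonneg)
  finally have "(\<Sum>i<p. a (int i) * (grad \<xi> (int i) - grad \<theta> (int i))) \<le> - (sqrt (1 - q\<^sup>2) / 4) * S"
    by (simp add: mult.commute)
  then show ?thesis by (simp add: a_def S_def)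
qed

lemma mean_zero_constant:
  assumes per: "\<And>i. a (i + int p) = a i" and zero: "(\<Sum>i<p. a (int i)) = 0"
    and S: "0 \<le> - (sqrt (1 - q\<^sup>2) / 4) * (\<Sum>i<p. (a (int i + 1) - a (int i))\<^sup>2)"
  shows "a = (\<lambda>_. 0)"
proof -
  let ?S = "\<Sum>i<p. (a (int i + 1) - a (int i))\<^sup>2"
  have "?S \<le> 0" using S slope_pos by (simp add: mult_le_0_iff zero_le_mult_iff)
  then have "?S = 0" by (intro antisym sum_nonneg) auto
  then have "\<forall>i<p. a (int i + 1) - a (int i) = 0" by (simp add: sum_nonneg_eq_0_iff)
  then have "(\<Sum>l<p. \<bar>a (int l + 1) - a (int l)\<bar>) = 0" by simp
  moreover have "0 < p" using p by simp
  ultimately have "\<bar>a i\<bar> \<le> 0" for i using mean_zero_le_sum_steps[of a p, OF per _ zero] by metis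
  then show ?thesis by auto
qed

text \<open>Rotating by \<open>2 \<pi> k / p\<close> and relabelling maps critical polygons to critical polygons with the same
  centre of mass, so they are fixed, that is, regular.\<close>

lemma critical_regular:
  assumes \<theta>: "\<theta> \<in> open_lifts p k" and crit: "critical \<theta>"
  shows "\<theta> = regular p k (\<theta> 0)"
proof -
  have p0: "0 < p" using p by simp
  have qp: "quasi_periodic p k \<theta>" using \<theta> by (simp add: open_lifts_def)
  \<comment> \<open>Relabelling raises the mean angle by 2 pi k / p; rotating back by this amount
    restores it.\<close>
  define \<alpha> where "\<alpha> = - 2 * pi * of_int k / real p"
  define \<xi> where "\<xi> i = \<theta> (i + 1) + \<alpha>" for i
  have "real p * \<alpha> = 0 + 2 * pi * of_int (- k)" using p0 by (simp add: \<alpha>_def)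
  then have \<alpha>: "cis (real p * \<alpha>) = 1" by (simp only: cis_add_2pi_int cis_zero)
  have "shift \<theta> \<in> open_lifts p k" by (rule shift_open[OF \<theta>])
  then have \<xi>: "\<xi> \<in> open_lifts p k" by (simp add: open_lifts_def quasi_periodic_def \<xi>_def shift_def)
  have "grad \<xi> i = grad \<theta> (i + 1)" for i
    unfolding grad_T[OF \<xi>] grad_T[OF \<theta>] by (simp add: \<xi>_def T_rotate[OF \<alpha>])
  then have crit\<xi>: "critical \<xi>" using crit by (simp add: critical_def)
  define a where "a i = \<xi> i - \<theta> i" for i
  have per: "a (i + int p) = a i" for i
    using \<xi> qp by (simp add: a_def open_lifts_def quasi_periodic_def)
  have "(\<Sum>i<p. a (int i)) = (\<Sum>i<p. \<theta> (int i + 1) - \<theta> (int i)) + real p * \<alpha>"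
    by (simp add: a_def \<xi>_def sum.distrib sum_subtractf)
  also have "\<dots> = \<theta> (0 + int p) - \<theta> 0 + real p * \<alpha>" by (simp add: sum_telescope_int)
  also have "\<dots> = 0"
    using qp p0 unfolding quasi_periodic_def by (simp add: \<alpha>_def del: add_0)
  finally have zero: "(\<Sum>i<p. a (int i)) = 0" .
  have "0 \<le> - (sqrt (1 - q\<^sup>2) / 4) * (\<Sum>i<p. (a (int i + 1) - a (int i))\<^sup>2)"
    using grad_monotone[OF \<theta> critical_balanced[OF \<theta> crit] \<xi> critical_balanced[OF \<xi> crit\<xi>]] zero crit crit\<xi>
    by (simp add: a_def critical_def)
  then have "a = (\<lambda>_. 0)" by (rule mean_zero_constant[OF per zero])
  have step: "\<theta> (i + 1) = \<theta> i - \<alpha>" for i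
    using fun_cong[OF \<open>a = (\<lambda>_. 0)\<close>, of i] by (simp add: a_def \<xi>_def)
  have linear: "\<theta> i = \<theta> 0 - \<alpha> * of_int i" for i
  proof (induction i rule: int_induct[where k = 0])
    case (step1 i)
    then show ?case using step[of i] by (simp add: algebra_simps)
  next
    case (step2 i)
    then show ?case using step[of "i - 1"] by (simp add: algebra_simps)
  qed simp
  have "\<theta> i = regular p k (\<theta> 0) i" for i
    using linear[of i] by (simp add: regular_def \<alpha>_def)
  then show ?thesis by (rule ext)
qed

end

section \<open>Dihedral orbits of regular polygons\<close>

lemma dihedral_orbit_trans:
  assumes "ys \<in> dihedral_orbit xs" "zs \<in> dihedral_orbit ys" shows "zs \<in> dihedral_orbit xs"
  using assms(2) by induction (auto intro: assms(1) dihedral_orbit.intros)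

lemma dihedral_orbit_rotate: "rotate m xs \<in> dihedral_orbit xs"
  by (induction m) (auto intro: dihedral_orbit.intros)

text \<open>Orbits are closed under the generators only; the inverse of a rotation is recovered as a
  power of it.\<close>

lemma dihedral_orbit_sym:
  assumes "ys \<in> dihedral_orbit xs" shows "xs \<in> dihedral_orbit ys"
  using assms
proof induction
  case (rotation ys)
  have "ys \<in> dihedral_orbit (rotate1 ys)"
  proof (cases "ys = []")
    case False
    have "rotate (length ys - 1) (rotate1 ys) = rotate (Suc (length ys - 1)) ys"
      by (simp only: rotate1_rotate_swap rotate_Suc)
    also have "\<dots> = ys" using False by simp
    finally show ?thesis using dihedral_orbit_rotate[of "length ys - 1" "rotate1 ys"] by simp
  qed (simp add: dihedral_orbit.base)
  then show ?case using rotation.IH dihedral_orbit_trans by blast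
next
  case (reflection ys)
  have "ys \<in> dihedral_orbit (rev ys)" using dihedral_orbit.reflection[OF dihedral_orbit.base, of "rev ys"] by simp
  then show ?case using reflection.IH dihedral_orbit_trans by blast
qed (rule dihedral_orbit.base)

lemma dihedral_orbit_eq: "ys \<in> dihedral_orbit xs \<Longrightarrow> dihedral_orbit ys = dihedral_orbit xs"
  using dihedral_orbit_trans dihedral_orbit_sym by blast

lemma quasi_periodic_regular: "0 < p \<Longrightarrow> quasi_periodic p k (regular p k t)"
  by (simp add: quasi_periodic_def regular_def field_simps)

lemma shift_regular: "shift (regular p k t) = regular p k (t + 2 * pi * of_int k / real p)"
  by (rule ext) (simp add: shift_def regular_def distrib_left add_divide_distrib)

lemma rotate_points_regular:
  assumes "0 < p"
  shows "rotate m (points p (regular p k t)) = points p (regular p k (t + real m * (2 * pi * of_int k / real p)))"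
proof (induction m)
  case (Suc m)
  have "rotate (Suc m) (points p (regular p k t)) = rotate1 (rotate m (points p (regular p k t)))" by simp
  also have "\<dots> = points p (shift (regular p k (t + real m * (2 * pi * of_int k / real p))))"
    unfolding Suc by (rule rotate1_points[OF quasi_periodic_regular[OF assms] assms])
  also have "shift (regular p k (t + real m * (2 * pi * of_int k / real p)))
      = regular p k (t + real (Suc m) * (2 * pi * of_int k / real p))"
    unfolding shift_regular by (simp add: distrib_right add_divide_distrib algebra_simps)
  finally show ?case .
qed simp

lemma rev_points_regular:
  assumes "0 < p"
  shows "rev (points p (regular p k t)) = points p (regular p (int p - k) (t + 2 * pi * of_int (int p - k) / real p))"
proof -
  have "shift (reverse (regular p k t)) = regular p (int p - k) (t + 2 * pi * of_int (int p - k) / real p)"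
    using assms by (intro ext) (simp add: shift_def reverse_def regular_def field_simps)
  then show ?thesis using rev_points[OF quasi_periodic_regular[OF assms]] by simp
qed

lemma points_regular_2pi: "points p (regular p k (t + 2 * pi * of_int m)) = points p (regular p k t)"
proof -
  have "regular p k (t + 2 * pi * of_int m) i = regular p k t i + 2 * pi * of_int m" for i
    by (simp add: regular_def)
  then show ?thesis unfolding points_def by (simp only: cis_add_2pi_int)
qed

text \<open>A cyclic shift turns the regular polygon by \<open>2 k\<close> units \<open>\<pi> / p\<close>, so for a prime \<open>p\<close> only the parity of
  the starting position survives.\<close>

lemma regular_orbit_parity:
  assumes p: "prime p" and k: "0 < k" "k < int p"
  shows "points p (regular p k (pi * of_int (j mod 2) / real p)) \<in> dihedral_orbit (points p (regular p k (pi * of_int j / real p)))"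
proof -
  have p0: "0 < p" using p by (simp add: prime_gt_0_nat)
  have "coprime k (int p)"
  proof -
    have "\<not> int p dvd k" using k zdvd_not_zless by blast
    then have "coprime (int p) k" using p by (intro prime_imp_coprime) auto
    then show ?thesis by (simp add: coprime_commute)
  qed
  then obtain x y where xy: "k * x + int p * y = 1" using bezout_int[of k "int p"] by (metis coprime_imp_gcd_eq_1 mult.commute)
  \<comment> \<open>\<open>x\<close> is an inverse of \<open>k\<close> modulo p, so \<open>m\<close>
    shifts turn the polygon by 2 k m units \<open>pi / p\<close>, and this is -2 (j div 2) modulo 2
    p. Of \<open>j\<close> only \<open>j mod 2\<close> remains.\<close>
  define m where "m = nat ((- (j div 2) * x) mod int p)"
  have m: "int m = (- (j div 2) * x) mod int p" using p0 by (simp add: m_def)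
  obtain l where l: "int m = - (j div 2) * x + int p * l"
    using m by (metis minus_mult_div_eq_mod uminus_add_conv_diff add.commute mult_minus_right)
  have "k * int m = - (j div 2) * (k * x) + int p * (k * l)" by (simp add: l algebra_simps)
  also have "k * x = 1 - int p * y" using xy by simp
  finally have km: "k * int m = - (j div 2) + int p * (k * l + (j div 2) * y)" by (simp add: algebra_simps)
  define w where "w = k * l + (j div 2) * y"
  have j: "j = 2 * (j div 2) + j mod 2" by simp
  have "real_of_int j + 2 * real m * of_int k = of_int (j + 2 * (k * int m))" by simp
  also have "j + 2 * (k * int m) = j mod 2 + 2 * int p * w" unfolding km w_def[symmetric] using j by (simp add: algebra_simps)
  finally have e: "real_of_int j + 2 * real m * of_int k = of_int (j mod 2) + 2 * real p * of_int w" by simp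
  have "pi * of_int j / real p + real m * (2 * pi * of_int k / real p) = pi * (real_of_int j + 2 * real m * of_int k) / real p"
    using p0 by (simp add: field_simps)
  also have "\<dots> = pi * of_int (j mod 2) / real p + 2 * pi * of_int w"
    unfolding e using p0 by (simp add: field_simps)
  finally have "rotate m (points p (regular p k (pi * of_int j / real p))) = points p (regular p k (pi * of_int (j mod 2) / real p))"
    unfolding rotate_points_regular[OF p0] by (simp only: points_regular_2pi)
  then show ?thesis using dihedral_orbit_rotate by metis
qed

section \<open>Regular polygons on the wavy curve, their Hessians and their number\<close>

context slightly_wavy_circle
begin

definition radius :: "real \<Rightarrow> real" where
  "radius t = sqrt (1 + \<epsilon>\<^sup>2 + 2 * \<epsilon> * cos (real p * t))"

lemma radius_pos: "0 < 1 + \<epsilon>\<^sup>2 + 2 * \<epsilon> * cos (real p * t)"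
proof -
  have "4 * \<epsilon> * 1 \<le> 4 * \<epsilon> * N" using \<epsilon>(1) by (intro mult_left_mono) auto
  then have "\<epsilon> < 1" using \<epsilon> by linarith
  then have "0 < (1 - \<epsilon>)\<^sup>2" by simp
  moreover have "2 * \<epsilon> * (- 1) \<le> 2 * \<epsilon> * cos (real p * t)" using \<epsilon>(1) by (intro mult_left_mono) auto
  ultimately show ?thesis by (simp add: power2_eq_square algebra_simps)
qed

lemma norm_g: "norm (g (cis t)) = radius t"
proof -
  have "g (cis t) = cis t * (1 + of_real \<epsilon> * cis (real p * t))"
    by (simp add: wavy_map_def distrib_left Complex.DeMoivre[symmetric])
  then have "norm (g (cis t)) = norm (1 + of_real \<epsilon> * cis (real p * t))" by (simp add: norm_mult)
  also have "\<dots> = sqrt ((1 + \<epsilon> * cos (real p * t))\<^sup>2 + (\<epsilon> * sin (real p * t))\<^sup>2)" by (simp add: cmod_def)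
  also have "(1 + \<epsilon> * cos (real p * t))\<^sup>2 + (\<epsilon> * sin (real p * t))\<^sup>2
      = 1 + \<epsilon>\<^sup>2 * ((sin (real p * t))\<^sup>2 + (cos (real p * t))\<^sup>2) + 2 * \<epsilon> * cos (real p * t)"
    by (simp only: power2_eq_square) (simp only: algebra_simps)
  finally show ?thesis by (simp add: radius_def)
qed

lemma cis_winding: "cis (2 * pi * of_int k / real p) ^ p = 1"
proof -
  have "cis (2 * pi * of_int k / real p) ^ p = cis (0 + 2 * pi * of_int k)"
    using p by (simp add: Complex.DeMoivre)
  then show ?thesis by (simp only: cis_add_2pi_int cis_zero)
qed

lemma len_regular: "len p (regular p k t) = real p * norm (1 - cis (2 * pi * of_int k / real p)) * radius t"
proof -
  let ?\<omega> = "cis (2 * pi * of_int k / real p)"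
  have "D (regular p k t i) (regular p k t (i + 1)) = norm (1 - ?\<omega>) * radius t" for i
  proof -
    let ?z = "cis (regular p k t i)"
    have r: "regular p k t (i + 1) = 2 * pi * of_int k / real p + regular p k t i"
      by (simp add: regular_def distrib_left add_divide_distrib)
    have "D (regular p k t i) (regular p k t (i + 1)) = norm (g ?z - ?\<omega> * g ?z)"
      unfolding D_wavy r cis_mult[symmetric] wavy_map_rotate[OF cis_winding] ..
    also have "\<dots> = norm (1 - ?\<omega>) * norm (g ?z)" by (simp only: norm_mult[symmetric] left_diff_distrib mult_1)
    also have "norm (g ?z) = radius t"
    proof -
      have "real p * regular p k t i = real p * t + 2 * pi * of_int (k * i)" using p by (simp add: regular_def field_simps)
      then have "cis (real p * regular p k t i) = cis (real p * t)" by (simp only: cis_add_2pi_int)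
      then have "cos (real p * regular p k t i) = cos (real p * t)" by (metis cis.simps(1))
      then show ?thesis by (simp add: norm_g radius_def)
    qed
    finally show ?thesis .
  qed
  then show ?thesis by (simp add: len_def)
qed

definition amplitude :: "int \<Rightarrow> real" where
  "amplitude k = norm (1 - cis (2 * pi * of_int k / real p)) * \<epsilon> * real p"

lemma amplitude_pos:
  assumes "0 < k" "k < int p" shows "0 < amplitude k"
proof -
  have "cis 0 \<noteq> cis (2 * pi * of_int k / real p)"
  proof (rule cis_neq_if_between)
    have "of_int k / real p < 1" using assms by (simp add: divide_less_eq_1)
    then have "2 * pi * (of_int k / real p) < 2 * pi * 1" by (intro mult_strict_left_mono) auto
    then show "2 * pi * of_int k / real p < 0 + 2 * pi" by simp
  qed (use assms p in simp)
  then show ?thesis using \<epsilon>(1) p by (simp add: amplitude_def)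
qed

text \<open>By the rotational symmetry all components of the gradient are equal, and their sum is
  the derivative of the length in t, for which \<open>len_regular\<close> is explicit.\<close>

lemma grad_regular:
  assumes k: "0 < k" "k < int p"
  shows "grad (regular p k t) i = - amplitude k * sin (real p * t) / radius t"
proof -
  let ?\<theta> = "regular p k t"
  have op: "?\<theta> \<in> open_lifts p k" by (rule regular_open[OF k])
  have p0: "0 < real p" using p by simp
  have eq: "grad ?\<theta> j = grad ?\<theta> 0" for j
  proof -
    define \<alpha> where "\<alpha> = 2 * pi * of_int k * of_int j / real p"
    have "real p * \<alpha> = 0 + 2 * pi * of_int (k * j)" using p0 by (simp add: \<alpha>_def)
    then have \<alpha>: "cis (real p * \<alpha>) = 1" by (simp only: cis_add_2pi_int cis_zero)
    have "?\<theta> (j + i) = ?\<theta> i + \<alpha>" for i by (simp add: regular_def \<alpha>_def distrib_left add_divide_distrib)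
    from this[of 0] this[of 1] this[of "-1"] show ?thesis
      unfolding grad_T[OF op] by (simp add: T_rotate[OF \<alpha>])
  qed
  have qp: "quasi_periodic p k ?\<theta>" using op by (simp add: open_lifts_def)
  have "((\<lambda>x. len p (\<lambda>i. ?\<theta> i + x * 1)) has_real_derivative (\<Sum>i<p. 1 * grad (\<lambda>i. ?\<theta> i + 0 * 1) (int i))) (at 0)"
    using D_open_lifts(1)[OF op] by (intro has_derivative_len[where a = "\<lambda>_. 1", OF qp]) (auto simp: less_imp_neq[symmetric])
  moreover have "(\<lambda>i. ?\<theta> i + x * 1) = regular p k (t + x)" for x by (simp add: regular_def fun_eq_iff)
  ultimately have "((\<lambda>x. len p (regular p k (t + x))) has_real_derivative (\<Sum>i<p. grad ?\<theta> (int i))) (at 0)"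
    by simp
  moreover have "(\<Sum>i<p. grad ?\<theta> (int i)) = (\<Sum>i<p. grad ?\<theta> 0)" by (intro sum.cong eq refl)
  ultimately have 1: "((\<lambda>x. len p (regular p k (t + x))) has_real_derivative real p * grad ?\<theta> 0) (at 0)" by simp
  let ?c = "real p * norm (1 - cis (2 * pi * of_int k / real p))"
  have "((\<lambda>x. 1 + \<epsilon>\<^sup>2 + 2 * \<epsilon> * cos (real p * (t + x))) has_real_derivative 2 * \<epsilon> * (- sin (real p * (t + 0)) * real p)) (at 0)"
    by (auto intro!: derivative_eq_intros)
  then have "((\<lambda>x. radius (t + x)) has_real_derivative
      2 * \<epsilon> * (- sin (real p * (t + 0)) * real p) * (inverse (radius (t + 0)) / 2)) (at 0)"
    unfolding radius_def using radius_pos[of "t + 0"] by (auto intro!: derivative_eq_intros)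
  then have "((\<lambda>x. len p (regular p k (t + x))) has_real_derivative
      ?c * (2 * \<epsilon> * (- sin (real p * (t + 0)) * real p) * (inverse (radius (t + 0)) / 2))) (at 0)"
    unfolding len_regular by (rule DERIV_cmult)
  from DERIV_unique[OF 1 this]
  have "real p * grad ?\<theta> 0 = ?c * (2 * \<epsilon> * (- sin (real p * t) * real p) * (inverse (radius t) / 2))" by (simp only: add_0_right)
  moreover have "P * n * (2 * e * (- s * P) * (r / 2)) = P * (- (n * e * P) * s * r)" for P n e s r :: real by simp
  ultimately have "real p * grad ?\<theta> 0 = real p * (- amplitude k * sin (real p * t) / radius t)"
    unfolding amplitude_def divide_inverse[of _ "radius t"] by (simp only:)
  then have "grad ?\<theta> 0 = - amplitude k * sin (real p * t) / radius t"
    by (rule mult_left_cancel[THEN iffD1, rotated]) (use p0 in simp)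
  then show ?thesis using eq[of i] by simp
qed

lemma critical_imp_regular:
  assumes \<theta>: "\<theta> \<in> open_lifts p k" "critical \<theta>"
  obtains j :: int where "\<theta> = regular p k (pi * of_int j / real p)"
proof -
  have k: "0 < k" "k < int p" using open_lifts_winding[OF \<theta>(1)] p by auto
  have reg: "\<theta> = regular p k (\<theta> 0)" by (rule critical_regular[OF \<theta>])
  then have "grad (regular p k (\<theta> 0)) 0 = 0" using \<theta>(2) by (simp add: critical_def)
  then have "sin (real p * \<theta> 0) = 0"
    using amplitude_pos[OF k] radius_pos[of "\<theta> 0"] by (simp add: grad_regular[OF k] radius_def)
  then obtain j :: int where "real p * \<theta> 0 = of_int j * pi" by (auto simp: sin_zero_iff_int2)
  then have "\<theta> 0 = pi * of_int j / real p" using p by (simp add: field_simps)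
  then show ?thesis using that reg by metis
qed

text \<open>Both hypotheses of \<open>nondegenerate_if\<close> hold at a critical regular polygon.
  Along translations \<open>grad_regular\<close> is differentiated at a simple zero of the sine. On
  variations of mean zero, \<open>grad_monotone\<close> passes to the derivative.\<close>

lemma morse_length_wavy: "morse_length p 2 (wavy p \<epsilon>)"
  unfolding morse_length_def
proof (intro ballI impI)
  fix xs assume xs: "xs \<in> admissible_tuples p" and crit0: "critical_at_origin p (local_length 2 (wavy p \<epsilon>) xs)"
  have p0: "0 < p" using p by simp
  obtain k \<theta> where \<theta>: "\<theta> \<in> open_lifts p k" "points p \<theta> = xs" using admissible_lift[OF xs p0] .
  have k: "0 < k" "k < int p" using open_lifts_winding[OF \<theta>(1) p0] by auto
  have crit: "critical \<theta>" using critical_at_origin_imp_critical[OF \<theta>(1) p0] crit0 \<theta>(2) by simp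
  have bal: "balanced \<theta>" by (rule critical_balanced[OF \<theta>(1) crit])
  obtain j :: int where reg: "\<theta> = regular p k (pi * of_int j / real p)" using critical_imp_regular[OF \<theta>(1) crit] .
  let ?t = "pi * of_int j / real p"
  have pt: "real p * ?t = of_int j * pi" using p0 by simp
  have sin0: "sin (real p * ?t) = 0" unfolding pt by (simp add: sin_zero_iff_int2)
  then have cos0: "cos (real p * ?t) \<noteq> 0" using sin_cos_squared_add[of "real p * ?t"] by auto
  \<comment> \<open>The derivative of the formula in \<open>grad_regular\<close>; since the sine
    vanishes here, the derivative of the radius does not contribute.\<close>
  define hh where "hh = - amplitude k * (cos (real p * ?t) * real p) / radius ?t"
  have "nondegenerate p (hessian_at_origin (local_length 2 (wavy p \<epsilon>) (points p \<theta>)))"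
  proof (rule nondegenerate_if[OF \<theta>(1) p0])
    show "hh \<noteq> 0"
      using amplitude_pos[OF k] cos0 p0 radius_pos[of ?t] by (simp add: hh_def radius_def)
    fix i assume "i < p"
    have "(\<lambda>x. grad (\<lambda>l. \<theta> l + x * 1) (int i)) = (\<lambda>x. - amplitude k * sin (real p * (?t + x)) / radius (?t + x))"
    proof
      fix x
      have "(\<lambda>l. \<theta> l + x * 1) = regular p k (?t + x)" by (simp add: reg regular_def fun_eq_iff)
      then show "grad (\<lambda>l. \<theta> l + x * 1) (int i) = - amplitude k * sin (real p * (?t + x)) / radius (?t + x)"
        by (simp only: grad_regular[OF k])
    qed
    moreover have "((\<lambda>x. - amplitude k * sin (real p * (?t + x)) / radius (?t + x)) has_real_derivative hh) (at 0)"
    proof -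
      have num: "((\<lambda>x. - amplitude k * sin (real p * (?t + x))) has_real_derivative - amplitude k * (cos (real p * ?t) * real p)) (at 0)"
        by (auto intro!: derivative_eq_intros)
      have r0: "radius (?t + 0) \<noteq> 0" using radius_pos[of "?t + 0"] by (simp add: radius_def)
      have den: "((\<lambda>x. radius (?t + x)) has_real_derivative
          2 * \<epsilon> * (- sin (real p * (?t + 0)) * real p) * (inverse (radius (?t + 0)) / 2)) (at 0)"
      proof -
        have "((\<lambda>x. 1 + \<epsilon>\<^sup>2 + 2 * \<epsilon> * cos (real p * (?t + x))) has_real_derivative 2 * \<epsilon> * (- sin (real p * (?t + 0)) * real p)) (at 0)"
          by (auto intro!: derivative_eq_intros)
        then show ?thesis
          unfolding radius_def using radius_pos[of "?t + 0"] by (auto intro!: derivative_eq_intros)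
      qed
      from DERIV_divide[OF num den r0] show ?thesis
        using sin0 r0 by (simp add: hh_def)
    qed
    ultimately show "grad_deriv \<theta> (int i) (\<lambda>_. 1) = hh"
      unfolding grad_deriv_def by (simp only: DERIV_imp_deriv)
  next
    fix v :: "int \<Rightarrow> real"
    assume per: "\<And>i. v (i + int p) = v i" and zero: "(\<Sum>j<p. v (int j)) = 0"
      and pos: "0 \<le> (\<Sum>j<p. v (int j) * grad_deriv \<theta> (int j) v)"
    let ?S = "\<Sum>i<p. (v (int i + 1) - v (int i))\<^sup>2"
    let ?b = "- (sqrt (1 - q\<^sup>2) / 4) * ?S"
    let ?\<xi> = "\<lambda>x i. \<theta> i + x * v i"
    let ?\<phi> = "\<lambda>x. \<Sum>j<p. v (int j) * grad (?\<xi> x) (int j)"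
    obtain \<delta> where \<delta>: "\<delta> > 0" "\<And>x. \<bar>x\<bar> < \<delta> \<Longrightarrow> ?\<xi> x \<in> open_lifts p k"
      using open_lifts_line[where a = v, OF \<theta>(1) per p0] by blast
    have "\<forall>\<^sub>F x in at 0. balanced (?\<xi> x)"
    proof -
      have "\<forall>\<^sub>F x in at 0. \<bar>cos ((?\<xi> x (int i + 1) - ?\<xi> x (int i)) / 2)\<bar> < q" for i
      proof (rule order_tendstoD(2))
        show "((\<lambda>x. \<bar>cos ((?\<xi> x (int i + 1) - ?\<xi> x (int i)) / 2)\<bar>) \<longlongrightarrow> \<bar>cos ((\<theta> (int i + 1) - \<theta> (int i)) / 2)\<bar>) (at 0)"
          by (auto intro!: tendsto_eq_intros)
        \<comment> \<open>All half-steps of a regular polygon are equal, and the cosine lies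
          strictly inside the bound \<open>q\<close>, so nearby polygons are still balanced.\<close>
        have "(\<theta> (int i + 1) - \<theta> (int i)) / 2 = pi * of_int k / real p"
          unfolding reg regular_def by (simp add: distrib_left add_divide_distrib)
        then show "\<bar>cos ((\<theta> (int i + 1) - \<theta> (int i)) / 2)\<bar> < q"
          using cos_winding_le[OF k] cos_less_q by simp
      qed
      then have "\<forall>\<^sub>F x in at 0. \<forall>i\<in>{..<p}. \<bar>cos ((?\<xi> x (int i + 1) - ?\<xi> x (int i)) / 2)\<bar> < q"
        by (intro eventually_ball_finite) auto
      then show ?thesis
      proof eventually_elim
        case (elim x)
        have qp: "quasi_periodic p k (?\<xi> x)" using \<theta>(1) per by (simp add: open_lifts_def quasi_periodic_def)
        have "\<bar>cos ((?\<xi> x (l + 1) - ?\<xi> x l) / 2)\<bar> \<le> q" for l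
        proof -
          have l: "nat (l mod int p) < p" "int (nat (l mod int p)) = l mod int p" using p0 by (auto simp: nat_less_iff)
          then have "\<bar>cos ((?\<xi> x (int (nat (l mod int p)) + 1) - ?\<xi> x (int (nat (l mod int p)))) / 2)\<bar> < q"
            using elim by blast
          then show ?thesis unfolding quasi_periodic_diff[OF qp, of l] l(2) by simp
        qed
        then show ?case by (simp add: balanced_def)
      qed
    qed
    then obtain \<delta>' where \<delta>': "\<delta>' > 0" "\<And>x. x \<noteq> 0 \<Longrightarrow> \<bar>x\<bar> < \<delta>' \<Longrightarrow> balanced (?\<xi> x)"
      unfolding eventually_at by (auto simp: dist_real_def)
    have "(?\<phi> has_real_derivative (\<Sum>j<p. v (int j) * grad_deriv \<theta> (int j) v)) (at 0)"
      by (intro DERIV_sum DERIV_cmult grad_deriv(1)[OF \<theta>(1)])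
    \<comment> \<open>A one-sided limit: for x > 0 the estimate x (phi x - phi 0) <= x^2 b from
      \<open>grad_monotone\<close> can be divided by x^2 without changing its direction.\<close>
    then have lim: "((\<lambda>x. (?\<phi> x - ?\<phi> 0) / (x - 0)) \<longlongrightarrow> (\<Sum>j<p. v (int j) * grad_deriv \<theta> (int j) v)) (at_right 0)"
      unfolding has_field_derivative_iff by (rule tendsto_within_subset) auto
    have "\<forall>\<^sub>F x in at_right 0. (?\<phi> x - ?\<phi> 0) / (x - 0) \<le> ?b"
      unfolding eventually_at_right_field
    proof (intro exI[of _ "min \<delta> \<delta>'"] conjI allI impI)
      show "0 < min \<delta> \<delta>'" using \<delta>(1) \<delta>'(1) by simp
      fix x assume x: "0 < x" "x < min \<delta> \<delta>'"
      have "(\<Sum>i<p. (?\<xi> x (int i) - \<theta> (int i)) * (grad (?\<xi> x) (int i) - grad \<theta> (int i)))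
        \<le> - (sqrt (1 - q\<^sup>2) / 4) * (\<Sum>i<p. ((?\<xi> x (int i + 1) - \<theta> (int i + 1)) - (?\<xi> x (int i) - \<theta> (int i)))\<^sup>2)"
      proof (rule grad_monotone[OF \<theta>(1) bal])
        show "?\<xi> x \<in> open_lifts p k" "balanced (?\<xi> x)" using \<delta>(2)[of x] \<delta>'(2)[of x] x by auto
        show "(\<Sum>i<p. ?\<xi> x (int i) - \<theta> (int i)) = 0" using zero by (simp add: sum_distrib_left[symmetric])
      qed
      moreover have "(\<Sum>i<p. (?\<xi> x (int i) - \<theta> (int i)) * (grad (?\<xi> x) (int i) - grad \<theta> (int i))) = x * (?\<phi> x - ?\<phi> 0)"
        by (simp add: sum_distrib_left sum_subtractf algebra_simps)
      moreover have "(\<Sum>i<p. ((?\<xi> x (int i + 1) - \<theta> (int i + 1)) - (?\<xi> x (int i) - \<theta> (int i)))\<^sup>2) = x\<^sup>2 * ?S"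
        by (simp add: sum_distrib_left power_mult_distrib[symmetric] algebra_simps)
      ultimately have "x * (?\<phi> x - ?\<phi> 0) \<le> - (sqrt (1 - q\<^sup>2) / 4) * (x\<^sup>2 * ?S)" by (simp only:)
      then have "x * (?\<phi> x - ?\<phi> 0) \<le> x * (x * ?b)" by (simp add: power2_eq_square algebra_simps)
      then have "?\<phi> x - ?\<phi> 0 \<le> x * ?b" by (rule mult_left_le_imp_le[OF _ x(1)])
      then show "(?\<phi> x - ?\<phi> 0) / (x - 0) \<le> ?b" using x by (simp add: pos_divide_le_eq mult.commute)
    qed
    from tendsto_upperbound[OF lim this] have "(\<Sum>j<p. v (int j) * grad_deriv \<theta> (int j) v) \<le> ?b" by simp
    then have "0 \<le> ?b" using pos by linarith
    then show "v = (\<lambda>_. 0)" by (rule mean_zero_constant[OF per zero])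
  qed
  then show "nondegenerate p (hessian_at_origin (local_length 2 (wavy p \<epsilon>) xs))" using \<theta>(2) by simp
qed

text \<open>Reversal brings the winding number into {1..h} with p = 2 h + 1, and
  \<open>regular_orbit_parity\<close> brings the starting angle to 0 or \<open>pi / p\<close>, so 2
  h = p - 1 orbits remain.\<close>

lemma trajectory_count_le:
  assumes "prime p" "odd p" shows "trajectory_count p 2 (wavy p \<epsilon>) \<le> enat (p - 1)"
proof -
  define h where "h = (p - 1) div 2"
  have h: "p = 2 * h + 1" using assms(2) by (auto simp: h_def elim!: oddE)
  have p0: "0 < p" using p by simp
  define F where "F = (\<lambda>(k, b). dihedral_orbit (points p (regular p (int k) (pi * of_int b / real p))))"
  have sub: "dihedral_orbit ` billiard_trajectories p 2 (wavy p \<epsilon>) \<subseteq> F ` ({1..h} \<times> {0, 1})"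
  proof (rule image_subsetI)
    fix xs assume xs: "xs \<in> billiard_trajectories p 2 (wavy p \<epsilon>)"
    then have "xs \<in> admissible_tuples p" by (simp add: billiard_trajectories_def)
    then obtain k \<theta> where \<theta>: "\<theta> \<in> open_lifts p k" "points p \<theta> = xs" using admissible_lift[OF _ p0] by metis
    have k: "0 < k" "k < int p" using open_lifts_winding[OF \<theta>(1) p0] by auto
    have "critical \<theta>" using points_trajectory_iff[OF \<theta>(1) p0] xs \<theta>(2) by simp
    then obtain j :: int where reg: "\<theta> = regular p k (pi * of_int j / real p)" using critical_imp_regular[OF \<theta>(1)] by blast
    have "\<exists>l i. 0 < l \<and> l \<le> int h \<and> points p (regular p l (pi * of_int i / real p)) \<in> dihedral_orbit xs"
    proof (cases "k \<le> int h")
      case True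
      then show ?thesis using k reg \<theta>(2) dihedral_orbit.base by blast
    next
      case False
      have "rev xs \<in> dihedral_orbit xs" by (intro dihedral_orbit.intros)
      \<comment> \<open>The reversed polygon also starts at a multiple of \<open>pi / p\<close>, so
        the parity argument applies to it.\<close>
      moreover have "pi * of_int j / real p + 2 * pi * of_int (int p - k) / real p = pi * of_int (j + 2 * (int p - k)) / real p"
        by (simp add: add_divide_distrib distrib_left)
      ultimately have "points p (regular p (int p - k) (pi * of_int (j + 2 * (int p - k)) / real p)) \<in> dihedral_orbit xs"
        using rev_points_regular[OF p0, of k "pi * of_int j / real p"] reg \<theta>(2) by simp
      moreover have "0 < int p - k" "int p - k \<le> int h" using k False h by auto
      ultimately show ?thesis by blast
    qed
    then obtain l i where l: "0 < l" "l \<le> int h" "points p (regular p l (pi * of_int i / real p)) \<in> dihedral_orbit xs" by blast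
    have "l < int p" using l(2) h by simp
    from regular_orbit_parity[OF assms(1) l(1) this, of i]
    have "points p (regular p l (pi * of_int (i mod 2) / real p)) \<in> dihedral_orbit xs"
      by (rule dihedral_orbit_trans[OF l(3)])
    from dihedral_orbit_eq[OF this] have "dihedral_orbit xs = F (nat l, i mod 2)" using l(1) by (simp add: F_def)
    moreover have "(nat l, i mod 2) \<in> {1..h} \<times> {0, 1}" using l(1,2) by auto
    ultimately show "dihedral_orbit xs \<in> F ` ({1..h} \<times> {0, 1})" by (rule image_eqI)
  qed
  have fin: "finite (F ` ({1..h} \<times> {0, 1}))" by simp
  have "card (dihedral_orbit ` billiard_trajectories p 2 (wavy p \<epsilon>)) \<le> card (F ` ({1..h} \<times> {0, 1}))"
    by (rule card_mono[OF fin sub])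
  also have "\<dots> \<le> card ({1..h} \<times> {0, 1 :: int})" by (rule card_image_le) simp
  also have "\<dots> = h * 2" by (simp only: card_cartesian_product card_atLeastAtMost) simp
  also have "\<dots> = p - 1" using h by simp
  finally show ?thesis using finite_subset[OF sub fin] by (simp add: trajectory_count_def ecard_def)
qed

end

section \<open>Choice of the parameter and conclusion\<close>

lemma ex_slightly_wavy_circle:
  assumes "3 \<le> p" shows "\<exists>\<epsilon>. slightly_wavy_circle p \<epsilon>"
proof -
  define c where "c = cos (pi / real p)"
  define s where "s = sqrt (1 - ((1 + c) / 2)\<^sup>2)"
  define N where "N = real (Suc p)"
  have pp: "0 < real p" using assms by simp
  have c: "0 \<le> c" "c < 1"
  proof -
    have b: "0 < pi / real p" "pi / real p \<le> pi / 2" using assms by (auto simp: field_simps)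
    have "cos (pi / real p) < cos 0" by (intro cos_monotone_0_pi) (use b pi_gt_zero in linarith)+
    then show "c < 1" by (simp add: c_def)
    show "0 \<le> c" unfolding c_def using b by (intro cos_ge_zero) auto
  qed
  have "((1 + c) / 2)\<^sup>2 < 1" using c by (simp add: power_less_one_iff)
  then have s: "0 < s" by (simp add: s_def)
  have N: "0 < N" by (simp add: N_def)
  \<comment> \<open>The three conditions on the parameter solved for it; with \<open>kappa\<close> =
    9 eps N^2 the coefficients are 36 = 4 * 9 and 288 = 32 * 9.\<close>
  define \<epsilon> where "\<epsilon> = Min {1 / (4 * N), (1 - c) / (36 * N\<^sup>2 * real p), s / (288 * N\<^sup>2 * (real p)\<^sup>2)}"
  have "\<epsilon> \<le> 1 / (4 * N)" "\<epsilon> \<le> (1 - c) / (36 * N\<^sup>2 * real p)" "\<epsilon> \<le> s / (288 * N\<^sup>2 * (real p)\<^sup>2)"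
    by (simp_all add: \<epsilon>_def)
  then have e: "\<epsilon> * (4 * N) \<le> 1" "\<epsilon> * (36 * N\<^sup>2 * real p) \<le> 1 - c" "\<epsilon> * (288 * N\<^sup>2 * (real p)\<^sup>2) \<le> s"
    using N pp by (simp_all add: pos_le_divide_eq)
  have pos: "0 < \<epsilon>" using N pp c(2) s by (simp add: \<epsilon>_def)
  interpret wavy_circle p \<epsilon>
    by unfold_locales (use assms pos e(1) in \<open>simp_all add: N_def algebra_simps\<close>)
  have "slightly_wavy_circle p \<epsilon>"
  proof unfold_locales
    show "4 * kappa * real p \<le> 1 - cos (pi / real p)"
      using e(2) unfolding kappa_def N_def[symmetric] c_def by (simp add: algebra_simps)
    show "32 * kappa * (real p)\<^sup>2 \<le> sqrt (1 - ((1 + cos (pi / real p)) / 2)\<^sup>2)"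
      using e(3) unfolding kappa_def N_def[symmetric] s_def c_def by (simp add: algebra_simps)
  qed
  then show ?thesis ..
qed

theorem theorem2:
  fixes p :: nat
  assumes "prime p" and "odd p"
  shows "BT_circle p = enat (p - 1)"
proof -
  have p: "3 \<le> p" using assms prime_ge_2_nat[of p] by (cases "p = 2") auto
  obtain \<epsilon> where "slightly_wavy_circle p \<epsilon>" using ex_slightly_wavy_circle[OF p] by blast
  then interpret slightly_wavy_circle p \<epsilon> .
  let ?A = "{trajectory_count p n e | n e. smooth_embedding n e \<and> morse_length p n e}"
  have "trajectory_count p 2 (wavy p \<epsilon>) \<in> ?A" using smooth_embedding_wavy morse_length_wavy by blast
  then have "BT_circle p \<le> trajectory_count p 2 (wavy p \<epsilon>)" unfolding BT_circle_def by (rule Inf_lower)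
  also have "\<dots> \<le> enat (p - 1)" by (rule trajectory_count_le[OF assms])
  finally have "BT_circle p \<le> enat (p - 1)" .
  moreover have "enat (p - 1) \<le> BT_circle p"
    unfolding BT_circle_def
  proof (rule Inf_greatest)
    fix x assume "x \<in> ?A"
    then obtain n e where "smooth_embedding n e" "x = trajectory_count p n e" by blast
    then show "enat (p - 1) \<le> x"
      using embedded_circle.trajectory_count_ge[OF embedded_circle.intro assms(2) p] by simp
  qed
  ultimately show ?thesis by (rule antisym)
qed
end
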